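(* Let $p$ be a prime and let $G$ be a generalized Golod-Shafarevich pro-$p$ group. For $m\in\mathbb{N}$ let $a_m(G)$ denote the number of open subgroups of index $m$ in $G$. Then there exists a constant $\beta=\beta(G)>0$ such that $$\log_2(\log_2(a_m(G)))\ \ge\ (\log_2 m)^{\beta}$$ for infinitely many values of $m$.
   Context: Fix a prime $p$. A (pro-$p$) presentation is a pair $(X,R)$ with $X=\{x_1,\dots,x_n\}$ a finite set and $R$ a countable subset of the free pro-$p$ group $F(X)$; it defines the pro-$p$ group $F(X)/\langle R\rangle^{F(X)}$ (quotient by the closed normal subgroup generated by $R$). Let $U=\{u_1,\dots,u_n\}$ and embed $F(X)$ in the unit group of $\mathbb{F}_p\langle\langle U\rangle\rangle$ (non-commutative power series) by $x_i\mapsto 1+u_i$. A degree function $D:F(X)\to\mathbb{N}\cup\{\infty\}$ on $(F(X),X)$ is a function of the form $D(f)=d(f-1)$, where $d$ is a degree function on $\mathbb{F}_p\langle\langle U\rangle\rangle$, i.e. $d:\mathbb{F}_p\langle\langle U\rangle\rangle\to\mathbb{Z}_{\ge0}\cup\{\infty\}$ satisfies: $d(f)=\infty$ iff $f=0$; $d(f)=0$ iff $f$ is invertible; $d(fg)=d(f)+d(g)$; and if $f=\sum_\alpha c_\alpha m_\alpha$ with $c_\alpha\in\mathbb{F}_p$ and distinct monomials $m_\alpha$, then $d(f)=\min\{d(m_\alpha):c_\alpha\ne0\}$. A presentation $(X,R)$ satisfies the generalized Golod-Shafarevich (GGS) condition if there are a degree function $D$ on $(F(X),X)$ and $t_0\in(0,1)$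 with $1-\sum_{x\in X}t_0^{D(x)}+\sum_{r\in R}t_0^{D(r)}<0$ (with $t_0^\infty=0$). A pro-$p$ group is generalized Golod-Shafarevich (GGS) if it has a presentation satisfying the GGS condition. *)

theory Defs
  imports
    "HOL-Analysis.Analysis"
    "HOL-Algebra.Coset"
    "HOL-Number_Theory.Residues"
begin

section \<open>Pro-$p$ groups\<close>

locale topological_group = group G
  for G :: "('a, 'm) monoid_scheme" (structure) +
  fixes T :: "'a topology"
  assumes topspace_eq: "topspace T = carrier G"
    and continuous_mult: "continuous_map (prod_topology T T) T (\<lambda>(x, y). x \<otimes> y)"
    and continuous_inv: "continuous_map T T (\<lambda>x. inv x)"

locale pro_p_group = topological_group G T
  for p :: nat and G :: "('a, 'm) monoid_scheme" (structure) and T :: "'a topology" +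
  assumes compact: "compact_space T"
    and Hausdorff: "Hausdorff_space T"
    and totally_disconnected: "\<And>S. connectedin T S \<Longrightarrow> \<exists>a. S \<subseteq> {a}"
    and p_power_index: "\<And>N. N \<lhd> G \<Longrightarrow> openin T N \<Longrightarrow> \<exists>k. card (rcosets N) = p ^ k"

definition closed_normal_closure ::
    "('a, 'm) monoid_scheme \<Rightarrow> 'a topology \<Rightarrow> 'a set \<Rightarrow> 'a set" where
  "closed_normal_closure G T R = \<Inter> {N. N \<lhd> G \<and> closedin T N \<and> R \<subseteq> N}"

text \<open>The quotient topology on \<^term>\<open>G Mod N\<close>.\<close>

definition coset_topology ::
    "('a, 'm) monoid_scheme \<Rightarrow> 'a topology \<Rightarrow> 'a set \<Rightarrow> 'a set topology" where
  "coset_topology G T N = topology (\<lambda>\<U>. \<U> \<subseteq> carrier (G Mod N) \<and>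
     openin T {x \<in> carrier G. N #>\<^bsub>G\<^esub> x \<in> \<U>})"

lemma openin_coset_topology:
  "openin (coset_topology G T N) \<U> \<longleftrightarrow>
     \<U> \<subseteq> carrier (G Mod N) \<and> openin T {x \<in> carrier G. N #>\<^bsub>G\<^esub> x \<in> \<U>}"
proof -
  have inter: "openin T {x \<in> carrier G. N #>\<^bsub>G\<^esub> x \<in> \<U> \<inter> \<V>}"
    if "openin T {x \<in> carrier G. N #>\<^bsub>G\<^esub> x \<in> \<U>}" "openin T {x \<in> carrier G. N #>\<^bsub>G\<^esub> x \<in> \<V>}"
    for \<U> \<V>
  proof -
    have "{x \<in> carrier G. N #>\<^bsub>G\<^esub> x \<in> \<U> \<inter> \<V>}
        = {x \<in> carrier G. N #>\<^bsub>G\<^esub> x \<in> \<U>} \<inter> {x \<in> carrier G. N #>\<^bsub>G\<^esub> x \<in> \<V>}"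
      by blast
    then show ?thesis using that by (simp add: openin_Int)
  qed
  have union: "openin T {x \<in> carrier G. N #>\<^bsub>G\<^esub> x \<in> \<Union>\<K>}"
    if "\<forall>\<U>\<in>\<K>. openin T {x \<in> carrier G. N #>\<^bsub>G\<^esub> x \<in> \<U>}" for \<K>
  proof -
    have "{x \<in> carrier G. N #>\<^bsub>G\<^esub> x \<in> \<Union>\<K>}
        = (\<Union>\<U>\<in>\<K>. {x \<in> carrier G. N #>\<^bsub>G\<^esub> x \<in> \<U>})"
      by blast
    then show ?thesis using that by (auto intro!: openin_Union)
  qed
  have "istopology (\<lambda>\<U>. \<U> \<subseteq> carrier (G Mod N) \<and>
     openin T {x \<in> carrier G. N #>\<^bsub>G\<^esub> x \<in> \<U>})"
    unfolding istopology_def using inter union by (intro conjI allI impI) blast+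
  then show ?thesis
    unfolding coset_topology_def by simp
qed

section \<open>Non-commutative power series\<close>

text \<open>
  Power series over \<open>R\<close> in indeterminates \<open>u\<^sub>x\<close>, \<open>x \<in> X\<close>.  A word
  \<open>[x\<^sub>1, \<dots>, x\<^sub>k] \<in> lists X\<close> stands for the monomial
  \<open>u\<^bsub>x\<^sub>1\<^esub> \<cdots> u\<^bsub>x\<^sub>k\<^esub>\<close>, and a series is its
  (extensional) family of coefficients.
\<close>

definition nc_power_series :: "('r, 'm) ring_scheme \<Rightarrow> 'x set \<Rightarrow> ('x list \<Rightarrow> 'r) ring" where
  "nc_power_series R X =
    \<lparr>carrier = lists X \<rightarrow>\<^sub>E carrier R,
     monoid.mult = \<lambda>f g. \<lambda>w\<in>lists X.
       \<Oplus>\<^bsub>R\<^esub>i\<in>{..length w}. f (take i w) \<otimes>\<^bsub>R\<^esub> g (drop i w),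
     one = \<lambda>w\<in>lists X. if w = [] then \<one>\<^bsub>R\<^esub> else \<zero>\<^bsub>R\<^esub>,
     zero = \<lambda>w\<in>lists X. \<zero>\<^bsub>R\<^esub>,
     add = \<lambda>f g. \<lambda>w\<in>lists X. f w \<oplus>\<^bsub>R\<^esub> g w\<rparr>"

definition nc_monom :: "('r, 'm) ring_scheme \<Rightarrow> 'x set \<Rightarrow> 'x list \<Rightarrow> 'x list \<Rightarrow> 'r" where
  "nc_monom R X v = (\<lambda>w\<in>lists X. if w = v then \<one>\<^bsub>R\<^esub> else \<zero>\<^bsub>R\<^esub>)"

definition nc_power_series_topology ::
    "('r, 'm) ring_scheme \<Rightarrow> 'x set \<Rightarrow> ('x list \<Rightarrow> 'r) topology" where
  "nc_power_series_topology R X =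
     product_topology (\<lambda>w. discrete_topology (carrier R)) (lists X)"

lemma topspace_nc_power_series_topology:
  "topspace (nc_power_series_topology R X) = carrier (nc_power_series R X)"
  by (simp add: nc_power_series_topology_def nc_power_series_def)

context ring
begin

definition conv :: "('x list \<Rightarrow> 'a) \<Rightarrow> ('x list \<Rightarrow> 'a) \<Rightarrow> 'x list \<Rightarrow> 'a" where
  "conv f g w = (\<Oplus>i\<in>{..length w}. f (take i w) \<otimes> g (drop i w))"

lemma conv_term_closed:
  assumes "f \<in> lists X \<rightarrow> carrier R" "g \<in> lists X \<rightarrow> carrier R" "w \<in> lists X"
  shows "f (take i w) \<otimes> g (drop i w) \<in> carrier R"
proof -
  have "take i w \<in> lists X" "drop i w \<in> lists X"
    using assms(3) by (auto dest: in_set_takeD in_set_dropD)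
  then show ?thesis using assms(1,2) by blast
qed

lemma conv_closed:
  assumes "f \<in> lists X \<rightarrow> carrier R" "g \<in> lists X \<rightarrow> carrier R" "w \<in> lists X"
  shows "conv f g w \<in> carrier R"
  unfolding conv_def by (rule finsum_closed) (use conv_term_closed[OF assms] in blast)

lemma conv_Nil:
  assumes "f \<in> lists X \<rightarrow> carrier R" "g \<in> lists X \<rightarrow> carrier R"
  shows "conv f g [] = f [] \<otimes> g []"
  using conv_term_closed[OF assms, of "[]" 0] by (simp add: conv_def)

lemma conv_Cons:
  assumes "f \<in> lists X \<rightarrow> carrier R" "g \<in> lists X \<rightarrow> carrier R" "x # w \<in> lists X"
  shows "conv f g (x # w) = conv (\<lambda>v. f (x # v)) g w \<oplus> f [] \<otimes> g (x # w)"
proof -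
  have "conv f g (x # w) = (\<Oplus>i\<in>{..Suc (length w)}. f (take i (x # w)) \<otimes> g (drop i (x # w)))"
    by (simp add: conv_def)
  also have "\<dots> = (\<Oplus>i\<in>{..length w}. f (take (Suc i) (x # w)) \<otimes> g (drop (Suc i) (x # w)))
      \<oplus> f (take 0 (x # w)) \<otimes> g (drop 0 (x # w))"
    by (rule finsum_Suc2) (use conv_term_closed[OF assms] in blast)
  finally show ?thesis by (simp add: conv_def)
qed

lemma conv_cong:
  assumes "f \<in> lists X \<rightarrow> carrier R" "g \<in> lists X \<rightarrow> carrier R" "w \<in> lists X"
    and "\<And>v. v \<in> lists X \<Longrightarrow> f v = f' v" "\<And>v. v \<in> lists X \<Longrightarrow> g v = g' v"
  shows "conv f g w = conv f' g' w"
proof -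
  have "take i w \<in> lists X" "drop i w \<in> lists X" for i
    using assms(3) by (auto dest: in_set_takeD in_set_dropD)
  then show ?thesis
    unfolding conv_def using conv_term_closed[OF assms(1-3)] assms(4,5)
    by (intro finsum_cong') auto
qed

lemma conv_add_left:
  assumes "f \<in> lists X \<rightarrow> carrier R" "f' \<in> lists X \<rightarrow> carrier R" "g \<in> lists X \<rightarrow> carrier R"
    "w \<in> lists X"
  shows "conv (\<lambda>v. f v \<oplus> f' v) g w = conv f g w \<oplus> conv f' g w"
proof -
  have sub: "take i w \<in> lists X" "drop i w \<in> lists X" for i
    using assms(4) by (auto dest: in_set_takeD in_set_dropD)
  have cl: "f (take i w) \<in> carrier R" "f' (take i w) \<in> carrier R" "g (drop i w) \<in> carrier R" for i
    using sub[of i] assms by blast+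
  have "conv (\<lambda>v. f v \<oplus> f' v) g w
      = (\<Oplus>i\<in>{..length w}. f (take i w) \<otimes> g (drop i w) \<oplus> f' (take i w) \<otimes> g (drop i w))"
    unfolding conv_def by (intro finsum_cong') (auto simp: cl l_distr)
  also have "\<dots> = conv f g w \<oplus> conv f' g w"
    unfolding conv_def by (intro finsum_addf) (auto simp: cl)
  finally show ?thesis .
qed

lemma conv_add_right:
  assumes "f \<in> lists X \<rightarrow> carrier R" "g \<in> lists X \<rightarrow> carrier R" "g' \<in> lists X \<rightarrow> carrier R"
    "w \<in> lists X"
  shows "conv f (\<lambda>v. g v \<oplus> g' v) w = conv f g w \<oplus> conv f g' w"
proof -
  have sub: "take i w \<in> lists X" "drop i w \<in> lists X" for i
    using assms(4) by (auto dest: in_set_takeD in_set_dropD)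
  have cl: "f (take i w) \<in> carrier R" "g (drop i w) \<in> carrier R" "g' (drop i w) \<in> carrier R" for i
    using sub[of i] assms by blast+
  have "conv f (\<lambda>v. g v \<oplus> g' v) w
      = (\<Oplus>i\<in>{..length w}. f (take i w) \<otimes> g (drop i w) \<oplus> f (take i w) \<otimes> g' (drop i w))"
    unfolding conv_def by (intro finsum_cong') (auto simp: cl r_distr)
  also have "\<dots> = conv f g w \<oplus> conv f g' w"
    unfolding conv_def by (intro finsum_addf) (auto simp: cl)
  finally show ?thesis .
qed

lemma conv_scale_left:
  assumes "a \<in> carrier R" "f \<in> lists X \<rightarrow> carrier R" "g \<in> lists X \<rightarrow> carrier R" "w \<in> lists X"
  shows "conv (\<lambda>v. a \<otimes> f v) g w = a \<otimes> conv f g w"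
proof -
  have sub: "take i w \<in> lists X" "drop i w \<in> lists X" for i
    using assms(4) by (auto dest: in_set_takeD in_set_dropD)
  have cl: "f (take i w) \<in> carrier R" "g (drop i w) \<in> carrier R" for i
    using sub[of i] assms by blast+
  have "conv (\<lambda>v. a \<otimes> f v) g w = (\<Oplus>i\<in>{..length w}. a \<otimes> (f (take i w) \<otimes> g (drop i w)))"
    unfolding conv_def by (intro finsum_cong') (auto simp: cl m_assoc assms(1))
  also have "\<dots> = a \<otimes> conv f g w"
    unfolding conv_def by (intro finsum_rdistr[symmetric]) (auto simp: cl assms(1))
  finally show ?thesis .
qed

lemma conv_assoc:
  assumes "f \<in> lists X \<rightarrow> carrier R" "g \<in> lists X \<rightarrow> carrier R" "h \<in> lists X \<rightarrow> carrier R"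
    "w \<in> lists X"
  shows "conv (conv f g) h w = conv f (conv g h) w"
  using assms(1,4)
proof (induction w arbitrary: f)
  case Nil
  have fg: "conv f g \<in> lists X \<rightarrow> carrier R" and gh: "conv g h \<in> lists X \<rightarrow> carrier R"
    using conv_closed Nil.prems(1) assms(2,3) by blast+
  have "f [] \<in> carrier R" "g [] \<in> carrier R" "h [] \<in> carrier R"
    using Nil.prems(1) assms(2,3) by auto
  then show ?case
    using conv_Nil[OF fg assms(3)] conv_Nil[OF Nil.prems(1) gh] conv_Nil[OF Nil.prems(1) assms(2)]
      conv_Nil[OF assms(2,3)] by (simp add: m_assoc)
next
  case (Cons x w)
  have x: "x \<in> X" and w: "w \<in> lists X" using Cons.prems(2) by auto
  define fx where "fx = (\<lambda>v. f (x # v))"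
  define gx where "gx = (\<lambda>v. g (x # v))"
  have fx: "fx \<in> lists X \<rightarrow> carrier R" and gx: "gx \<in> lists X \<rightarrow> carrier R"
    unfolding fx_def gx_def using Cons.prems(1) assms(2) x by (auto simp: Pi_iff simp del: in_lists_conv_set intro!: lists.Cons)
  have fg: "conv f g \<in> lists X \<rightarrow> carrier R" and gh: "conv g h \<in> lists X \<rightarrow> carrier R"
    and fxg: "conv fx g \<in> lists X \<rightarrow> carrier R"
    using conv_closed Cons.prems(1) assms(2,3) fx by blast+
  have f0: "f [] \<in> carrier R" and g0: "g [] \<in> carrier R" and hx: "h (x # w) \<in> carrier R"
    using Cons.prems assms(2,3) by (blast intro: lists.Nil)+
  have f0gx: "(\<lambda>v. f [] \<otimes> gx v) \<in> lists X \<rightarrow> carrier R" using gx f0 by auto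
  have sum: "(\<lambda>v. conv fx g v \<oplus> f [] \<otimes> gx v) \<in> lists X \<rightarrow> carrier R"
    using fxg f0gx by auto
  have cl: "conv fx (conv g h) w \<in> carrier R" "conv gx h w \<in> carrier R"
    using conv_closed[OF fx gh w] conv_closed[OF gx assms(3) w] by auto
  have step: "conv (\<lambda>v. conv f g (x # v)) h w = conv (\<lambda>v. conv fx g v \<oplus> f [] \<otimes> gx v) h w"
  proof (rule conv_cong[OF _ assms(3) w])
    show "(\<lambda>v. conv f g (x # v)) \<in> lists X \<rightarrow> carrier R"
      using fg x by (auto simp: Pi_iff simp del: in_lists_conv_set intro!: lists.Cons)
    show "conv f g (x # v) = conv fx g v \<oplus> f [] \<otimes> gx v" if "v \<in> lists X" for v
      using conv_Cons[OF Cons.prems(1) assms(2) lists.Cons[OF x that]]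
      by (simp add: fx_def gx_def)
  qed auto
  have "conv (conv f g) h (x # w)
      = conv (\<lambda>v. conv f g (x # v)) h w \<oplus> conv f g [] \<otimes> h (x # w)"
    by (rule conv_Cons[OF fg assms(3) Cons.prems(2)])
  also have "\<dots> = (conv (conv fx g) h w \<oplus> f [] \<otimes> conv gx h w) \<oplus> (f [] \<otimes> g []) \<otimes> h (x # w)"
    unfolding step conv_add_left[OF fxg f0gx assms(3) w] conv_scale_left[OF f0 gx assms(3) w]
      conv_Nil[OF Cons.prems(1) assms(2)] ..
  also have "\<dots> = conv fx (conv g h) w \<oplus> f [] \<otimes> (conv gx h w \<oplus> g [] \<otimes> h (x # w))"
    unfolding Cons.IH[OF fx w] using cl f0 g0 hx by (simp add: r_distr m_assoc a_assoc)
  also have "\<dots> = conv f (conv g h) (x # w)"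
    unfolding conv_Cons[OF Cons.prems(1) gh Cons.prems(2)] fx_def
      conv_Cons[OF assms(2,3) Cons.prems(2)] gx_def ..
  finally show ?case .
qed

lemma conv_one_left:
  assumes "f \<in> lists X \<rightarrow> carrier R" "w \<in> lists X"
  shows "conv (\<lambda>v. if v = [] then \<one> else \<zero>) f w = f w"
proof -
  have "drop i w \<in> lists X" for i
    using assms(2) by (auto dest: in_set_dropD)
  then have sub: "f (drop i w) \<in> carrier R" for i
    using assms(1) by blast
  have "conv (\<lambda>v. if v = [] then \<one> else \<zero>) f w
      = (\<Oplus>i\<in>{..length w}. if 0 = i then f (drop i w) else \<zero>)"
    unfolding conv_def using sub sub[of 0] by (intro finsum_cong') auto
  also have "\<dots> = f (drop 0 w)"
    by (rule add.finprod_singleton) (auto simp: sub)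
  finally show ?thesis by simp
qed

lemma conv_one_right:
  assumes "f \<in> lists X \<rightarrow> carrier R" "w \<in> lists X"
  shows "conv f (\<lambda>v. if v = [] then \<one> else \<zero>) w = f w"
proof -
  have "take i w \<in> lists X" for i
    using assms(2) by (auto dest: in_set_takeD)
  then have sub: "f (take i w) \<in> carrier R" for i
    using assms(1) by blast
  have "conv f (\<lambda>v. if v = [] then \<one> else \<zero>) w
      = (\<Oplus>i\<in>{..length w}. if length w = i then f (take i w) else \<zero>)"
    unfolding conv_def using sub sub[of "length w"] by (intro finsum_cong') auto
  also have "\<dots> = f (take (length w) w)"
    by (rule add.finprod_singleton) (auto simp: sub)
  finally show ?thesis by simp
qed

lemma mult_nc_power_series:
  "f \<otimes>\<^bsub>nc_power_series R X\<^esub> g = restrict (conv f g) (lists X)"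
  by (simp add: nc_power_series_def conv_def[abs_def])

lemma ring_nc_power_series: "ring (nc_power_series R X)"
proof (rule ringI)
  let ?S = "nc_power_series R X"
  have carr: "carrier ?S = lists X \<rightarrow>\<^sub>E carrier R"
    by (simp add: nc_power_series_def)
  have add: "f \<oplus>\<^bsub>?S\<^esub> g = (\<lambda>w\<in>lists X. f w \<oplus> g w)" for f g
    by (simp add: nc_power_series_def)
  have one: "\<one>\<^bsub>?S\<^esub> = (\<lambda>w\<in>lists X. if w = [] then \<one> else \<zero>)"
    by (simp add: nc_power_series_def)
  have zero: "\<zero>\<^bsub>?S\<^esub> = (\<lambda>w\<in>lists X. \<zero>)"
    by (simp add: nc_power_series_def)
  have pi: "f \<in> lists X \<rightarrow> carrier R" if "f \<in> carrier ?S" for f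
    using that by (auto simp: carr)
  have cl: "f w \<in> carrier R" if "f \<in> carrier ?S" "w \<in> lists X" for f w
    using pi[OF that(1)] that(2) by blast
  have ext: "f = g" if "f \<in> carrier ?S" "g \<in> carrier ?S" "\<And>w. w \<in> lists X \<Longrightarrow> f w = g w" for f g
    using that by (intro extensionalityI[of f "lists X" g]) (auto simp: carr PiE_def)
  have addc: "f \<oplus>\<^bsub>?S\<^esub> g \<in> carrier ?S" if "f \<in> carrier ?S" "g \<in> carrier ?S" for f g
    using cl[OF that(1)] cl[OF that(2)] by (auto simp: add carr)
  have multc: "f \<otimes>\<^bsub>?S\<^esub> g \<in> carrier ?S" if "f \<in> carrier ?S" "g \<in> carrier ?S" for f g
    using conv_closed[OF pi[OF that(1)] pi[OF that(2)]]
    unfolding mult_nc_power_series carr by auto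
  have onec: "\<one>\<^bsub>?S\<^esub> \<in> carrier ?S" and zeroc: "\<zero>\<^bsub>?S\<^esub> \<in> carrier ?S"
    by (auto simp: one zero carr)
  show "abelian_group ?S"
  proof (rule abelian_groupI)
    fix f assume f: "f \<in> carrier ?S"
    have m: "(\<lambda>w\<in>lists X. \<ominus> f w) \<in> carrier ?S" using cl[OF f] by (auto simp: carr)
    have "(\<lambda>w\<in>lists X. \<ominus> f w) \<oplus>\<^bsub>?S\<^esub> f = \<zero>\<^bsub>?S\<^esub>"
      by (rule ext[OF addc[OF m f] zeroc]) (simp add: add zero l_neg cl[OF f] del: in_lists_conv_set)
    then show "\<exists>g\<in>carrier ?S. g \<oplus>\<^bsub>?S\<^esub> f = \<zero>\<^bsub>?S\<^esub>" using m by blast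
  next
    fix f g h assume "f \<in> carrier ?S" "g \<in> carrier ?S" "h \<in> carrier ?S"
    then show "f \<oplus>\<^bsub>?S\<^esub> g \<oplus>\<^bsub>?S\<^esub> h = f \<oplus>\<^bsub>?S\<^esub> (g \<oplus>\<^bsub>?S\<^esub> h)"
      by (intro ext addc) (auto simp: add a_assoc cl)
  next
    fix f g assume "f \<in> carrier ?S" "g \<in> carrier ?S"
    then show "f \<oplus>\<^bsub>?S\<^esub> g = g \<oplus>\<^bsub>?S\<^esub> f"
      by (intro ext addc) (auto simp: add a_comm cl)
  next
    fix f assume "f \<in> carrier ?S"
    then show "\<zero>\<^bsub>?S\<^esub> \<oplus>\<^bsub>?S\<^esub> f = f"
      by (intro ext addc zeroc) (auto simp: add zero cl)
  qed (use addc zeroc in auto)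
  show "Group.monoid ?S"
  proof (rule monoidI)
    fix f g h assume fgh: "f \<in> carrier ?S" "g \<in> carrier ?S" "h \<in> carrier ?S"
    note c = pi[OF fgh(1)] pi[OF fgh(2)] pi[OF fgh(3)]
    have fg: "conv f g \<in> lists X \<rightarrow> carrier R" and gh: "conv g h \<in> lists X \<rightarrow> carrier R"
      using conv_closed c by blast+
    show "f \<otimes>\<^bsub>?S\<^esub> g \<otimes>\<^bsub>?S\<^esub> h = f \<otimes>\<^bsub>?S\<^esub> (g \<otimes>\<^bsub>?S\<^esub> h)"
    proof (rule ext)
      fix w assume w: "w \<in> lists X"
      have "(f \<otimes>\<^bsub>?S\<^esub> g \<otimes>\<^bsub>?S\<^esub> h) w = conv (restrict (conv f g) (lists X)) h w"
        using w by (simp add: mult_nc_power_series)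
      also have "\<dots> = conv (conv f g) h w"
        by (rule conv_cong[OF _ c(3) w]) (use fg in auto)
      also have "\<dots> = conv f (conv g h) w" by (rule conv_assoc[OF c w])
      also have "\<dots> = conv f (restrict (conv g h) (lists X)) w"
        by (rule conv_cong[OF c(1) gh w]) auto
      finally show "(f \<otimes>\<^bsub>?S\<^esub> g \<otimes>\<^bsub>?S\<^esub> h) w = (f \<otimes>\<^bsub>?S\<^esub> (g \<otimes>\<^bsub>?S\<^esub> h)) w"
        using w by (simp add: mult_nc_power_series)
    qed (intro multc fgh)+
  next
    fix f assume f: "f \<in> carrier ?S"
    have e: "(\<lambda>v. if v = [] then \<one> else \<zero>) \<in> lists X \<rightarrow> carrier R" by auto
    show "\<one>\<^bsub>?S\<^esub> \<otimes>\<^bsub>?S\<^esub> f = f"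
    proof (rule ext)
      fix w assume w: "w \<in> lists X"
      have "conv (\<one>\<^bsub>?S\<^esub>) f w = conv (\<lambda>v. if v = [] then \<one> else \<zero>) f w"
        by (rule conv_cong[OF pi[OF onec] pi[OF f] w]) (auto simp: one)
      then show "(\<one>\<^bsub>?S\<^esub> \<otimes>\<^bsub>?S\<^esub> f) w = f w"
        using w conv_one_left[OF pi[OF f] w] by (simp add: mult_nc_power_series)
    qed (intro multc onec f)+
    show "f \<otimes>\<^bsub>?S\<^esub> \<one>\<^bsub>?S\<^esub> = f"
    proof (rule ext)
      fix w assume w: "w \<in> lists X"
      have "conv f (\<one>\<^bsub>?S\<^esub>) w = conv f (\<lambda>v. if v = [] then \<one> else \<zero>) w"
        by (rule conv_cong[OF pi[OF f] pi[OF onec] w]) (auto simp: one)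
      then show "(f \<otimes>\<^bsub>?S\<^esub> \<one>\<^bsub>?S\<^esub>) w = f w"
        using w conv_one_right[OF pi[OF f] w] by (simp add: mult_nc_power_series)
    qed (intro multc onec f)+
  qed (use multc onec in auto)
  fix f g h assume fgh: "f \<in> carrier ?S" "g \<in> carrier ?S" "h \<in> carrier ?S"
  note c = pi[OF fgh(1)] pi[OF fgh(2)] pi[OF fgh(3)]
  show "(f \<oplus>\<^bsub>?S\<^esub> g) \<otimes>\<^bsub>?S\<^esub> h = f \<otimes>\<^bsub>?S\<^esub> h \<oplus>\<^bsub>?S\<^esub> g \<otimes>\<^bsub>?S\<^esub> h"
  proof (rule ext)
    fix w assume w: "w \<in> lists X"
    have "conv (f \<oplus>\<^bsub>?S\<^esub> g) h w = conv (\<lambda>v. f v \<oplus> g v) h w"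
      by (rule conv_cong[OF pi[OF addc[OF fgh(1,2)]] c(3) w]) (auto simp: add)
    then show "((f \<oplus>\<^bsub>?S\<^esub> g) \<otimes>\<^bsub>?S\<^esub> h) w = (f \<otimes>\<^bsub>?S\<^esub> h \<oplus>\<^bsub>?S\<^esub> g \<otimes>\<^bsub>?S\<^esub> h) w"
      using w conv_add_left[OF c w] by (simp add: mult_nc_power_series) (simp add: add)
  qed (intro multc addc fgh)+
  show "h \<otimes>\<^bsub>?S\<^esub> (f \<oplus>\<^bsub>?S\<^esub> g) = h \<otimes>\<^bsub>?S\<^esub> f \<oplus>\<^bsub>?S\<^esub> h \<otimes>\<^bsub>?S\<^esub> g"
  proof (rule ext)
    fix w assume w: "w \<in> lists X"
    have "conv h (f \<oplus>\<^bsub>?S\<^esub> g) w = conv h (\<lambda>v. f v \<oplus> g v) w"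
      by (rule conv_cong[OF c(3) pi[OF addc[OF fgh(1,2)]] w]) (auto simp: add)
    then show "(h \<otimes>\<^bsub>?S\<^esub> (f \<oplus>\<^bsub>?S\<^esub> g)) w = (h \<otimes>\<^bsub>?S\<^esub> f \<oplus>\<^bsub>?S\<^esub> h \<otimes>\<^bsub>?S\<^esub> g) w"
      using w conv_add_right[OF c(3,1,2) w] by (simp add: mult_nc_power_series) (simp add: add)
  qed (intro multc addc fgh)+
qed

end

section \<open>Free pro-$p$ groups and degree functions\<close>

text \<open>
  A type of the cardinality of the continuum.  Up to isomorphism it carries every finitely
  generated pro-$p$ group; for instance \<open>\<F>\<^sub>p\<langle>\<langle>U\<rangle>\<rangle>\<close> with \<open>U\<close> indexed by natural numbers, and
  hence (by the Magnus embedding) the free pro-$p$ groups of finite rank, consist of elements of it.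
\<close>

type_synonym continuum = "nat list \<Rightarrow> int"

text \<open>
  The universal property needs to be tested only on targets carried by
  \<^typ>\<open>continuum\<close>: a map from a finite set into a pro-$p$ group takes values in
  the finitely generated closed subgroup generated by its image.
\<close>

locale free_pro_p_group = pro_p_group p F T
  for p :: nat and F :: "'a monoid" (structure) and T :: "'a topology" +
  fixes X :: "'a set"
  assumes finite_basis: "finite X"
    and basis_subset: "X \<subseteq> carrier F"
    and universal: "\<And>(H :: continuum monoid) T\<^sub>H f. pro_p_group p H T\<^sub>H \<Longrightarrow> f \<in> X \<rightarrow> carrier H \<Longrightarrow>
      \<exists>!\<phi>. \<phi> \<in> hom F H \<inter> extensional (carrier F) \<and> continuous_map T T\<^sub>H \<phi> \<and> (\<forall>x\<in>X. \<phi> x = f x)"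

locale pro_p_presentation = free_pro_p_group p F T X
  for p :: nat and F :: "'a monoid" (structure) and T :: "'a topology" and X :: "'a set" +
  fixes R :: "'a set"
  assumes countable_relators: "countable R"
    and relators_subset: "R \<subseteq> carrier F"

definition presented_by ::
    "'g monoid \<Rightarrow> 'g topology \<Rightarrow> 'a monoid \<Rightarrow> 'a topology \<Rightarrow> 'a set \<Rightarrow> bool" where
  "presented_by G T\<^sub>G F T R \<longleftrightarrow> (let N = closed_normal_closure F T R in
     \<exists>\<phi>\<in>iso (F Mod N) G. homeomorphic_map (coset_topology F T N) T\<^sub>G \<phi>)"

abbreviation Fp_series :: "nat \<Rightarrow> 'x set \<Rightarrow> ('x list \<Rightarrow> int) ring" where
  "Fp_series p X \<equiv> nc_power_series (residue_ring (int p)) X"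

definition magnus_embedding ::
    "nat \<Rightarrow> 'a monoid \<Rightarrow> 'a topology \<Rightarrow> 'a set \<Rightarrow> ('a \<Rightarrow> 'a list \<Rightarrow> int) \<Rightarrow> bool" where
  "magnus_embedding p F T X \<mu> \<longleftrightarrow>
     \<mu> \<in> hom F (units_of (Fp_series p X)) \<and>
     inj_on \<mu> (carrier F) \<and>
     continuous_map T (nc_power_series_topology (residue_ring (int p)) X) \<mu> \<and>
     (\<forall>x\<in>X. \<mu> x = \<one>\<^bsub>Fp_series p X\<^esub> \<oplus>\<^bsub>Fp_series p X\<^esub> nc_monom (residue_ring (int p)) X [x])"

text \<open>
  In the last clause the infimum in \<^typ>\<open>enat\<close> is attained, being that of a set of
  extended naturals, unless \<open>f\<close> is zero, when it is \<open>\<infinity>\<close>.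
\<close>

definition series_degree_function :: "nat \<Rightarrow> 'x set \<Rightarrow> (('x list \<Rightarrow> int) \<Rightarrow> enat) \<Rightarrow> bool" where
  "series_degree_function p X d \<longleftrightarrow> (let S = Fp_series p X in
     (\<forall>f\<in>carrier S. d f = \<infinity> \<longleftrightarrow> f = \<zero>\<^bsub>S\<^esub>) \<and>
     (\<forall>f\<in>carrier S. d f = 0 \<longleftrightarrow> f \<in> Units S) \<and>
     (\<forall>f\<in>carrier S. \<forall>g\<in>carrier S. d (f \<otimes>\<^bsub>S\<^esub> g) = d f + d g) \<and>
     (\<forall>f\<in>carrier S. d f = (INF w\<in>{w \<in> lists X. f w \<noteq> \<zero>\<^bsub>residue_ring (int p)\<^esub>}.
        d (nc_monom (residue_ring (int p)) X w))))"

definition degree_function ::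
    "nat \<Rightarrow> 'a monoid \<Rightarrow> 'a topology \<Rightarrow> 'a set \<Rightarrow> ('a \<Rightarrow> enat) \<Rightarrow> bool" where
  "degree_function p F T X D \<longleftrightarrow> (\<exists>\<mu> d. magnus_embedding p F T X \<mu> \<and>
     series_degree_function p X d \<and>
     (\<forall>f\<in>carrier F. D f = d (\<mu> f \<ominus>\<^bsub>Fp_series p X\<^esub> \<one>\<^bsub>Fp_series p X\<^esub>)))"

section \<open>Generalized Golod-Shafarevich groups\<close>

definition enat_power :: "real \<Rightarrow> enat \<Rightarrow> real" where
  "enat_power t e = (case e of enat k \<Rightarrow> t ^ k | \<infinity> \<Rightarrow> 0)"

text \<open>
  Summability is part of the condition: a divergent series of relators counts as
  \<open>\<infinity>\<close>, whereas \<^const>\<open>infsum\<close> would yield 0.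
\<close>

definition GGS_condition ::
    "nat \<Rightarrow> 'a monoid \<Rightarrow> 'a topology \<Rightarrow> 'a set \<Rightarrow> 'a set \<Rightarrow> bool" where
  "GGS_condition p F T X R \<longleftrightarrow> (\<exists>D t\<^sub>0. degree_function p F T X D \<and> 0 < t\<^sub>0 \<and> t\<^sub>0 < 1 \<and>
     (\<lambda>r. enat_power t\<^sub>0 (D r)) summable_on R \<and>
     1 - (\<Sum>x\<in>X. enat_power t\<^sub>0 (D x)) + (\<Sum>\<^sub>\<infinity>r\<in>R. enat_power t\<^sub>0 (D r)) < 0)"

definition GGS_group :: "nat \<Rightarrow> 'g monoid \<Rightarrow> 'g topology \<Rightarrow> bool" where
  "GGS_group p G T\<^sub>G \<longleftrightarrow> pro_p_group p G T\<^sub>G \<and>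
     (\<exists>(F :: continuum monoid) T X R. pro_p_presentation p F T X R \<and>
        presented_by G T\<^sub>G F T R \<and> GGS_condition p F T X R)"

definition num_open_subgroups :: "'g monoid \<Rightarrow> 'g topology \<Rightarrow> nat \<Rightarrow> nat" where
  "num_open_subgroups G T m =
     card {H. subgroup H G \<and> openin T H \<and> card (rcosets\<^bsub>G\<^esub> H) = m}"

end

theory Submission
  imports
    Defs
    "HOL-Algebra.Generated_Groups"
    "HOL-Algebra.Multiplicative_Group"
    "HOL-Library.Infinite_Set"
begin

text \<open>
  Call a function \<open>F \<rightarrow> \<F>\<^sub>p\<close> of degree \<open>< m\<close> if it is a combination of coefficients of the Magnus
  expansion at words of \<open>D\<close>-weight \<open>< m\<close>, write \<open>(\<Delta>\<^sub>g \<phi>)(f) = \<phi>(f g) - \<phi>(f)\<close>, and let \<open>D\<^sub>n\<close> be the common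
  stabiliser of the relator-invariant functions of degree \<open>< n\<close>.  For a subgroup \<open>S\<close> containing the relators,
  \<open>\<phi> \<mapsto> (\<phi>(1), (\<Delta>\<^sub>x \<phi>)\<^sub>x)\<close> maps the functions of degree \<open>< i\<close> with \<open>S\<close>-invariant derivatives bijectively to
  \<open>\<F>\<^sub>p\<close> times the product over \<open>x \<in> X\<close> of the spaces of \<open>S\<close>-invariant functions of degree \<open>< i - D(x)\<close>,
  while imposing \<open>\<Delta>\<^sub>r \<phi> = 0\<close> costs at most the dimension of the \<open>S\<close>-invariant functions of degree
  \<open>< i - D(r)\<close>.

  For \<open>R\<close>-invariant functions these dimension inequalities, summed against \<open>t\<^sup>i\<close>, show that
  \<open>\<Sum> c\<^sub>i t\<^sup>i\<close> diverges for \<open>t\<close> slightly below \<open>t\<^sub>0\<close>, where \<open>c\<^sub>i\<close> is the dimension of \<open>D\<^sub>i / D\<^bsub>i+1\<^esub>\<close>; hence the partial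
  sums of \<open>\<Sum> c\<^sub>i t\<^sub>0\<^sup>i\<close> up to \<open>n\<close> exceed \<open>\<kappa>\<^sup>n\<close> infinitely often for some \<open>\<kappa> > 1\<close>.  For \<open>S = D\<^sub>n\<close> the functions surviving the
  conditions at the relators restrict to affine functions on \<open>D\<^sub>n\<close>, and the inequality bounds the
  dimension of \<open>Hom(D\<^sub>n, \<F>\<^sub>p)\<close> below by a multiple of \<open>\<Prod> (1 + t\<^sub>0\<^sup>i)\<close>, each \<open>i < n\<close> taken \<open>c\<^sub>i\<close> times, since this
  is a lower bound for the weighted count of functions on \<open>F / D\<^sub>n\<close>.  So \<open>D\<^sub>n\<close> has doubly
  exponentially many (in \<open>\<kappa>\<^sup>n\<close>) subgroups of index \<open>p\<close>, whereas \<open>log\<^sub>p [F : D\<^sub>n] \<le> (|X| + 1)\<^sup>n\<close>.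
\<close>

section \<open>Functions of bounded degree on a group with Magnus coefficients\<close>

text \<open>The functions of degree < m are the linear functionals on power series truncated at
  weight m, read on F, and the relator-invariant ones are dual to the truncated completed group
  algebra of G. Dualising replaces ideals and quotient algebras by restrictions of functions, and
  dimensions by logarithms of cardinalities. The inequality for S = D_n is a weighted Schreier rank
  formula: dim Hom(D_n, F_p) - 1 is at least \<delta> times the weighted size of F / D_n, where
  \<delta> > 0 is the margin in the GGS condition. It says much only if that size grows fast. A step
  of index p inside D_i / D_(i+1) multiplies the weighted size by a factor between 1 + t^i and 1 /
  (1 - t^i): the upper estimate, for relator-invariant functions, proves divergence; the lower one
  drives the growth. Divergence at t0 itself would not force exponential growth of partial sums.
  Strictness of the GGS condition moves it to some t1 < t0, and the ratio supplies \<kappa> = sqrt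
  (t0 / t1). The exponent \<beta> is half of ln \<kappa> / ln (|X| + 1), the other half absorbing
  constants.\<close>

text \<open>\<open>\<nu> w f\<close> stands for the coefficient at the monomial \<open>w\<close> of the Magnus expansion of \<open>f\<close>.
  Functions with values in \<open>\<F>\<^sub>p\<close> are represented by integer-valued ones up to congruence.\<close>

locale magnus_coefficients = group F for F :: "('a, 'b) monoid_scheme" (structure) +
  fixes p :: nat and X :: "'a set" and D :: "'a \<Rightarrow> nat" and \<nu> :: "'a list \<Rightarrow> 'a \<Rightarrow> int"
  assumes prime_p: "prime p"
    and finite_X: "finite X"
    and X_subset: "X \<subseteq> carrier F"
    and D_pos: "x \<in> X \<Longrightarrow> D x > 0"
    and nu_mult: "w \<in> lists X \<Longrightarrow> f \<in> carrier F \<Longrightarrow> g \<in> carrier F \<Longrightarrow>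
      [\<nu> w (f \<otimes> g) = (\<Sum>i\<le>length w. \<nu> (take i w) f * \<nu> (drop i w) g)] (mod (int p))"
    and nu_one: "w \<in> lists X \<Longrightarrow> [\<nu> w \<one> = of_bool (w = [])] (mod (int p))"
    and nu_gen: "x \<in> X \<Longrightarrow> w \<in> lists X \<Longrightarrow> [\<nu> w x = of_bool (w = []) + of_bool (w = [x])] (mod (int p))"
    and nu_Nil: "f \<in> carrier F \<Longrightarrow> [\<nu> [] f = 1] (mod (int p))"
    and dense: "f \<in> carrier F \<Longrightarrow>
      \<exists>g\<in>generate F X. \<forall>w\<in>lists X. length w < n \<longrightarrow> [\<nu> w f = \<nu> w g] (mod (int p))"
begin

definition weight :: "'a list \<Rightarrow> nat" where "weight w = sum_list (map D w)"

definition words :: "nat \<Rightarrow> 'a list set" where "words m = {w \<in> lists X. weight w < m}"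

abbreviation eqp :: "('a \<Rightarrow> int) \<Rightarrow> ('a \<Rightarrow> int) \<Rightarrow> bool" (infix "\<doteq>" 50) where
  "\<phi> \<doteq> \<psi> \<equiv> (\<forall>f\<in>carrier F. [\<phi> f = \<psi> f] (mod (int p)))"

definition comb :: "nat \<Rightarrow> ('a list \<Rightarrow> int) \<Rightarrow> 'a \<Rightarrow> int" where
  "comb m l f = (\<Sum>w\<in>words m. l w * \<nu> w f)"

text \<open>The index is a strict bound: \<open>Pol 0\<close> is zero modulo p and
  \<open>Pol 1\<close> consists of the constants. Truncated subtraction in
  \<open>Pol (m - d)\<close> is therefore harmless, a function of negative degree being
  zero.\<close>

definition Pol :: "nat \<Rightarrow> ('a \<Rightarrow> int) set" where
  "Pol m = {\<phi>. \<exists>l. \<phi> \<doteq> comb m l}"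

definition Dif :: "'a \<Rightarrow> ('a \<Rightarrow> int) \<Rightarrow> 'a \<Rightarrow> int" where
  "Dif g \<phi> f = \<phi> (f \<otimes> g) - \<phi> f"

text \<open>Inserting s in the middle, rather than at an end, makes the condition stable under
  translation on both sides and equivalent to invariance under the normal closure of S.\<close>

definition Inv :: "'a set \<Rightarrow> ('a \<Rightarrow> int) set" where
  "Inv S = {\<phi>. \<forall>f\<in>carrier F. \<forall>g\<in>carrier F. \<forall>s\<in>S. [\<phi> (f \<otimes> s \<otimes> g) = \<phi> (f \<otimes> g)] (mod (int p))}"

section \<open>Words, weights and combinations of coefficients\<close>

lemma weight_simps [simp]: "weight [] = 0" "weight (x # w) = D x + weight w"
  "weight (v @ u) = weight v + weight u"
  by (simp_all add: weight_def)

lemma length_le_weight: "w \<in> lists X \<Longrightarrow> length w \<le> weight w"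
proof (induction w)
  case (Cons x w)
  then show ?case using D_pos[of x] by auto
qed auto

lemma words_0 [simp]: "words 0 = {}" by (simp add: words_def)

lemma words_subset: "words m \<subseteq> {w. set w \<subseteq> X \<and> length w \<le> m}"
  using length_le_weight by (fastforce simp: words_def)

lemma finite_words [simp]: "finite (words m)"
  using finite_subset[OF words_subset] finite_lists_length_le[OF finite_X] by auto

lemma words_mono: "m \<le> n \<Longrightarrow> words m \<subseteq> words n" by (auto simp: words_def)

lemma words_append: "v @ u \<in> words m \<longleftrightarrow> v \<in> words m \<and> u \<in> words (m - weight v)"
  by (auto simp: words_def)

lemma words_append': "v @ u \<in> words m \<longleftrightarrow> u \<in> words m \<and> v \<in> words (m - weight u)"
  by (auto simp: words_def)

lemma words_take_drop:
  assumes "w \<in> words m"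
  shows "take i w \<in> words m" "drop i w \<in> words (m - weight (take i w))"
    "drop i w \<in> words m" "take i w \<in> words (m - weight (drop i w))"
  using assms words_append[of "take i w" "drop i w"] words_append'[of "take i w" "drop i w"] by auto

lemma words_lists: "w \<in> words m \<Longrightarrow> w \<in> lists X" by (auto simp: words_def)

lemma sum_words_split:
  fixes l a b :: "'a list \<Rightarrow> int"
  shows "(\<Sum>w\<in>words m. l w * (\<Sum>i\<le>length w. a (take i w) * b (drop i w)))
       = (\<Sum>v\<in>words m. a v * (\<Sum>u\<in>words (m - weight v). l (v @ u) * b u))"
proof -
  have "(\<Sum>w\<in>words m. l w * (\<Sum>i\<le>length w. a (take i w) * b (drop i w)))
      = (\<Sum>(w,i)\<in>(SIGMA w:words m. {..length w}). l w * (a (take i w) * b (drop i w)))"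
    by (simp add: sum_distrib_left sum.Sigma)
  also have "\<dots> = (\<Sum>(v,u)\<in>(SIGMA v:words m. words (m - weight v)). a v * (l (v @ u) * b u))"
    by (rule sum.reindex_bij_witness[where i="\<lambda>(v,u). (v @ u, length v)"
          and j="\<lambda>(w,i). (take i w, drop i w)"])
      (auto simp: words_append words_take_drop)
  also have "\<dots> = (\<Sum>v\<in>words m. a v * (\<Sum>u\<in>words (m - weight v). l (v @ u) * b u))"
    by (simp add: sum_distrib_left sum.Sigma)
  finally show ?thesis .
qed

lemma sum_words_split':
  fixes l a b :: "'a list \<Rightarrow> int"
  shows "(\<Sum>w\<in>words m. l w * (\<Sum>i\<le>length w. a (take i w) * b (drop i w)))
       = (\<Sum>u\<in>words m. b u * (\<Sum>v\<in>words (m - weight u). l (v @ u) * a v))"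
proof -
  have "(\<Sum>w\<in>words m. l w * (\<Sum>i\<le>length w. a (take i w) * b (drop i w)))
      = (\<Sum>(w,i)\<in>(SIGMA w:words m. {..length w}). l w * (a (take i w) * b (drop i w)))"
    by (simp add: sum_distrib_left sum.Sigma)
  also have "\<dots> = (\<Sum>(u,v)\<in>(SIGMA u:words m. words (m - weight u)). b u * (l (v @ u) * a v))"
    by (rule sum.reindex_bij_witness[where i="\<lambda>(u,v). (v @ u, length v)"
          and j="\<lambda>(w,i). (drop i w, take i w)"])
      (auto simp: words_append' words_take_drop)
  also have "\<dots> = (\<Sum>u\<in>words m. b u * (\<Sum>v\<in>words (m - weight u). l (v @ u) * a v))"
    by (simp add: sum_distrib_left sum.Sigma)
  finally show ?thesis .
qed

lemma comb_mult_aux: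
  assumes "f \<in> carrier F" "g \<in> carrier F"
  shows "[comb m l (f \<otimes> g) = (\<Sum>w\<in>words m. l w * (\<Sum>i\<le>length w. \<nu> (take i w) f * \<nu> (drop i w) g))] (mod (int p))"
  unfolding comb_def using assms by (intro cong_sum cong_mult cong_refl nu_mult words_lists)

text \<open>Weight spent on the prefix v is lost to the function of g that multiplies
  \<open>\<nu> v f\<close>. All degree drops along differences come from this loss or from its
  mirror image below.\<close>

lemma comb_mult_left:
  assumes "f \<in> carrier F" "g \<in> carrier F"
  shows "[comb m l (f \<otimes> g) = (\<Sum>v\<in>words m. \<nu> v f * comb (m - weight v) (\<lambda>u. l (v @ u)) g)] (mod (int p))"
  using comb_mult_aux[OF assms, where m=m and l=l] sum_words_split[where l=l and m=m and a="\<lambda>v. \<nu> v f" and b="\<lambda>u. \<nu> u g"]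
  by (simp add: comb_def)

lemma comb_mult_right:
  assumes "f \<in> carrier F" "g \<in> carrier F"
  shows "[comb m l (f \<otimes> g) = (\<Sum>u\<in>words m. \<nu> u g * comb (m - weight u) (\<lambda>v. l (v @ u)) f)] (mod (int p))"
  using comb_mult_aux[OF assms, where m=m and l=l] sum_words_split'[where l=l and m=m and a="\<lambda>v. \<nu> v f" and b="\<lambda>u. \<nu> u g"]
  by (simp add: comb_def)

lemma Pol_cong: "\<phi> \<in> Pol m \<Longrightarrow> \<psi> \<doteq> \<phi> \<Longrightarrow> \<psi> \<in> Pol m"
  unfolding Pol_def by (auto intro: cong_trans)

lemma comb_Pol: "comb m l \<in> Pol m" unfolding Pol_def by (blast intro: cong_refl)

lemma Pol_0: "\<phi> \<in> Pol 0 \<longleftrightarrow> \<phi> \<doteq> (\<lambda>_. 0)"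
  by (simp add: Pol_def comb_def)

lemma Pol_mono: assumes "\<phi> \<in> Pol m" "m \<le> n" shows "\<phi> \<in> Pol n"
proof -
  obtain l where l: "\<phi> \<doteq> comb m l" using assms by (auto simp: Pol_def)
  have "comb m l f = comb n (\<lambda>w. if w \<in> words m then l w else 0) f" for f
    unfolding comb_def using words_mono[OF assms(2)]
    by (intro sum.mono_neutral_cong_left) auto
  then show ?thesis using l by (auto simp: Pol_def)
qed

lemma Pol_zero: "(\<lambda>_. 0) \<in> Pol m"
  using Pol_0[of "\<lambda>_. 0"] Pol_mono[of _ 0 m] by auto

lemma Pol_add: assumes "\<phi> \<in> Pol m" "\<psi> \<in> Pol m" shows "(\<lambda>f. \<phi> f + \<psi> f) \<in> Pol m"
proof -
  obtain l l' where "\<phi> \<doteq> comb m l" "\<psi> \<doteq> comb m l'" using assms by (auto simp: Pol_def)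
  moreover have "comb m (\<lambda>w. l w + l' w) f = comb m l f + comb m l' f" for f
    by (simp add: comb_def sum.distrib algebra_simps)
  ultimately show ?thesis unfolding Pol_def by (auto intro!: exI[of _ "\<lambda>w. l w + l' w"] cong_add)
qed

lemma Pol_scale: assumes "\<phi> \<in> Pol m" shows "(\<lambda>f. c * \<phi> f) \<in> Pol m"
proof -
  obtain l where "\<phi> \<doteq> comb m l" using assms by (auto simp: Pol_def)
  moreover have "comb m (\<lambda>w. c * l w) f = c * comb m l f" for f
    by (simp add: comb_def sum_distrib_left algebra_simps)
  ultimately show ?thesis unfolding Pol_def by (auto intro!: exI[of _ "\<lambda>w. c * l w"] cong_mult)
qed

lemma Pol_diff: assumes "\<phi> \<in> Pol m" "\<psi> \<in> Pol m" shows "(\<lambda>f. \<phi> f - \<psi> f) \<in> Pol m"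
  using Pol_add[OF assms(1) Pol_scale[OF assms(2), of "-1"]] by simp

lemma Pol_sum: "(\<And>i. i \<in> I \<Longrightarrow> \<phi> i \<in> Pol m) \<Longrightarrow> (\<lambda>f. \<Sum>i\<in>I. \<phi> i f) \<in> Pol m"
proof (induction I rule: infinite_finite_induct)
  case (insert i I)
  then show ?case using Pol_add[of "\<phi> i" m "\<lambda>f. \<Sum>i\<in>I. \<phi> i f"] by auto
qed (auto simp: Pol_zero)

lemma Pol_nu: "w \<in> words m \<Longrightarrow> \<nu> w \<in> Pol m"
proof -
  assume w: "w \<in> words m"
  have "comb m (\<lambda>v. of_bool (v = w)) f = \<nu> w f" for f
  proof -
    have "comb m (\<lambda>v. of_bool (v = w)) f = (\<Sum>v\<in>words m. if v = w then \<nu> w f else 0)"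
      unfolding comb_def by (intro sum.cong) auto
    then show ?thesis using w by simp
  qed
  then show ?thesis by (metis comb_Pol ext)
qed

lemma Pol_const: assumes "m > 0" shows "(\<lambda>_. c) \<in> Pol m"
proof -
  have "(\<lambda>f. c * \<nu> [] f) \<in> Pol m" by (intro Pol_scale Pol_nu) (use assms in \<open>simp add: words_def\<close>)
  moreover have "(\<lambda>_. c) \<doteq> (\<lambda>f. c * \<nu> [] f)"
    using cong_mult[OF cong_refl, OF cong_sym[OF nu_Nil], of _ c] by simp
  ultimately show ?thesis by (rule Pol_cong)
qed

lemma Pol_1: assumes "\<phi> \<in> Pol (Suc 0)" "f \<in> carrier F" "g \<in> carrier F"
  shows "[\<phi> f = \<phi> g] (mod (int p))"
proof -
  obtain l where l: "\<phi> \<doteq> comb (Suc 0) l" using assms by (auto simp: Pol_def)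
  have W: "words (Suc 0) = {[]}"
  proof -
    have "w = []" if "w \<in> words (Suc 0)" for w
      using that length_le_weight[of w] by (auto simp: words_def)
    then show ?thesis by (auto simp: words_def)
  qed
  have "[\<phi> f = l []] (mod (int p))" if "f \<in> carrier F" for f
    using l that cong_mult[OF cong_refl, OF nu_Nil[OF that], of "l []"]
    by (auto simp: comb_def W intro: cong_trans)
  from this[OF assms(2)] this[OF assms(3)] show ?thesis by (metis cong_sym cong_trans)
qed

lemma Pol_translate_right:
  assumes "\<phi> \<in> Pol m" "g \<in> carrier F" shows "(\<lambda>f. \<phi> (f \<otimes> g)) \<in> Pol m"
proof -
  obtain l where l: "\<phi> \<doteq> comb m l" using assms by (auto simp: Pol_def)
  have "(\<lambda>f. \<Sum>u\<in>words m. \<nu> u g * comb (m - weight u) (\<lambda>v. l (v @ u)) f) \<in> Pol m"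
    by (intro Pol_sum Pol_scale Pol_mono[OF comb_Pol]) auto
  moreover have "(\<lambda>f. \<phi> (f \<otimes> g)) \<doteq> (\<lambda>f. \<Sum>u\<in>words m. \<nu> u g * comb (m - weight u) (\<lambda>v. l (v @ u)) f)"
    using l comb_mult_right[OF _ assms(2)] assms(2) by (meson cong_trans m_closed)
  ultimately show ?thesis by (rule Pol_cong)
qed

lemma Pol_translate_left:
  assumes "\<phi> \<in> Pol m" "g \<in> carrier F" shows "(\<lambda>f. \<phi> (g \<otimes> f)) \<in> Pol m"
proof -
  obtain l where l: "\<phi> \<doteq> comb m l" using assms by (auto simp: Pol_def)
  have "(\<lambda>f. \<Sum>u\<in>words m. \<nu> u g * comb (m - weight u) (\<lambda>v. l (u @ v)) f) \<in> Pol m"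
    by (intro Pol_sum Pol_scale Pol_mono[OF comb_Pol]) auto
  moreover have "(\<lambda>f. \<phi> (g \<otimes> f)) \<doteq> (\<lambda>f. \<Sum>u\<in>words m. \<nu> u g * comb (m - weight u) (\<lambda>v. l (u @ v)) f)"
    using l comb_mult_left[OF assms(2)] assms(2) by (meson cong_trans m_closed)
  ultimately show ?thesis by (rule Pol_cong)
qed

text \<open>The term of the empty suffix cancels against \<phi>, the terms of the other suffixes of
  weight below d vanish with the coefficients of g, and every remaining term has lost weight at
  least d.\<close>

lemma Dif_Pol:
  assumes "\<phi> \<in> Pol m" "g \<in> carrier F"
    and van: "\<And>w. w \<in> lists X \<Longrightarrow> w \<noteq> [] \<Longrightarrow> weight w < d \<Longrightarrow> [\<nu> w g = 0] (mod (int p))"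
  shows "Dif g \<phi> \<in> Pol (m - d)"
proof -
  obtain l where l: "\<phi> \<doteq> comb m l" using assms by (auto simp: Pol_def)
  let ?c = "\<lambda>u. comb (m - weight u) (\<lambda>v. l (v @ u))"
  let ?W = "{u \<in> words m. d \<le> weight u \<and> u \<noteq> []}"
  have "(\<lambda>f. \<Sum>u\<in>?W. \<nu> u g * ?c u f) \<in> Pol (m - d)"
    by (intro Pol_sum Pol_scale Pol_mono[OF comb_Pol]) auto
  moreover have "Dif g \<phi> \<doteq> (\<lambda>f. \<Sum>u\<in>?W. \<nu> u g * ?c u f)"
  proof
    fix f assume f: "f \<in> carrier F"
    show "[Dif g \<phi> f = (\<Sum>u\<in>?W. \<nu> u g * ?c u f)] (mod (int p))"
    \<comment> \<open>For m = 0 the empty word is not in \<open>words m\<close>, so the term that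
      should cancel \<phi> is absent.\<close>
    proof (cases "m = 0")
      case True
      then have "[\<phi> (f \<otimes> g) = 0] (mod (int p))" "[\<phi> f = 0] (mod (int p))"
        using assms(1,2) f by (auto simp: Pol_0)
      from cong_diff[OF this] True show ?thesis by (simp add: Dif_def)
    next
      case False
      then have N: "[] \<in> words m" by (simp add: words_def)
      have "[Dif g \<phi> f = comb m l (f \<otimes> g) - comb m l f] (mod (int p))"
        unfolding Dif_def using l f assms(2) by (intro cong_diff) auto
      also have "[comb m l (f \<otimes> g) - comb m l f = (\<Sum>u\<in>words m. \<nu> u g * ?c u f) - comb m l f] (mod (int p))"
        by (intro cong_diff comb_mult_right f assms(2) cong_refl)
      also have "(\<Sum>u\<in>words m. \<nu> u g * ?c u f) - comb m l f
          = \<nu> [] g * comb m l f - comb m l f + (\<Sum>u\<in>words m - {[]}. \<nu> u g * ?c u f)"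
        using N by (subst sum.remove[OF finite_words N]) simp
      also have "[\<nu> [] g * comb m l f - comb m l f + (\<Sum>u\<in>words m - {[]}. \<nu> u g * ?c u f)
          = 1 * comb m l f - comb m l f + (\<Sum>u\<in>words m - {[]}. if d \<le> weight u then \<nu> u g * ?c u f else 0)] (mod (int p))"
      proof (intro cong_add cong_diff cong_mult cong_refl nu_Nil assms(2) cong_sum)
        fix u assume u: "u \<in> words m - {[]}"
        show "[\<nu> u g * ?c u f = (if d \<le> weight u then \<nu> u g * ?c u f else 0)] (mod (int p))"
          using van[of u] u cong_mult[of "\<nu> u g" 0 "int p" "?c u f" "?c u f"] by (auto simp: words_def)
      qed
      also have "1 * comb m l f - comb m l f + (\<Sum>u\<in>words m - {[]}. if d \<le> weight u then \<nu> u g * ?c u f else 0)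
          = (\<Sum>u\<in>?W. \<nu> u g * ?c u f)"
        by (simp add: sum.If_cases) (intro sum.cong, auto)
      finally show ?thesis .
    qed
  qed
  ultimately show ?thesis by (rule Pol_cong)
qed

lemma Dif_gen_Pol: assumes "\<phi> \<in> Pol m" "x \<in> X" shows "Dif x \<phi> \<in> Pol (m - D x)"
proof (rule Dif_Pol[OF assms(1)])
  show "x \<in> carrier F" using assms X_subset by auto
  fix w assume "w \<in> lists X" "w \<noteq> []" "weight w < D x"
  then show "[\<nu> w x = 0] (mod (int p))" using nu_gen[OF assms(2), of w] by (cases "w = [x]") auto
qed

text \<open>The expansion of x is 1 + u_x, so only the suffixes [] and [x] contribute: the
  difference along x keeps the words ending in x and deletes that letter, as a Fox derivative
  does.\<close>

lemma Dif_gen_comb: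
  assumes "x \<in> X"
  shows "Dif x (comb m l) \<doteq> comb (m - D x) (\<lambda>v. l (v @ [x]))"
proof
  fix f assume f: "f \<in> carrier F"
  let ?c = "\<lambda>u. comb (m - weight u) (\<lambda>v. l (v @ u)) f"
  have x: "x \<in> carrier F" using assms X_subset by auto
  have N: "[] \<in> words m" if "m > 0" using that by (simp add: words_def)
  have C: "comb m l f = 0" if "\<not> m > 0" using that by (simp add: comb_def)
  have S: "comb (m - D x) (\<lambda>v. l (v @ [x])) f = 0" if "[x] \<notin> words m"
    using that assms by (simp add: comb_def words_def)
  have "[comb m l (f \<otimes> x) = (\<Sum>u\<in>words m. \<nu> u x * ?c u)] (mod (int p))"
    by (rule comb_mult_right[OF f x])
  also have "[(\<Sum>u\<in>words m. \<nu> u x * ?c u)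
      = (\<Sum>u\<in>words m. (of_bool (u = []) + of_bool (u = [x])) * ?c u)] (mod (int p))"
    by (intro cong_sum cong_mult cong_refl nu_gen assms words_lists)
  also have "(\<Sum>u\<in>words m. (of_bool (u = []) + of_bool (u = [x])) * ?c u)
      = (\<Sum>u\<in>words m. if u = [] then ?c u else 0) + (\<Sum>u\<in>words m. if u = [x] then ?c u else 0)"
    by (subst sum.distrib[symmetric]) (intro sum.cong, auto)
  also have "\<dots> = comb m l f + comb (m - D x) (\<lambda>v. l (v @ [x])) f"
    using N C S by (auto simp: sum.delta)
  finally have "[comb m l (f \<otimes> x) - comb m l f
      = comb m l f + comb (m - D x) (\<lambda>v. l (v @ [x])) f - comb m l f] (mod (int p))"
    by (intro cong_diff cong_refl)
  then show "[Dif x (comb m l) f = comb (m - D x) (\<lambda>v. l (v @ [x])) f] (mod (int p))"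
    by (simp add: Dif_def)
qed

lemma left_Dif_gen_comb:
  assumes "x \<in> X" "f \<in> carrier F"
  shows "[comb m l (x \<otimes> f) - comb m l f = comb (m - D x) (\<lambda>v. l (x # v)) f] (mod (int p))"
proof -
  let ?c = "\<lambda>u. comb (m - weight u) (\<lambda>v. l (u @ v)) f"
  have x: "x \<in> carrier F" using assms X_subset by auto
  have N: "[] \<in> words m" if "m > 0" using that by (simp add: words_def)
  have C: "comb m l f = 0" if "\<not> m > 0" using that by (simp add: comb_def)
  have S: "comb (m - D x) (\<lambda>v. l (x # v)) f = 0" if "[x] \<notin> words m"
    using that assms by (simp add: comb_def words_def)
  have "[comb m l (x \<otimes> f) = (\<Sum>u\<in>words m. \<nu> u x * ?c u)] (mod (int p))"
    by (rule comb_mult_left[OF x assms(2)])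
  also have "[(\<Sum>u\<in>words m. \<nu> u x * ?c u)
      = (\<Sum>u\<in>words m. (of_bool (u = []) + of_bool (u = [x])) * ?c u)] (mod (int p))"
    by (intro cong_sum cong_mult cong_refl nu_gen assms words_lists)
  also have "(\<Sum>u\<in>words m. (of_bool (u = []) + of_bool (u = [x])) * ?c u)
      = (\<Sum>u\<in>words m. if u = [] then ?c u else 0) + (\<Sum>u\<in>words m. if u = [x] then ?c u else 0)"
    by (subst sum.distrib[symmetric]) (intro sum.cong, auto)
  also have "\<dots> = comb m l f + comb (m - D x) (\<lambda>v. l (x # v)) f"
    using N C S by (auto simp: sum.delta)
  finally have "[comb m l (x \<otimes> f) - comb m l f
      = comb m l f + comb (m - D x) (\<lambda>v. l (x # v)) f - comb m l f] (mod (int p))"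
    by (intro cong_diff cong_refl)
  then show ?thesis by simp
qed

lemma comb_one: assumes "m > 0" shows "[comb m l \<one> = l []] (mod (int p))"
proof -
  have "[comb m l \<one> = (\<Sum>w\<in>words m. l w * of_bool (w = []))] (mod (int p))"
    unfolding comb_def by (intro cong_sum cong_mult cong_refl nu_one words_lists)
  also have "(\<Sum>w\<in>words m. l w * of_bool (w = [])) = (\<Sum>w\<in>words m. if w = [] then l w else 0)"
    by (intro sum.cong) auto
  also have "\<dots> = l []"
  proof -
    have "[] \<in> words m" using assms by (simp add: words_def)
    then show ?thesis by (simp add: sum.delta)
  qed
  finally show ?thesis .
qed

text \<open>Every nonempty word has exactly one last letter, so the coefficients of the prescribed
  derivatives assemble without any compatibility condition. In the Golod-Shafarevich inequalities
  this yields the full product over X.\<close>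

lemma integrate:
  assumes "m > 0" "\<And>x. x \<in> X \<Longrightarrow> \<psi> x \<in> Pol (m - D x)"
  obtains \<zeta> where "\<zeta> \<in> Pol m" "\<And>x. x \<in> X \<Longrightarrow> Dif x \<zeta> \<doteq> \<psi> x" "[\<zeta> \<one> = c] (mod (int p))"
proof -
  have "\<forall>x. \<exists>l. x \<in> X \<longrightarrow> \<psi> x \<doteq> comb (m - D x) l" using assms(2) by (auto simp: Pol_def)
  then obtain l where l: "\<And>x. x \<in> X \<Longrightarrow> \<psi> x \<doteq> comb (m - D x) (l x)" by metis
  define L where "L w = (if w = [] then c else l (last w) (butlast w))" for w
  have "Dif x (comb m L) \<doteq> \<psi> x" if "x \<in> X" for x
  proof -
    have "Dif x (comb m L) \<doteq> comb (m - D x) (l x)"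
      using Dif_gen_comb[OF that, of m L] by (simp add: L_def)
    then show ?thesis using l[OF that] by (meson cong_sym cong_trans)
  qed
  moreover have "[comb m L \<one> = c] (mod (int p))" using comb_one[OF assms(1), of L] by (simp add: L_def)
  ultimately show ?thesis using that[OF comb_Pol] by blast
qed

text \<open>Dependence on finitely many coefficients lets statements pass from the dense subgroup
  generated by X to F. Products of functions of bounded degree have this property before their own
  degree is known, which is what \<open>Pol_mult\<close> relies on.\<close>

definition lconst :: "('a \<Rightarrow> int) \<Rightarrow> bool" where
  "lconst \<phi> \<longleftrightarrow> (\<exists>n. \<forall>f\<in>carrier F. \<forall>g\<in>carrier F.
     (\<forall>w\<in>lists X. length w < n \<longrightarrow> [\<nu> w f = \<nu> w g] (mod (int p))) \<longrightarrow> [\<phi> f = \<phi> g] (mod (int p)))"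

lemma Pol_separated:
  assumes "\<phi> \<in> Pol m" "f \<in> carrier F" "g \<in> carrier F" "\<And>w. w \<in> words m \<Longrightarrow> [\<nu> w f = \<nu> w g] (mod (int p))"
  shows "[\<phi> f = \<phi> g] (mod (int p))"
proof -
  obtain l where l: "\<phi> \<doteq> comb m l" using assms by (auto simp: Pol_def)
  have "[comb m l f = comb m l g] (mod (int p))"
    unfolding comb_def by (intro cong_sum cong_mult cong_refl assms(4))
  then show ?thesis using l assms(2,3) by (meson cong_sym cong_trans)
qed

lemma Pol_lconst: assumes "\<phi> \<in> Pol m" shows "lconst \<phi>"
  unfolding lconst_def
proof (rule exI[of _ m], intro ballI impI)
  fix f g assume fg: "f \<in> carrier F" "g \<in> carrier F"
    "\<forall>w\<in>lists X. length w < m \<longrightarrow> [\<nu> w f = \<nu> w g] (mod (int p))"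
  show "[\<phi> f = \<phi> g] (mod (int p))"
    by (rule Pol_separated[OF assms fg(1,2)])
      (use fg(3) length_le_weight in \<open>force simp: words_def\<close>)
qed

lemma lconst_comp2:
  assumes "lconst \<phi>" "lconst \<psi>"
    and h: "\<And>a b c d. [a = b] (mod (int p)) \<Longrightarrow> [c = d] (mod (int p)) \<Longrightarrow> [h a c = h b d] (mod (int p))"
  shows "lconst (\<lambda>f. h (\<phi> f) (\<psi> f))"
proof -
  obtain m where m: "\<And>f g. f \<in> carrier F \<Longrightarrow> g \<in> carrier F \<Longrightarrow>
    (\<forall>w\<in>lists X. length w < m \<longrightarrow> [\<nu> w f = \<nu> w g] (mod (int p))) \<Longrightarrow> [\<phi> f = \<phi> g] (mod (int p))"
    using assms(1) unfolding lconst_def by blast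
  obtain n where n: "\<And>f g. f \<in> carrier F \<Longrightarrow> g \<in> carrier F \<Longrightarrow>
    (\<forall>w\<in>lists X. length w < n \<longrightarrow> [\<nu> w f = \<nu> w g] (mod (int p))) \<Longrightarrow> [\<psi> f = \<psi> g] (mod (int p))"
    using assms(2) unfolding lconst_def by blast
  show ?thesis unfolding lconst_def
    by (rule exI[of _ "max m n"]) (intro ballI impI h m n; simp add: less_max_iff_disj del: in_lists_conv_set)
qed

text \<open>Vanishing derivatives along X give invariance under right multiplication by the subgroup
  generated by X, inverses included; density does the rest.\<close>

lemma lconst_vanish:
  assumes "lconst \<theta>" "\<And>x. x \<in> X \<Longrightarrow> Dif x \<theta> \<doteq> (\<lambda>_. 0)" "[\<theta> \<one> = 0] (mod (int p))"
  shows "\<theta> \<doteq> (\<lambda>_. 0)"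
proof
  fix f assume f: "f \<in> carrier F"
  have step: "[\<theta> (f \<otimes> x) = \<theta> f] (mod (int p))" if "f \<in> carrier F" "x \<in> X" for f x
    using assms(2)[OF that(2)] that(1) by (auto simp: Dif_def cong_diff_iff_cong_0)
  have gen: "\<forall>f\<in>carrier F. [\<theta> (f \<otimes> g) = \<theta> f] (mod (int p))" if "g \<in> generate F X" for g
    using that
  proof induction
    case (inv x)
    show ?case
    proof
      fix f assume f: "f \<in> carrier F"
      have x: "x \<in> carrier F" using inv X_subset by auto
      have "[\<theta> (f \<otimes> inv x \<otimes> x) = \<theta> (f \<otimes> inv x)] (mod (int p))"
        using f x inv by (intro step) auto
      then show "[\<theta> (f \<otimes> inv x) = \<theta> f] (mod (int p))" using f x by (simp add: m_assoc cong_sym)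
    qed
  next
    case (eng g h)
    have gh: "g \<in> carrier F" "h \<in> carrier F" using generate_in_carrier[OF X_subset] eng by auto
    show ?case
    proof
      fix f assume f: "f \<in> carrier F"
      have "[\<theta> (f \<otimes> g \<otimes> h) = \<theta> (f \<otimes> g)] (mod (int p))" using eng f gh by auto
      also have "[\<theta> (f \<otimes> g) = \<theta> f] (mod (int p))" using eng f by auto
      finally show "[\<theta> (f \<otimes> (g \<otimes> h)) = \<theta> f] (mod (int p))" using f gh by (simp add: m_assoc)
    qed
  qed (use step in auto)
  obtain n where n: "\<And>f g. f \<in> carrier F \<Longrightarrow> g \<in> carrier F \<Longrightarrow>
    (\<forall>w\<in>lists X. length w < n \<longrightarrow> [\<nu> w f = \<nu> w g] (mod (int p))) \<Longrightarrow> [\<theta> f = \<theta> g] (mod (int p))"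
    using assms(1) unfolding lconst_def by blast
  obtain g where g: "g \<in> generate F X" "\<forall>w\<in>lists X. length w < n \<longrightarrow> [\<nu> w f = \<nu> w g] (mod (int p))"
    using dense[OF f] by blast
  have gc: "g \<in> carrier F" using generate_in_carrier[OF X_subset g(1)] .
  have "[\<theta> f = \<theta> g] (mod (int p))" using n f gc g(2) by blast
  also have "[\<theta> g = \<theta> \<one>] (mod (int p))" using gen[OF g(1)] gc by (auto dest: bspec[of _ _ \<one>])
  finally show "[\<theta> f = 0] (mod (int p))" using assms(3) by (auto intro: cong_trans)
qed

text \<open>Subtracting an integral of the same derivatives with the same value at the identity
  leaves zero, by \<open>lconst_vanish\<close>. Thus degrees can be read off derivatives.\<close>

lemma Pol_from_Dif:
  assumes "lconst \<zeta>" "m > 0" "\<And>x. x \<in> X \<Longrightarrow> Dif x \<zeta> \<in> Pol (m - D x)"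
  shows "\<zeta> \<in> Pol m"
proof -
  obtain \<zeta>' where c: "\<zeta>' \<in> Pol m" "\<And>x. x \<in> X \<Longrightarrow> Dif x \<zeta>' \<doteq> Dif x \<zeta>" "[\<zeta>' \<one> = \<zeta> \<one>] (mod (int p))"
    using integrate[OF assms(2,3)] by metis
  have "(\<lambda>f. \<zeta> f - \<zeta>' f) \<doteq> (\<lambda>_. 0)"
  proof (rule lconst_vanish)
    show "lconst (\<lambda>f. \<zeta> f - \<zeta>' f)"
      by (rule lconst_comp2[OF assms(1) Pol_lconst[OF c(1)]]) (rule cong_diff)
    show "[\<zeta> \<one> - \<zeta>' \<one> = 0] (mod (int p))" using c(3) by (simp add: cong_diff_iff_cong_0 cong_sym)
    fix x assume x: "x \<in> X"
    have "Dif x (\<lambda>f. \<zeta> f - \<zeta>' f) = (\<lambda>f. Dif x \<zeta> f - Dif x \<zeta>' f)" by (auto simp: Dif_def)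
    then show "Dif x (\<lambda>f. \<zeta> f - \<zeta>' f) \<doteq> (\<lambda>_. 0)"
      using c(2)[OF x] by (simp add: cong_diff_iff_cong_0 cong_sym)
  qed
  then have "\<zeta> \<doteq> \<zeta>'" by (simp add: cong_diff_iff_cong_0)
  then show ?thesis using Pol_cong[OF c(1)] by blast
qed

lemma Pol_mult_0:
  assumes "\<phi> \<in> Pol 0 \<or> \<psi> \<in> Pol 0" shows "(\<lambda>f. \<phi> f * \<psi> f) \<in> Pol m"
proof (rule Pol_mono)
  show "(\<lambda>f. \<phi> f * \<psi> f) \<in> Pol 0" unfolding Pol_0
  proof
    fix f assume f: "f \<in> carrier F"
    have "[\<phi> f = 0] (mod (int p)) \<or> [\<psi> f = 0] (mod (int p))" using assms f by (auto simp: Pol_0)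
    then show "[\<phi> f * \<psi> f = 0] (mod (int p))" by (auto simp: cong_0_iff)
  qed
qed auto

text \<open>The factors have degree at most m - 1 and l - 1. Instead of expanding products of
  coefficients by shuffles, the degree is tested on derivatives: the discrete Leibniz rule expresses
  them by three products with smaller m + l. The sharp bound matters in
  \<open>count_lower_step\<close>, where i + 1 and m - i have to combine to m.\<close>

lemma Pol_mult:
  assumes "\<phi> \<in> Pol m" "\<psi> \<in> Pol l" shows "(\<lambda>f. \<phi> f * \<psi> f) \<in> Pol (m + l - 1)"
  using assms
proof (induction "m + l" arbitrary: m l \<phi> \<psi> rule: less_induct)
  case less
  show ?case
  proof (cases "m = 0 \<or> l = 0")
    case True
    then show ?thesis using less.prems Pol_mult_0 by auto
  next
    case False
    show ?thesis
    proof (rule Pol_from_Dif)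
      show "lconst (\<lambda>f. \<phi> f * \<psi> f)"
        by (rule lconst_comp2[OF Pol_lconst[OF less.prems(1)] Pol_lconst[OF less.prems(2)]]) (rule cong_mult)
      show "0 < m + l - 1" using False by auto
      fix x assume x: "x \<in> X"
      note d = Dif_gen_Pol[OF less.prems(1) x] Dif_gen_Pol[OF less.prems(2) x]
      have Dx: "D x > 0" using D_pos x by auto
      have 1: "(\<lambda>f. Dif x \<phi> f * \<psi> f) \<in> Pol (m + l - 1 - D x)"
      proof (cases "m - D x = 0")
        case True then show ?thesis using d(1) Pol_mult_0 by auto
      next
        case F: False
        show ?thesis by (rule Pol_mono[OF less.hyps[OF _ d(1) less.prems(2)]]) (use F Dx in auto)
      qed
      have 2: "(\<lambda>f. \<phi> f * Dif x \<psi> f) \<in> Pol (m + l - 1 - D x)"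
      proof (cases "l - D x = 0")
        case True then show ?thesis using d(2) Pol_mult_0 by auto
      next
        case F: False
        show ?thesis by (rule Pol_mono[OF less.hyps[OF _ less.prems(1) d(2)]]) (use F Dx in auto)
      qed
      have 3: "(\<lambda>f. Dif x \<phi> f * Dif x \<psi> f) \<in> Pol (m + l - 1 - D x)"
      proof (cases "m - D x = 0 \<or> l - D x = 0")
        case True then show ?thesis using d Pol_mult_0 by auto
      next
        case F: False
        show ?thesis by (rule Pol_mono[OF less.hyps[OF _ d(1) d(2)]]) (use F Dx in auto)
      qed
      have "Dif x (\<lambda>f. \<phi> f * \<psi> f)
          = (\<lambda>f. Dif x \<phi> f * \<psi> f + \<phi> f * Dif x \<psi> f + Dif x \<phi> f * Dif x \<psi> f)"
        by (auto simp: Dif_def algebra_simps)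
      then show "Dif x (\<lambda>f. \<phi> f * \<psi> f) \<in> Pol (m + l - 1 - D x)"
        using Pol_add[OF Pol_add[OF 1 2] 3] by simp
    qed
  qed
qed

section \<open>Invariant functions and their stabilisers\<close>

lemma InvD: "\<phi> \<in> Inv S \<Longrightarrow> f \<in> carrier F \<Longrightarrow> s \<in> S \<Longrightarrow> g \<in> carrier F \<Longrightarrow>
    [\<phi> (f \<otimes> s \<otimes> g) = \<phi> (f \<otimes> g)] (mod (int p))"
  by (auto simp: Inv_def)

lemma InvD_right: "\<phi> \<in> Inv S \<Longrightarrow> S \<subseteq> carrier F \<Longrightarrow> f \<in> carrier F \<Longrightarrow> s \<in> S \<Longrightarrow>
    [\<phi> (f \<otimes> s) = \<phi> f] (mod (int p))"
  using InvD[of \<phi> S f s \<one>] by auto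

lemma Inv_antimono: "S \<subseteq> S' \<Longrightarrow> Inv S' \<subseteq> Inv S"
  by (auto simp: Inv_def)

lemma Inv_cong: assumes "\<phi> \<in> Inv S" "\<psi> \<doteq> \<phi>" "S \<subseteq> carrier F" shows "\<psi> \<in> Inv S"
  unfolding Inv_def
proof (intro CollectI ballI)
  fix f g s assume a: "f \<in> carrier F" "g \<in> carrier F" "s \<in> S"
  then have s: "s \<in> carrier F" using assms by auto
  have "[\<psi> (f \<otimes> s \<otimes> g) = \<phi> (f \<otimes> s \<otimes> g)] (mod (int p))" "[\<psi> (f \<otimes> g) = \<phi> (f \<otimes> g)] (mod (int p))"
    using assms(2) a s by auto
  with InvD[OF assms(1) a(1,3,2)] show "[\<psi> (f \<otimes> s \<otimes> g) = \<psi> (f \<otimes> g)] (mod (int p))"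
    by (meson cong_sym cong_trans)
qed

lemma Inv_comp2:
  assumes "\<phi> \<in> Inv S" "\<psi> \<in> Inv S"
    and h: "\<And>a b c d. [a = b] (mod (int p)) \<Longrightarrow> [c = d] (mod (int p)) \<Longrightarrow> [h a c = h b d] (mod (int p))"
  shows "(\<lambda>f. h (\<phi> f) (\<psi> f)) \<in> Inv S"
  using assms(1,2) by (auto simp: Inv_def intro!: h)

lemma Inv_add: "\<phi> \<in> Inv S \<Longrightarrow> \<psi> \<in> Inv S \<Longrightarrow> (\<lambda>f. \<phi> f + \<psi> f) \<in> Inv S"
  and Inv_diff: "\<phi> \<in> Inv S \<Longrightarrow> \<psi> \<in> Inv S \<Longrightarrow> (\<lambda>f. \<phi> f - \<psi> f) \<in> Inv S"
  and Inv_mult: "\<phi> \<in> Inv S \<Longrightarrow> \<psi> \<in> Inv S \<Longrightarrow> (\<lambda>f. \<phi> f * \<psi> f) \<in> Inv S"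
  by (rule Inv_comp2; (assumption | rule cong_add cong_diff cong_mult; assumption))+

lemma Inv_const: "(\<lambda>_. c) \<in> Inv S" by (auto simp: Inv_def)

lemma Inv_translate:
  assumes "\<phi> \<in> Inv S" "S \<subseteq> carrier F" "a \<in> carrier F" "b \<in> carrier F"
  shows "(\<lambda>f. \<phi> (a \<otimes> f \<otimes> b)) \<in> Inv S"
  unfolding Inv_def
proof (intro CollectI ballI)
  fix f g s assume h: "f \<in> carrier F" "g \<in> carrier F" "s \<in> S"
  then have "s \<in> carrier F" using assms by auto
  with InvD[OF assms(1), of "a \<otimes> f" s "g \<otimes> b"] h assms
  show "[\<phi> (a \<otimes> (f \<otimes> s \<otimes> g) \<otimes> b) = \<phi> (a \<otimes> (f \<otimes> g) \<otimes> b)] (mod (int p))"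
    by (simp add: m_assoc)
qed

lemma Inv_translate_right:
  assumes "\<phi> \<in> Inv S" "S \<subseteq> carrier F" "b \<in> carrier F" shows "(\<lambda>f. \<phi> (f \<otimes> b)) \<in> Inv S"
  unfolding Inv_def
proof (intro CollectI ballI)
  fix f g s assume h: "f \<in> carrier F" "g \<in> carrier F" "s \<in> S"
  then have "s \<in> carrier F" using assms by auto
  with InvD[OF assms(1), of f s "g \<otimes> b"] h assms
  show "[\<phi> (f \<otimes> s \<otimes> g \<otimes> b) = \<phi> (f \<otimes> g \<otimes> b)] (mod (int p))"
    by (simp add: m_assoc)
qed

lemma Inv_translate_left:
  assumes "\<phi> \<in> Inv S" "S \<subseteq> carrier F" "b \<in> carrier F" shows "(\<lambda>f. \<phi> (b \<otimes> f)) \<in> Inv S"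
  unfolding Inv_def
proof (intro CollectI ballI)
  fix f g s assume h: "f \<in> carrier F" "g \<in> carrier F" "s \<in> S"
  then have "s \<in> carrier F" using assms by auto
  with InvD[OF assms(1), of "b \<otimes> f" s g] h assms
  show "[\<phi> (b \<otimes> (f \<otimes> s \<otimes> g)) = \<phi> (b \<otimes> (f \<otimes> g))] (mod (int p))"
    by (simp add: m_assoc)
qed

lemma Inv_Dif:
  assumes "\<phi> \<in> Inv S" "S \<subseteq> carrier F" "g \<in> carrier F" shows "Dif g \<phi> \<in> Inv S"
  unfolding Dif_def[abs_def] by (intro Inv_diff Inv_translate_right assms)

text \<open>Stabilisers are normal subgroups, so invariance under the relators passes to everything in the
  normal subgroup generated by them.\<close>

definition Stab :: "('a \<Rightarrow> int) \<Rightarrow> 'a set" where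
  "Stab \<phi> = {k \<in> carrier F. \<phi> \<in> Inv {k}}"

lemma Stab_iff: "S \<subseteq> carrier F \<Longrightarrow> \<phi> \<in> Inv S \<longleftrightarrow> S \<subseteq> Stab \<phi>"
  by (auto simp: Stab_def Inv_def)

lemma StabD: "k \<in> Stab \<phi> \<Longrightarrow> f \<in> carrier F \<Longrightarrow> g \<in> carrier F \<Longrightarrow>
    [\<phi> (f \<otimes> k \<otimes> g) = \<phi> (f \<otimes> g)] (mod (int p))"
  by (auto simp: Stab_def Inv_def)

lemma Stab_normal: "Stab \<phi> \<lhd> F"
proof (rule normal_invI)
  show "subgroup (Stab \<phi>) F"
  proof (rule subgroupI)
    show "Stab \<phi> \<subseteq> carrier F" by (auto simp: Stab_def)
    have "\<one> \<in> Stab \<phi>" by (auto simp: Stab_def Inv_def)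
    then show "Stab \<phi> \<noteq> {}" by auto
  next
    fix a assume a: "a \<in> Stab \<phi>"
    then have ac: "a \<in> carrier F" by (auto simp: Stab_def)
    have "[\<phi> (f \<otimes> inv a \<otimes> g) = \<phi> (f \<otimes> g)] (mod (int p))" if "f \<in> carrier F" "g \<in> carrier F" for f g
    proof -
      have "f \<otimes> inv a \<otimes> a \<otimes> g = f \<otimes> g" using ac that by (simp add: m_assoc)
      then show ?thesis using StabD[OF a, of "f \<otimes> inv a" g] ac that by (simp add: cong_sym)
    qed
    then show "inv a \<in> Stab \<phi>" using ac by (auto simp: Stab_def Inv_def)
  next
    fix a b assume a: "a \<in> Stab \<phi>" and b: "b \<in> Stab \<phi>"
    then have c: "a \<in> carrier F" "b \<in> carrier F" by (auto simp: Stab_def)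
    have "[\<phi> (f \<otimes> (a \<otimes> b) \<otimes> g) = \<phi> (f \<otimes> g)] (mod (int p))" if "f \<in> carrier F" "g \<in> carrier F" for f g
    proof -
      have "[\<phi> (f \<otimes> a \<otimes> (b \<otimes> g)) = \<phi> (f \<otimes> (b \<otimes> g))] (mod (int p))"
        using StabD[OF a, of f "b \<otimes> g"] c that by simp
      moreover have "[\<phi> (f \<otimes> b \<otimes> g) = \<phi> (f \<otimes> g)] (mod (int p))" using StabD[OF b] that by simp
      ultimately show ?thesis using c that by (auto simp: m_assoc intro: cong_trans)
    qed
    then show "a \<otimes> b \<in> Stab \<phi>" using c by (auto simp: Stab_def Inv_def)
  qed
next
  fix x h assume x: "x \<in> carrier F" and h: "h \<in> Stab \<phi>"
  then have hc: "h \<in> carrier F" by (auto simp: Stab_def)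
  have "[\<phi> (f \<otimes> (x \<otimes> h \<otimes> inv x) \<otimes> g) = \<phi> (f \<otimes> g)] (mod (int p))" if "f \<in> carrier F" "g \<in> carrier F" for f g
  proof -
    have "f \<otimes> x \<otimes> (inv x \<otimes> g) = f \<otimes> g"
      using x that by (simp add: m_assoc) (simp add: m_assoc[symmetric])
    then show ?thesis
      using StabD[OF h, of "f \<otimes> x" "inv x \<otimes> g"] hc x that by (simp add: m_assoc)
  qed
  then show "x \<otimes> h \<otimes> inv x \<in> Stab \<phi>" using hc x by (auto simp: Stab_def Inv_def)
qed

end

section \<open>Weighted dimension subgroups\<close>

lemma (in group) rcos_eq_iff:
  assumes "subgroup N G" "x \<in> carrier G" "y \<in> carrier G"
  shows "N #> x = N #> y \<longleftrightarrow> x \<otimes> inv y \<in> N"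
proof
  assume "N #> x = N #> y"
  then have "x \<in> N #> y" using rcos_self[OF assms(2,1)] by simp
  then obtain k where "k \<in> N" "x = k \<otimes> y" by (auto simp: r_coset_def)
  then show "x \<otimes> inv y \<in> N" using assms subgroup.mem_carrier[OF assms(1)] by (auto simp: m_assoc)
next
  assume a: "x \<otimes> inv y \<in> N"
  have "x = x \<otimes> inv y \<otimes> y" using assms by (simp add: m_assoc)
  with a have "x \<in> N #> y" unfolding r_coset_def by blast
  then show "N #> x = N #> y" using repr_independence[OF _ assms(3,1)] by metis
qed

lemma card_image_le_of_kernel:
  assumes "finite (g ` A)" "\<And>x y. x \<in> A \<Longrightarrow> y \<in> A \<Longrightarrow> g x = g y \<Longrightarrow> f x = f y"
  shows "finite (f ` A)" "card (f ` A) \<le> card (g ` A)"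
proof -
  have eq: "f ` A = (\<lambda>z. f (SOME x. x \<in> A \<and> g x = z)) ` (g ` A)"
    unfolding image_image
  proof (rule image_cong[OF refl])
    fix x assume "x \<in> A"
    then have "(SOME y. y \<in> A \<and> g y = g x) \<in> A \<and> g (SOME y. y \<in> A \<and> g y = g x) = g x"
      by (intro someI[of "\<lambda>y. y \<in> A \<and> g y = g x" x]) auto
    then show "f x = f (SOME y. y \<in> A \<and> g y = g x)" using assms(2)[of x] \<open>x \<in> A\<close> by metis
  qed
  show "finite (f ` A)" unfolding eq using assms(1) by blast
  show "card (f ` A) \<le> card (g ` A)" unfolding eq using assms(1) by (rule card_image_le)
qed

lemma card_image_eq_of_kernel:
  assumes "\<And>x y. x \<in> A \<Longrightarrow> y \<in> A \<Longrightarrow> g x = g y \<longleftrightarrow> f x = f y"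
  shows "card (f ` A) = card (g ` A)"
proof (cases "finite (g ` A)")
  case True
  then have "finite (f ` A)" using card_image_le_of_kernel[of g A f] assms by blast
  then show ?thesis
    using card_image_le_of_kernel(2)[OF True, of f] card_image_le_of_kernel(2)[of f A g] assms
    by (intro order_antisym) auto
next
  case False
  then have "infinite (f ` A)" using card_image_le_of_kernel[of f A g] assms by blast
  then show ?thesis using False by simp
qed

text \<open>Cosets are formed in the ambient group, as images of A and B, which avoids turning A
  into a group of its own. Each a in A is b times the chosen representative \<rho> of its B-coset,
  and the C-coset of b is determined by that of a.\<close>

lemma (in group) card_cosets_tower:
  assumes "subgroup C G" "subgroup B G" "subgroup A G" "C \<subseteq> B" "B \<subseteq> A"
  shows "card ((\<lambda>a. C #> a) ` A) = card ((\<lambda>a. B #> a) ` A) * card ((\<lambda>a. C #> a) ` B)"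
proof -
  define \<rho> where "\<rho> U = (SOME a. a \<in> A \<and> B #> a = U)" for U
  have \<rho>: "\<rho> U \<in> A" "B #> \<rho> U = U" if "U \<in> (\<lambda>a. B #> a) ` A" for U
    using someI_ex[of "\<lambda>a. a \<in> A \<and> B #> a = U"] that by (auto simp: \<rho>_def)
  have cA: "a \<in> carrier G" if "a \<in> A" for a using subgroup.mem_carrier[OF assms(3) that] .
  have cB: "a \<in> carrier G" if "a \<in> B" for a using subgroup.mem_carrier[OF assms(2) that] .
  have cC: "C \<subseteq> carrier G" "B \<subseteq> carrier G" using subgroup.subset assms by auto
  have "bij_betw (\<lambda>(U, V). V #> \<rho> U) (((\<lambda>a. B #> a) ` A) \<times> ((\<lambda>a. C #> a) ` B)) ((\<lambda>a. C #> a) ` A)"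
    unfolding bij_betw_def
  proof
    show "inj_on (\<lambda>(U, V). V #> \<rho> U) (((\<lambda>a. B #> a) ` A) \<times> ((\<lambda>a. C #> a) ` B))"
    proof (rule inj_onI, clarify)
      fix a b a' b' assume a: "a \<in> A" "a' \<in> A" and b: "b \<in> B" "b' \<in> B"
        and eq: "C #> b #> \<rho> (B #> a) = C #> b' #> \<rho> (B #> a')"
      define r r' where "r = \<rho> (B #> a)" and "r' = \<rho> (B #> a')"
      have r: "r \<in> A" "B #> r = B #> a" "r' \<in> A" "B #> r' = B #> a'"
        using \<rho> a by (auto simp: r_def r'_def)
      have eq': "C #> (b \<otimes> r) = C #> (b' \<otimes> r')"
        using eq cC cB b cA r by (simp add: coset_mult_assoc r_def[symmetric] r'_def[symmetric])
      have "b \<otimes> r \<in> C #> (b' \<otimes> r')"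
        using rcos_self[OF _ assms(1), of "b \<otimes> r"] cB b cA r by (auto simp: eq'[symmetric])
      then obtain c where c: "c \<in> C" "b \<otimes> r = c \<otimes> (b' \<otimes> r')" by (auto simp: r_coset_def)
      have cc: "c \<in> B" using c assms by auto
      have "inv b \<otimes> (b \<otimes> r) = inv b \<otimes> (c \<otimes> (b' \<otimes> r'))" using c by simp
      then have "r = (inv b \<otimes> c \<otimes> b') \<otimes> r'" using cB cc b cA r by (simp add: m_assoc[symmetric])
      moreover have "inv b \<otimes> c \<otimes> b' \<in> B"
        using subgroup.m_closed[OF assms(2)] subgroup.m_inv_closed[OF assms(2)] b cc by auto
      ultimately have "r \<in> B #> r'" by (auto simp: r_coset_def)
      then have "B #> r = B #> r'" using repr_independence[OF _ cA[OF r(3)] assms(2)] by metis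
      then have U: "B #> a = B #> a'" using r by simp
      then have "r = r'" by (simp add: r_def r'_def)
      then have "C #> b #> r = C #> b' #> r" using eq r_def r'_def by simp
      then have "C #> b #> r #> inv r = C #> b' #> r #> inv r" by simp
      then have "C #> b = C #> b'"
        using cC cB b cA r by (simp add: coset_mult_assoc m_assoc)
      with U show "B #> a = B #> a' \<and> C #> b = C #> b'" by simp
    qed
    show "(\<lambda>(U, V). V #> \<rho> U) ` (((\<lambda>a. B #> a) ` A) \<times> ((\<lambda>a. C #> a) ` B)) = (\<lambda>a. C #> a) ` A"
    proof (intro equalityI subsetI)
      fix Z assume "Z \<in> (\<lambda>(U, V). V #> \<rho> U) ` (((\<lambda>a. B #> a) ` A) \<times> ((\<lambda>a. C #> a) ` B))"
      then obtain a b where ab: "a \<in> A" "b \<in> B" "Z = C #> b #> \<rho> (B #> a)" by auto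
      have r: "\<rho> (B #> a) \<in> A" using \<rho> ab by auto
      then have "Z = C #> (b \<otimes> \<rho> (B #> a))" using ab cC cB cA by (simp add: coset_mult_assoc)
      moreover have "b \<otimes> \<rho> (B #> a) \<in> A" using r ab assms subgroup.m_closed[OF assms(3)] by auto
      ultimately show "Z \<in> (\<lambda>a. C #> a) ` A" by auto
    next
      fix Z assume "Z \<in> (\<lambda>a. C #> a) ` A"
      then obtain a where a: "a \<in> A" "Z = C #> a" by auto
      define r where "r = \<rho> (B #> a)"
      have r: "r \<in> A" "B #> r = B #> a" using \<rho> a by (auto simp: r_def)
      have "a \<in> B #> r" using rcos_self[OF cA[OF a(1)] assms(2)] r by simp
      then obtain b where b: "b \<in> B" "a = b \<otimes> r" by (auto simp: r_coset_def)
      then have "Z = C #> b #> r" using a cC cB cA r by (simp add: coset_mult_assoc)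
      then show "Z \<in> (\<lambda>(U, V). V #> \<rho> U) ` (((\<lambda>a. B #> a) ` A) \<times> ((\<lambda>a. C #> a) ` B))"
        using a b r_def by force
    qed
  qed
  then show ?thesis using bij_betw_same_card card_cartesian_product by metis
qed

context magnus_coefficients
begin

lemma p_gt_1: "1 < p" using prime_p by (rule prime_gt_1_nat)

lemma pow_in_subgroup: assumes "subgroup K F" "g \<in> K" shows "g [^] (a::nat) \<in> K"
  by (induction a) (use assms subgroup.m_closed[OF assms(1)] subgroup.one_closed[OF assms(1)] in auto)

section \<open>Homomorphisms modulo p on a subgroup\<close>

context
  fixes K :: "'a set" and \<phi> :: "'a \<Rightarrow> int"
  assumes K: "subgroup K F"
    and add: "\<And>g h. g \<in> K \<Longrightarrow> h \<in> K \<Longrightarrow> [\<phi> (g \<otimes> h) = \<phi> g + \<phi> h] (mod (int p))"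
begin

lemma hom_mod_one: "[\<phi> \<one> = 0] (mod (int p))"
  using add[OF subgroup.one_closed[OF K] subgroup.one_closed[OF K]]
    cong_add_lcancel[of "\<phi> \<one>" 0 "\<phi> \<one>" "int p"] by (simp add: cong_sym_eq)

lemma hom_mod_inv: assumes "g \<in> K" shows "[\<phi> (inv g) = - \<phi> g] (mod (int p))"
proof -
  have "[\<phi> \<one> = \<phi> g + \<phi> (inv g)] (mod (int p))"
    using add[OF assms subgroup.m_inv_closed[OF K assms]] subgroup.mem_carrier[OF K assms] by simp
  from cong_add[OF cong_trans[OF cong_sym[OF this] hom_mod_one] cong_refl, of "- \<phi> g"]
  show ?thesis by simp
qed

lemma hom_mod_pow: assumes "g \<in> K" shows "[\<phi> (g [^] (a::nat)) = int a * \<phi> g] (mod (int p))"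
proof (induction a)
  case (Suc a)
  from cong_trans[OF add[OF pow_in_subgroup[OF K assms] assms] cong_add[OF Suc cong_refl]]
  have "[\<phi> (g [^] Suc a) = int a * \<phi> g + \<phi> g] (mod (int p))" by simp
  then show ?case by (simp add: algebra_simps)
qed (use hom_mod_one in auto)

lemma hom_mod_div: assumes "g \<in> K" "h \<in> K" shows "[\<phi> (g \<otimes> inv h) = \<phi> g - \<phi> h] (mod (int p))"
  using cong_trans[OF add[OF assms(1) subgroup.m_inv_closed[OF K assms(2)]]
      cong_add[OF cong_refl hom_mod_inv[OF assms(2)]]] by simp

lemma hom_mod_kernel_subgroup: "subgroup {k \<in> K. [\<phi> k = 0] (mod (int p))} F"
proof (rule subgroupI)
  show "{k \<in> K. [\<phi> k = 0] (mod (int p))} \<subseteq> carrier F" using subgroup.mem_carrier[OF K] by auto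
  show "{k \<in> K. [\<phi> k = 0] (mod (int p))} \<noteq> {}" using hom_mod_one subgroup.one_closed[OF K] by auto
next
  fix a assume "a \<in> {k \<in> K. [\<phi> k = 0] (mod (int p))}"
  then have a: "a \<in> K" "[- \<phi> a = 0] (mod (int p))" by (auto simp: cong_0_iff)
  then show "inv a \<in> {k \<in> K. [\<phi> k = 0] (mod (int p))}"
    using cong_trans[OF hom_mod_inv[OF a(1)] a(2)] subgroup.m_inv_closed[OF K a(1)] by auto
next
  fix a b assume "a \<in> {k \<in> K. [\<phi> k = 0] (mod (int p))}" "b \<in> {k \<in> K. [\<phi> k = 0] (mod (int p))}"
  then have ab: "a \<in> K" "b \<in> K" "[\<phi> a + \<phi> b = 0] (mod (int p))" by (auto simp: cong_0_iff)
  then show "a \<otimes> b \<in> {k \<in> K. [\<phi> k = 0] (mod (int p))}"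
    using cong_trans[OF add[OF ab(1,2)] ab(3)] subgroup.m_closed[OF K ab(1,2)] by auto
qed

text \<open>A nonzero residue is invertible modulo p, so the powers of g already take every value,
  and the cosets of the kernel correspond to the values.\<close>

lemma hom_mod_kernel_cosets:
  assumes "g \<in> K" "\<not> [\<phi> g = 0] (mod (int p))"
  shows "card ((\<lambda>a. {k \<in> K. [\<phi> k = 0] (mod (int p))} #> a) ` K) = p"
proof -
  define K' where "K' = {k \<in> K. [\<phi> k = 0] (mod (int p))}"
  have K': "subgroup K' F" using hom_mod_kernel_subgroup by (simp add: K'_def)
  have Kc: "k \<in> carrier F" if "k \<in> K" for k using subgroup.mem_carrier[OF K that] .
  have "card ((\<lambda>a. K' #> a) ` K) = card ((\<lambda>k. \<phi> k mod int p) ` K)"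
  proof (rule card_image_eq_of_kernel)
    fix x y assume xy: "x \<in> K" "y \<in> K"
    have "K' #> x = K' #> y \<longleftrightarrow> x \<otimes> inv y \<in> K'"
      by (rule rcos_eq_iff[OF K' Kc[OF xy(1)] Kc[OF xy(2)]])
    also have "\<dots> \<longleftrightarrow> [\<phi> (x \<otimes> inv y) = 0] (mod (int p))"
      using subgroup.m_closed[OF K xy(1) subgroup.m_inv_closed[OF K xy(2)]] by (simp add: K'_def)
    also have "\<dots> \<longleftrightarrow> [\<phi> x - \<phi> y = 0] (mod (int p))"
      using hom_mod_div[OF xy] by (meson cong_sym cong_trans)
    also have "\<dots> \<longleftrightarrow> [\<phi> x = \<phi> y] (mod (int p))" by (simp add: cong_diff_iff_cong_0)
    finally show "(\<phi> x mod int p = \<phi> y mod int p) = (K' #> x = K' #> y)" by (simp add: cong_def)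
  qed
  also have "(\<lambda>k. \<phi> k mod int p) ` K = {0..<int p}"
  proof (intro equalityI subsetI)
    fix z assume z: "z \<in> {0..<int p}"
    have "\<not> int p dvd \<phi> g" using assms(2) by (simp add: cong_0_iff)
    then have "coprime (\<phi> g) (int p)"
      using prime_p by (metis coprime_commute prime_imp_coprime prime_nat_int_transfer)
    then obtain u where u: "[\<phi> g * u = 1] (mod (int p))" using cong_solve_coprime_int by blast
    define a where "a = nat ((u * z) mod int p)"
    have a: "[int a = u * z] (mod (int p))" using p_gt_1 by (simp add: a_def)
    have "[\<phi> (g [^] a) = int a * \<phi> g] (mod (int p))" by (rule hom_mod_pow[OF assms(1)])
    also have "[int a * \<phi> g = u * z * \<phi> g] (mod (int p))" by (intro cong_mult a cong_refl)
    also have "u * z * \<phi> g = \<phi> g * u * z" by simp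
    also have "[\<phi> g * u * z = 1 * z] (mod (int p))" by (intro cong_mult u cong_refl)
    finally have "\<phi> (g [^] a) mod int p = z" using z by (simp add: cong_def)
    then show "z \<in> (\<lambda>k. \<phi> k mod int p) ` K"
      using pow_in_subgroup[OF K assms(1), of a] by (metis image_eqI)
  qed (use p_gt_1 in auto)
  finally show ?thesis by (simp add: K'_def)
qed

end

end

text \<open>\<open>e\<close> plays the part of the degree of a relator, expressed through the
  vanishing of low coefficients. The last assumption keeps the products over the relators of degree
  below i finite although R may be infinite.\<close>

locale golod_shafarevich_coefficients = magnus_coefficients F p X D \<nu>
  for F :: "('a, 'b) monoid_scheme" (structure) and p X D \<nu> +
  fixes R :: "'a set" and e :: "'a \<Rightarrow> nat"
  assumes R_subset: "R \<subseteq> carrier F"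
    and nu_relator: "r \<in> R \<Longrightarrow> w \<in> lists X \<Longrightarrow> w \<noteq> [] \<Longrightarrow> weight w < e r \<Longrightarrow> [\<nu> w r = 0] (mod (int p))"
    and finite_relators: "finite {r \<in> R. e r < i}"
begin

text \<open>\<open>lvl\<close> pulls the weighted dimension series of the presented group back to the free group.\<close>

definition lvl :: "nat \<Rightarrow> 'a set" where
  "lvl n = {h \<in> carrier F. \<forall>\<phi>\<in>Pol n \<inter> Inv R. h \<in> Stab \<phi>}"

lemma lvl_subset: "lvl n \<subseteq> carrier F" by (auto simp: lvl_def)

text \<open>The R-invariant functions of degree < n are closed under translation on both sides, so
  comparing values at h and at the identity is enough.\<close>

lemma lvl_memI:
  assumes "h \<in> carrier F" "\<And>\<phi>. \<phi> \<in> Pol n \<inter> Inv R \<Longrightarrow> [\<phi> h = \<phi> \<one>] (mod (int p))"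
  shows "h \<in> lvl n"
proof -
  have "[\<phi> (f \<otimes> h \<otimes> g) = \<phi> (f \<otimes> g)] (mod (int p))"
    if "\<phi> \<in> Pol n \<inter> Inv R" "f \<in> carrier F" "g \<in> carrier F" for \<phi> f g
  proof -
    have "(\<lambda>x. \<phi> (f \<otimes> x \<otimes> g)) \<in> Pol n \<inter> Inv R"
      using that R_subset Inv_translate
        Pol_translate_left[OF Pol_translate_right[of \<phi> n g], of f] by auto
    from assms(2)[OF this] show ?thesis using that by simp
  qed
  then show ?thesis using assms(1) by (auto simp: lvl_def Stab_def Inv_def)
qed

lemma lvlD: "h \<in> lvl n \<Longrightarrow> \<phi> \<in> Pol n \<Longrightarrow> \<phi> \<in> Inv R \<Longrightarrow> [\<phi> h = \<phi> \<one>] (mod (int p))"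
  using StabD[of h \<phi> \<one> \<one>] by (auto simp: lvl_def)

lemma lvl_Inv: "\<phi> \<in> Pol n \<Longrightarrow> \<phi> \<in> Inv R \<Longrightarrow> \<phi> \<in> Inv (lvl n)"
  using Stab_iff[OF lvl_subset] by (auto simp: lvl_def)

lemma lvl_normal: "lvl n \<lhd> F"
proof (rule normal_invI)
  have sg: "subgroup (Stab \<phi>) F" for \<phi> using Stab_normal normal_imp_subgroup by blast
  show "subgroup (lvl n) F"
  proof (rule subgroupI)
    have "\<one> \<in> lvl n" using subgroup.one_closed[OF sg] by (auto simp: lvl_def)
    then show "lvl n \<noteq> {}" by auto
  qed (auto simp: lvl_def intro: subgroup.m_closed[OF sg] subgroup.m_inv_closed[OF sg])
  fix x h assume "x \<in> carrier F" "h \<in> lvl n"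
  then show "x \<otimes> h \<otimes> inv x \<in> lvl n"
    by (auto simp: lvl_def intro: normal.inv_op_closed2[OF Stab_normal])
qed

lemma lvl_subgroup: "subgroup (lvl n) F" using lvl_normal normal_imp_subgroup by blast

lemma lvl_antimono: "m \<le> n \<Longrightarrow> lvl n \<subseteq> lvl m"
  using Pol_mono by (auto simp: lvl_def)

lemma R_lvl: "R \<subseteq> lvl n"
  using R_subset by (auto simp: lvl_def Stab_def Inv_def)

lemma lvl_1: "lvl (Suc 0) = carrier F"
  using lvl_memI[of _ "Suc 0"] Pol_1 lvl_subset[of "Suc 0"] by blast

text \<open>These are the functions multiplying \<open>\<nu> v f\<close> in
  \<open>comb_mult_left\<close>. Removing a leading letter is a left difference, which is built from
  translations and so preserves invariance.\<close>

lemma left_coefficients_Inv: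
  assumes "v \<in> lists X" "comb m l \<in> Inv R"
  shows "comb (m - weight v) (\<lambda>u. l (v @ u)) \<in> Inv R"
  using assms
proof (induction v arbitrary: m l)
  case (Cons x v)
  have x: "x \<in> X" and v: "v \<in> lists X" using Cons by auto
  have xc: "x \<in> carrier F" using x X_subset by auto
  have "(\<lambda>f. comb m l (x \<otimes> f) - comb m l f) \<in> Inv R"
    by (intro Inv_diff Inv_translate_left Cons.prems R_subset xc)
  moreover have "comb (m - D x) (\<lambda>v. l (x # v)) \<doteq> (\<lambda>f. comb m l (x \<otimes> f) - comb m l f)"
    using left_Dif_gen_comb[OF x] cong_sym by blast
  ultimately have "comb (m - D x) (\<lambda>v. l (x # v)) \<in> Inv R"
    by (rule Inv_cong) (rule R_subset)
  from Cons.IH[OF this] show ?case by simp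
qed auto

lemma Dif_lvl:
  assumes "\<phi> \<in> Pol m" "\<phi> \<in> Inv R" "h \<in> lvl i"
  shows "Dif h \<phi> \<in> Pol (m - i)" "Dif h \<phi> \<in> Inv R"
proof -
  have h: "h \<in> carrier F" using assms lvl_subset by auto
  show "Dif h \<phi> \<in> Inv R" by (intro Inv_Dif assms R_subset h)
  obtain l where l: "\<phi> \<doteq> comb m l" using assms by (auto simp: Pol_def)
  then have inv: "comb m l \<in> Inv R"
    using Inv_cong[OF assms(2) _ R_subset, of "comb m l"] cong_sym by blast
  let ?c = "\<lambda>v g. comb (m - weight v) (\<lambda>u. l (v @ u)) g"
  have "(\<lambda>f. \<Sum>v\<in>words (m - i). (?c v h - ?c v \<one>) * \<nu> v f) \<in> Pol (m - i)"
    by (intro Pol_sum Pol_scale Pol_nu)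
  moreover have "Dif h \<phi> \<doteq> (\<lambda>f. \<Sum>v\<in>words (m - i). (?c v h - ?c v \<one>) * \<nu> v f)"
  proof
    fix f assume f: "f \<in> carrier F"
    have "[\<phi> (f \<otimes> h) = comb m l (f \<otimes> h)] (mod (int p))" "[\<phi> f = comb m l (f \<otimes> \<one>)] (mod (int p))"
      using l f h by simp_all
    then have "[Dif h \<phi> f = comb m l (f \<otimes> h) - comb m l (f \<otimes> \<one>)] (mod (int p))"
      unfolding Dif_def by (rule cong_diff)
    also have "[comb m l (f \<otimes> h) - comb m l (f \<otimes> \<one>)
        = (\<Sum>v\<in>words m. \<nu> v f * ?c v h) - (\<Sum>v\<in>words m. \<nu> v f * ?c v \<one>)] (mod (int p))"
      by (intro cong_diff comb_mult_left f h one_closed)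
    also have "(\<Sum>v\<in>words m. \<nu> v f * ?c v h) - (\<Sum>v\<in>words m. \<nu> v f * ?c v \<one>)
        = (\<Sum>v\<in>words m. (?c v h - ?c v \<one>) * \<nu> v f)"
      by (simp add: sum_subtractf[symmetric] algebra_simps)
    also have "[(\<Sum>v\<in>words m. (?c v h - ?c v \<one>) * \<nu> v f)
        = (\<Sum>v\<in>words m. if weight v < m - i then (?c v h - ?c v \<one>) * \<nu> v f else 0)] (mod (int p))"
    proof (rule cong_sum)
      fix v assume v: "v \<in> words m"
      show "[(?c v h - ?c v \<one>) * \<nu> v f
          = (if weight v < m - i then (?c v h - ?c v \<one>) * \<nu> v f else 0)] (mod (int p))"
      proof (cases "weight v < m - i")
        case False
        then have "?c v \<in> Pol i" by (intro Pol_mono[OF comb_Pol]) auto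
        moreover have "?c v \<in> Inv R" using left_coefficients_Inv[OF words_lists[OF v] inv] .
        ultimately have "[?c v h = ?c v \<one>] (mod (int p))" using lvlD[OF assms(3)] by blast
        then have "[?c v h - ?c v \<one> = 0] (mod (int p))" by (simp add: cong_diff_iff_cong_0)
        then show ?thesis using False by (auto simp: cong_0_iff)
      qed simp
    qed
    also have "(\<Sum>v\<in>words m. if weight v < m - i then (?c v h - ?c v \<one>) * \<nu> v f else 0)
        = (\<Sum>v\<in>words (m - i). (?c v h - ?c v \<one>) * \<nu> v f)"
      by (intro sum.mono_neutral_cong_right finite_words) (auto simp: words_def)
    finally show "[Dif h \<phi> f = (\<Sum>v\<in>words (m - i). (?c v h - ?c v \<one>) * \<nu> v f)] (mod (int p))" .
  qed
  ultimately show "Dif h \<phi> \<in> Pol (m - i)" by (rule Pol_cong)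
qed

text \<open>The difference along h has degree 0, hence is constant. Since such \<phi> separate the
  elements of \<open>lvl i\<close> modulo \<open>lvl (Suc i)\<close>, the factor is elementary
  abelian.\<close>

lemma hom_on_lvl:
  assumes "\<phi> \<in> Pol (Suc i)" "\<phi> \<in> Inv R" "g \<in> carrier F" "h \<in> lvl i"
  shows "[\<phi> (g \<otimes> h) = \<phi> g + \<phi> h - \<phi> \<one>] (mod (int p))"
proof -
  have h: "h \<in> carrier F" using assms lvl_subset by auto
  have "Dif h \<phi> \<in> Pol (Suc 0)" using Pol_mono[OF Dif_lvl(1)[OF assms(1,2,4)], of "Suc 0"] by simp
  from Pol_1[OF this assms(3) one_closed] have "[\<phi> (g \<otimes> h) - \<phi> g = \<phi> h - \<phi> \<one>] (mod (int p))"
    using h by (simp add: Dif_def)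
  from cong_add[OF this cong_refl, of "\<phi> g"] show ?thesis by (simp add: algebra_simps)
qed

text \<open>The coset of f depends only on its coefficients modulo p at the words of weight below
  n.\<close>

lemma lvl_cosets:
  shows "finite ((\<lambda>f. lvl n #> f) ` carrier F)"
    and "card ((\<lambda>f. lvl n #> f) ` carrier F) \<le> p ^ card (words n)"
proof -
  let ?s = "\<lambda>f. \<lambda>w\<in>words n. \<nu> w f mod int p"
  have sub: "?s ` carrier F \<subseteq> words n \<rightarrow>\<^sub>E {0..<int p}" using p_gt_1 by auto
  have fin: "finite (words n \<rightarrow>\<^sub>E {0..<int p})" by (intro finite_PiE) auto
  have k: "lvl n #> f = lvl n #> g" if "f \<in> carrier F" "g \<in> carrier F" "?s f = ?s g" for f g
  proof -
    have c: "[\<nu> w f = \<nu> w g] (mod (int p))" if "w \<in> words n" for w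
      using fun_cong[OF \<open>?s f = ?s g\<close>, of w] that by (simp add: cong_def)
    have "f \<otimes> inv g \<in> lvl n"
    proof (rule lvl_memI)
      fix \<phi> assume "\<phi> \<in> Pol n \<inter> Inv R"
      then have "(\<lambda>x. \<phi> (x \<otimes> inv g)) \<in> Pol n" using Pol_translate_right that by auto
      from Pol_separated[OF this that(1,2) c] show "[\<phi> (f \<otimes> inv g) = \<phi> \<one>] (mod (int p))"
        using that by simp
    qed (use that in auto)
    moreover have "f = f \<otimes> inv g \<otimes> g" using that by (simp add: m_assoc)
    ultimately have "f \<in> lvl n #> g" unfolding r_coset_def by blast
    then show ?thesis using repr_independence[OF _ that(2) lvl_subgroup] by auto
  qed
  have fs: "finite (?s ` carrier F)" using finite_subset[OF sub fin] .
  note c = card_image_le_of_kernel[of ?s "carrier F" "\<lambda>f. lvl n #> f", OF fs k]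
  show "finite ((\<lambda>f. lvl n #> f) ` carrier F)" by (rule c(1))
  have "card (?s ` carrier F) \<le> card (words n \<rightarrow>\<^sub>E {0..<int p})" by (rule card_mono[OF fin sub])
  also have "\<dots> = p ^ card (words n)" by (simp add: card_PiE)
  finally show "card ((\<lambda>f. lvl n #> f) ` carrier F) \<le> p ^ card (words n)" using c(2) by linarith
qed

text \<open>A step up is an inclusion of index \<open>p\<close>; \<open>steps i K c\<close> reaches \<open>K\<close> from \<open>lvl (Suc i)\<close> in \<open>c\<close> of them.\<close>

definition step :: "nat \<Rightarrow> 'a set \<Rightarrow> 'a set \<Rightarrow> bool" where
  "step i K' K \<longleftrightarrow> subgroup K F \<and> lvl (Suc i) \<subseteq> K \<and> K \<subseteq> lvl i \<and>
     (\<exists>\<phi>\<in>Pol (Suc i) \<inter> Inv R. [\<phi> \<one> = 0] (mod (int p)) \<and>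
        K' = {k \<in> K. [\<phi> k = 0] (mod (int p))} \<and> (\<exists>g\<in>K. [\<phi> g = 1] (mod (int p))))"

inductive steps :: "nat \<Rightarrow> 'a set \<Rightarrow> nat \<Rightarrow> bool" for i where
  base: "steps i (lvl (Suc i)) 0"
| step: "steps i K' c \<Longrightarrow> step i K' K \<Longrightarrow> steps i K (Suc c)"

lemma step_props:
  assumes "subgroup K F" "K \<subseteq> lvl i" "lvl (Suc i) \<subseteq> K" "\<phi> \<in> Pol (Suc i)" "\<phi> \<in> Inv R" "[\<phi> \<one> = 0] (mod (int p))"
    "K' = {k \<in> K. [\<phi> k = 0] (mod (int p))}"
  shows "subgroup K' F" "lvl (Suc i) \<subseteq> K'"
    "\<And>g h. g \<in> K \<Longrightarrow> h \<in> K \<Longrightarrow> [\<phi> (g \<otimes> h) = \<phi> g + \<phi> h] (mod (int p))"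
proof -
  have Kc: "k \<in> carrier F" if "k \<in> K" for k using subgroup.mem_carrier[OF assms(1) that] .
  show add: "[\<phi> (g \<otimes> h) = \<phi> g + \<phi> h] (mod (int p))" if "g \<in> K" "h \<in> K" for g h
  proof -
    have "[\<phi> (g \<otimes> h) = \<phi> g + \<phi> h - \<phi> \<one>] (mod (int p))"
      using hom_on_lvl[OF assms(4,5) Kc[OF that(1)]] that assms(2) by auto
    also have "[\<phi> g + \<phi> h - \<phi> \<one> = \<phi> g + \<phi> h - 0] (mod (int p))"
      by (intro cong_diff cong_refl assms(6))
    finally show ?thesis by simp
  qed
  show "lvl (Suc i) \<subseteq> K'"
    using assms(3,7) cong_trans[OF lvlD[OF _ assms(4,5)] assms(6)] by auto
  show "subgroup K' F" unfolding assms(7) by (rule hom_mod_kernel_subgroup[OF assms(1) add])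
qed

end

section \<open>Counting functions\<close>

context magnus_coefficients
begin

definition res :: "'a set \<Rightarrow> ('a \<Rightarrow> int) \<Rightarrow> 'a \<Rightarrow> int" where
  "res K \<phi> = (\<lambda>k\<in>K. \<phi> k mod int p)"

lemma res_eq_iff: "res K \<phi> = res K \<psi> \<longleftrightarrow> (\<forall>k\<in>K. [\<phi> k = \<psi> k] (mod (int p)))"
  by (auto simp: res_def cong_def fun_eq_iff restrict_def)

lemma finite_res_Pol: assumes "K \<subseteq> carrier F" shows "finite (res K ` Pol m)"
proof -
  have "res K ` Pol m \<subseteq> (\<lambda>l. res K (comb m l)) ` (words m \<rightarrow>\<^sub>E {0..<int p})"
  proof
    fix z assume "z \<in> res K ` Pol m"
    then obtain \<phi> l where z: "z = res K \<phi>" "\<phi> \<doteq> comb m l" by (auto simp: Pol_def)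
    define l' where "l' = (\<lambda>w\<in>words m. l w mod int p)"
    have "[comb m l f = comb m l' f] (mod (int p))" for f
      unfolding comb_def by (intro cong_sum cong_mult cong_refl) (simp add: l'_def cong_def)
    then have "res K \<phi> = res K (comb m l')"
      using z(2) assms unfolding res_eq_iff by (meson cong_trans subsetD)
    moreover have "l' \<in> words m \<rightarrow>\<^sub>E {0..<int p}"
      using prime_gt_0_nat[OF prime_p] by (auto simp: l'_def)
    ultimately show "z \<in> (\<lambda>l. res K (comb m l)) ` (words m \<rightarrow>\<^sub>E {0..<int p})" using z by blast
  qed
  moreover have "finite (words m \<rightarrow>\<^sub>E {0..<int p})" by (intro finite_PiE) auto
  ultimately show ?thesis by (meson finite_imageI finite_subset)
qed

text \<open>For a subspace V this is p to the dimension of its restriction to K. Cardinalities make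
  multiplicative inequalities out of linear algebra; dimensions reappear as logarithms to base
  p.\<close>

definition count :: "('a \<Rightarrow> int) set \<Rightarrow> 'a set \<Rightarrow> nat" where
  "count V K = card (res K ` V)"

lemma finite_res: "V \<subseteq> Pol m \<Longrightarrow> K \<subseteq> carrier F \<Longrightarrow> finite (res K ` V)"
  using finite_res_Pol by (meson finite_subset image_mono)

lemma count_pos: "V \<subseteq> Pol m \<Longrightarrow> K \<subseteq> carrier F \<Longrightarrow> V \<noteq> {} \<Longrightarrow> count V K > 0"
  using finite_res by (auto simp: count_def card_gt_0_iff)

lemma Dif_pow_diff: "(Dif g ^^ b) (\<lambda>f. \<phi> f - \<psi> f) = (\<lambda>f. (Dif g ^^ b) \<phi> f - (Dif g ^^ b) \<psi> f)"
  by (induction b) (auto simp: Dif_def)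

text \<open>By Newton's forward difference formula the value at k g^a is a combination of the first
  a differences along g at k. The induction avoids writing out the binomial coefficients.\<close>

lemma Dif_pow_vanish:
  assumes "k \<in> carrier F" "g \<in> carrier F" "\<And>b. b \<le> a \<Longrightarrow> [(Dif g ^^ b) \<theta> k = 0] (mod (int p))"
  shows "[\<theta> (k \<otimes> g [^] a) = 0] (mod (int p))"
  using assms(3)
proof (induction a arbitrary: \<theta>)
  case 0
  then show ?case using assms 0[of 0] by simp
next
  case (Suc a)
  have 1: "[\<theta> (k \<otimes> g [^] a) = 0] (mod (int p))" by (rule Suc.IH) (use Suc.prems in auto)
  have 2: "[Dif g \<theta> (k \<otimes> g [^] a) = 0] (mod (int p))"
  proof (rule Suc.IH)
    fix b assume "b \<le> a"
    then show "[(Dif g ^^ b) (Dif g \<theta>) k = 0] (mod (int p))"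
      using Suc.prems[of "Suc b"] by (simp add: funpow_swap1)
  qed
  have "\<theta> (k \<otimes> g [^] Suc a) = Dif g \<theta> (k \<otimes> g [^] a) + \<theta> (k \<otimes> g [^] a)"
    using assms by (simp add: Dif_def m_assoc)
  then show ?case using cong_add[OF 2 1] by simp
qed

end

context golod_shafarevich_coefficients
begin

section \<open>Chains of index p inside a level, and the index of the levels\<close>

lemma steps_props: "steps i K c \<Longrightarrow> subgroup K F \<and> lvl (Suc i) \<subseteq> K \<and> K \<subseteq> lvl i"
  by (induction rule: steps.induct) (auto simp: step_def lvl_subgroup lvl_antimono)

text \<open>As \<phi> takes the value a modulo p at g^a, the powers of g with exponent below p
  represent the cosets of K' in K.\<close>

lemma stepE:
  assumes "step i K' K"
  obtains \<phi> g where "subgroup K F" "lvl (Suc i) \<subseteq> K" "K \<subseteq> lvl i" "\<phi> \<in> Pol (Suc i)" "\<phi> \<in> Inv R"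
    "[\<phi> \<one> = 0] (mod (int p))" "K' = {k \<in> K. [\<phi> k = 0] (mod (int p))}" "g \<in> K" "[\<phi> g = 1] (mod (int p))"
    "subgroup K' F" "lvl (Suc i) \<subseteq> K'" "K' \<subseteq> K" "g \<in> carrier F" "K \<subseteq> carrier F"
    "\<And>g h. g \<in> K \<Longrightarrow> h \<in> K \<Longrightarrow> [\<phi> (g \<otimes> h) = \<phi> g + \<phi> h] (mod (int p))"
    "\<And>k. k \<in> K \<Longrightarrow> \<exists>a<p. \<exists>k'\<in>K'. k = k' \<otimes> g [^] a"
proof -
  obtain \<phi> g where h: "subgroup K F" "lvl (Suc i) \<subseteq> K" "K \<subseteq> lvl i" "\<phi> \<in> Pol (Suc i)" "\<phi> \<in> Inv R"
    "[\<phi> \<one> = 0] (mod (int p))" "K' = {k \<in> K. [\<phi> k = 0] (mod (int p))}" "g \<in> K" "[\<phi> g = 1] (mod (int p))"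
    using assms unfolding step_def by blast
  note sp = step_props[OF h(1,3,2,4-7)]
  have Kc: "K \<subseteq> carrier F" using h(1) subgroup.subset by blast
  have dec: "\<exists>a<p. \<exists>k'\<in>K'. k = k' \<otimes> g [^] a" if k: "k \<in> K" for k
  proof -
    define a where "a = nat (\<phi> k mod int p)"
    have a: "a < p" "int a = \<phi> k mod int p" using p_gt_1 by (auto simp: a_def nat_less_iff)
    have ga: "g [^] a \<in> K" by (rule pow_in_subgroup[OF h(1) h(8)])
    have "[\<phi> (g [^] a) = int a * 1] (mod (int p))"
      using cong_trans[OF hom_mod_pow[OF h(1) sp(3) h(8)] cong_mult[OF cong_refl h(9)]] .
    then have "[\<phi> k = \<phi> (g [^] a)] (mod (int p))" using a by (simp add: cong_def)
    then have "[\<phi> k - \<phi> (g [^] a) = 0] (mod (int p))" by (simp add: cong_diff_iff_cong_0)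
    from cong_trans[OF hom_mod_div[OF h(1) sp(3) k ga] this]
    have "k \<otimes> inv (g [^] a) \<in> K'"
      using subgroup.m_closed[OF h(1) k subgroup.m_inv_closed[OF h(1) ga]] by (simp add: h(7))
    moreover have "k = k \<otimes> inv (g [^] a) \<otimes> g [^] a" using subsetD[OF Kc k] subsetD[OF Kc ga] by (simp add: m_assoc)
    ultimately show ?thesis using a by blast
  qed
  show ?thesis
    by (rule that[OF h sp(1,2) _ _ Kc sp(3) dec]) (use h Kc in auto)
qed

lemma step_card: assumes "step i K' K" shows "card ((\<lambda>a. K' #> a) ` K) = p"
proof -
  from assms obtain \<phi> g where h: "subgroup K F" "lvl (Suc i) \<subseteq> K" "K \<subseteq> lvl i" "\<phi> \<in> Pol (Suc i)" "\<phi> \<in> Inv R"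
    "[\<phi> \<one> = 0] (mod (int p))" "K' = {k \<in> K. [\<phi> k = 0] (mod (int p))}" "g \<in> K" "[\<phi> g = 1] (mod (int p))"
    "subgroup K' F" "lvl (Suc i) \<subseteq> K'" "K' \<subseteq> K" "g \<in> carrier F" "K \<subseteq> carrier F"
    "\<And>g h. g \<in> K \<Longrightarrow> h \<in> K \<Longrightarrow> [\<phi> (g \<otimes> h) = \<phi> g + \<phi> h] (mod (int p))"
    "\<And>k. k \<in> K \<Longrightarrow> \<exists>a<p. \<exists>k'\<in>K'. k = k' \<otimes> g [^] a"
    by (rule stepE) (rule that)
  have "\<not> [\<phi> g = 0] (mod (int p))"
    using h(9) p_gt_1 by (auto simp: cong_def)
  then show ?thesis using hom_mod_kernel_cosets[OF h(1) h(15) h(8)] by (simp add: h(7))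
qed

lemma steps_card:
  assumes "steps i K c" "subgroup C F" "C \<subseteq> lvl (Suc i)"
  shows "card ((\<lambda>a. C #> a) ` K) = p ^ c * card ((\<lambda>a. C #> a) ` lvl (Suc i))"
  using assms(1)
proof induction
  case (step K' c K)
  note k = steps_props[OF step(1)]
  have "K' \<subseteq> K" "subgroup K F" using step(2) by (auto simp: step_def)
  then have "card ((\<lambda>a. C #> a) ` K) = p * card ((\<lambda>a. C #> a) ` K')"
    using card_cosets_tower[OF assms(2), of K' K] k assms(3) step_card[OF step(2)] by auto
  then show ?case using step by simp
qed simp

text \<open>Induction on the index of \<open>lvl (Suc i)\<close> in K. An element of K outside
  \<open>lvl (Suc i)\<close> is separated from the identity by some R-invariant function in
  \<open>Pol (Suc i)\<close>; normalised to 0 at the identity and 1 at that element, it is a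
  homomorphism on K whose kernel is the next smaller term.\<close>

lemma steps_exist_aux:
  assumes "subgroup K F" "lvl (Suc i) \<subseteq> K" "K \<subseteq> lvl i"
  shows "\<exists>c. steps i K c"
  using assms
proof (induction "card ((\<lambda>a. lvl (Suc i) #> a) ` K)" arbitrary: K rule: less_induct)
  case less
  have Kc: "K \<subseteq> carrier F" using less.prems subgroup.subset by blast
  show ?case
  proof (cases "K = lvl (Suc i)")
    case True
    then show ?thesis using steps.base by auto
  next
    case False
    then obtain k where k: "k \<in> K" "k \<notin> lvl (Suc i)" using less.prems by auto
    then obtain \<phi> where \<phi>: "\<phi> \<in> Pol (Suc i)" "\<phi> \<in> Inv R" "\<not> [\<phi> k = \<phi> \<one>] (mod (int p))"
      using lvl_memI[of k "Suc i"] Kc by blast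
    then have "\<not> int p dvd (\<phi> k - \<phi> \<one>)" by (simp add: cong_iff_dvd_diff)
    then have "coprime (\<phi> k - \<phi> \<one>) (int p)"
      using prime_p by (metis coprime_commute prime_imp_coprime prime_nat_int_transfer)
    then obtain u where u: "[(\<phi> k - \<phi> \<one>) * u = 1] (mod (int p))" using cong_solve_coprime_int by blast
    define \<psi> where "\<psi> f = u * (\<phi> f - \<phi> \<one>)" for f
    define K' where "K' = {k \<in> K. [\<psi> k = 0] (mod (int p))}"
    have \<psi>: "\<psi> \<in> Pol (Suc i)" "\<psi> \<in> Inv R" "[\<psi> \<one> = 0] (mod (int p))" "[\<psi> k = 1] (mod (int p))"
      using u unfolding \<psi>_def[abs_def]
      by (auto intro!: Pol_scale Pol_diff Pol_const \<phi> Inv_mult Inv_diff Inv_const simp: mult.commute)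
    have st: "step i K' K" unfolding step_def using less.prems \<psi> k K'_def by blast
    note sp = step_props[OF less.prems(1,3,2) \<psi>(1-3) K'_def]
    have K'K: "K' \<subseteq> K" by (auto simp: K'_def)
    have "lvl (Suc i) #> k \<notin> (\<lambda>a. lvl (Suc i) #> a) ` K'"
    proof
      assume "lvl (Suc i) #> k \<in> (\<lambda>a. lvl (Suc i) #> a) ` K'"
      then obtain a where a: "a \<in> K'" "lvl (Suc i) #> k = lvl (Suc i) #> a" by auto
      then have "k \<in> lvl (Suc i) #> a" using rcos_self[OF _ lvl_subgroup, of k "Suc i"] k Kc by auto
      then have "k \<in> K'" using subgroup.m_closed[OF sp(1)] sp(2) a by (auto simp: r_coset_def)
      then have "[\<psi> k = 0] (mod (int p))" by (simp add: K'_def)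
      then have "[1 = 0] (mod (int p))" using \<psi>(4) by (meson cong_sym cong_trans)
      then show False using p_gt_1 by (simp add: cong_def)
    qed
    then have "(\<lambda>a. lvl (Suc i) #> a) ` K' \<subset> (\<lambda>a. lvl (Suc i) #> a) ` K" using K'K k by blast
    moreover have "finite ((\<lambda>a. lvl (Suc i) #> a) ` K)"
      using lvl_cosets(1)[of "Suc i"] Kc by (meson finite_subset image_mono)
    ultimately have "card ((\<lambda>a. lvl (Suc i) #> a) ` K') < card ((\<lambda>a. lvl (Suc i) #> a) ` K)"
      by (rule psubset_card_mono[rotated])
    then obtain c where "steps i K' c" using less.hyps[OF _ sp(1,2)] K'K less.prems by blast
    then show ?thesis using st steps.step by blast
  qed
qed

text \<open>The dimension over \<open>\<F>\<^sub>p\<close> of the \<open>i\<close>-th factor of the series (see \<open>index_lvl\<close>).\<close>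

definition cdim :: "nat \<Rightarrow> nat" where "cdim i = (SOME c. steps i (lvl i) c)"

lemma steps_cdim: "steps i (lvl i) (cdim i)"
  unfolding cdim_def using steps_exist_aux[OF lvl_subgroup lvl_antimono, of i i]
  by (auto intro: someI_ex)

lemma index_lvl: "card ((\<lambda>a. lvl n #> a) ` lvl k) = p ^ (\<Sum>i\<in>{k..<n}. cdim i)" if "k \<le> n"
  using that
proof (induction "n - k" arbitrary: k)
  case 0
  have "(\<lambda>a. lvl n #> a) ` lvl n = {lvl n}"
    using subgroup.rcos_const[OF lvl_subgroup is_group] subgroup.one_closed[OF lvl_subgroup] by fastforce
  then show ?case using 0 by simp
next
  case (Suc d)
  have "card ((\<lambda>a. lvl n #> a) ` lvl k) = p ^ cdim k * card ((\<lambda>a. lvl n #> a) ` lvl (Suc k))"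
    using steps_card[OF steps_cdim lvl_subgroup lvl_antimono] Suc by auto
  also have "card ((\<lambda>a. lvl n #> a) ` lvl (Suc k)) = p ^ (\<Sum>i\<in>{Suc k..<n}. cdim i)"
    by (rule Suc.hyps(1)) (use Suc in auto)
  finally show ?case using Suc by (simp add: power_add[symmetric] sum.atLeast_Suc_lessThan)
qed

text \<open>\<open>VR\<close> collects functions on the presented group, \<open>VL n\<close>
  functions on the finite quotient F / \<open>lvl n\<close>. The upper estimates concern the former,
  the lower estimates the latter.\<close>

abbreviation VR :: "nat \<Rightarrow> ('a \<Rightarrow> int) set" where "VR m \<equiv> Pol m \<inter> Inv R"
abbreviation VL :: "nat \<Rightarrow> nat \<Rightarrow> ('a \<Rightarrow> int) set" where "VL n m \<equiv> Pol m \<inter> Inv (lvl n)"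

text \<open>Two of the p cosets are used: on K' the function \<phi> vanishes and leaves \<alpha>; on
  g K' it is 1 and, once \<alpha> is known, reveals \<beta>. The product stays in
  \<open>Pol m\<close> because \<phi> has degree at most i and \<beta> degree below m - i, and
  \<phi> is \<open>lvl n\<close>-invariant because i < n.\<close>

lemma count_lower_step:
  assumes "step i K' K" "i < n"
  shows "count (VL n m) K' * count (VL n (m - i)) K' \<le> count (VL n m) K"
proof -
  from assms(1) obtain \<phi> g where h: "subgroup K F" "lvl (Suc i) \<subseteq> K" "K \<subseteq> lvl i" "\<phi> \<in> Pol (Suc i)" "\<phi> \<in> Inv R"
    "[\<phi> \<one> = 0] (mod (int p))" "K' = {k \<in> K. [\<phi> k = 0] (mod (int p))}" "g \<in> K" "[\<phi> g = 1] (mod (int p))"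
    "subgroup K' F" "lvl (Suc i) \<subseteq> K'" "K' \<subseteq> K" "g \<in> carrier F" "K \<subseteq> carrier F"
    "\<And>g h. g \<in> K \<Longrightarrow> h \<in> K \<Longrightarrow> [\<phi> (g \<otimes> h) = \<phi> g + \<phi> h] (mod (int p))"
    "\<And>k. k \<in> K \<Longrightarrow> \<exists>a<p. \<exists>k'\<in>K'. k = k' \<otimes> g [^] a"
    by (rule stepE) (rule that)
  let ?A = "res K' ` VL n m" and ?B = "res K' ` VL n (m - i)" and ?C = "res K ` VL n m"
  have \<phi>L: "\<phi> \<in> Inv (lvl n)"
    using lvl_Inv[OF h(4,5)] Inv_antimono[OF lvl_antimono[of "Suc i" n]] assms(2) by auto
  define la where "la \<alpha> = (SOME \<psi>. \<psi> \<in> VL n m \<and> res K' \<psi> = \<alpha>)" for \<alpha>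
  define lb where "lb \<alpha> = (SOME \<psi>. \<psi> \<in> VL n (m - i) \<and> res K' \<psi> = \<alpha>)" for \<alpha>
  have la: "la \<alpha> \<in> VL n m" "res K' (la \<alpha>) = \<alpha>" if "\<alpha> \<in> ?A" for \<alpha>
    using someI_ex[of "\<lambda>\<psi>. \<psi> \<in> VL n m \<and> res K' \<psi> = \<alpha>"] that by (auto simp: la_def)
  have lb: "lb \<alpha> \<in> VL n (m - i)" "res K' (lb \<alpha>) = \<alpha>" if "\<alpha> \<in> ?B" for \<alpha>
    using someI_ex[of "\<lambda>\<psi>. \<psi> \<in> VL n (m - i) \<and> res K' \<psi> = \<alpha>"] that by (auto simp: lb_def)
  define T where "T = (\<lambda>(\<alpha>, \<beta>) f. la \<alpha> f + \<phi> f * lb \<beta> (inv g \<otimes> f))"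
  have "card (?A \<times> ?B) \<le> card ?C"
  proof (rule card_inj_on_le)
    show "finite ?C" by (rule finite_res[OF _ h(14)]) auto
    show "(\<lambda>z. res K (T z)) ` (?A \<times> ?B) \<subseteq> ?C"
    proof clarify
      fix \<psi> \<psi>' assume a: "\<psi> \<in> Pol m" "\<psi> \<in> Inv (lvl n)" "\<psi>' \<in> Pol (m - i)" "\<psi>' \<in> Inv (lvl n)"
      let ?a = "la (res K' \<psi>)" and ?b = "lb (res K' \<psi>')"
      have l: "?a \<in> VL n m" "?b \<in> VL n (m - i)" using la lb a by blast+
      have bt: "(\<lambda>f. ?b (inv g \<otimes> f)) \<in> VL n (m - i)"
        using l(2) h(13) by (auto intro!: Pol_translate_left Inv_translate_left lvl_subset)
      have "(\<lambda>f. \<phi> f * ?b (inv g \<otimes> f)) \<in> Pol m"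
      \<comment> \<open>For m <= i the bound i + 1 + (m - i) - 1 would be i, possibly more than m;
        but then the second factor is zero.\<close>
      proof (cases "m - i = 0")
        case True
        then show ?thesis using bt Pol_mult_0 by auto
      next
        case False
        have "(\<lambda>f. \<phi> f * ?b (inv g \<otimes> f)) \<in> Pol (Suc i + (m - i) - 1)"
          using Pol_mult[OF h(4), of "\<lambda>f. ?b (inv g \<otimes> f)" "m - i"] bt by auto
        then show ?thesis using False by simp
      qed
      then have "T (res K' \<psi>, res K' \<psi>') \<in> VL n m"
        using l bt by (auto simp: T_def intro!: Pol_add Inv_add Inv_mult \<phi>L)
      then show "res K (T (res K' \<psi>, res K' \<psi>')) \<in> ?C" by blast
    qed
    show "inj_on (\<lambda>z. res K (T z)) (?A \<times> ?B)"
    proof (rule inj_onI)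
      fix z z' assume z: "z \<in> ?A \<times> ?B" "z' \<in> ?A \<times> ?B" and eq: "res K (T z) = res K (T z')"
      obtain \<alpha> \<beta> \<alpha>' \<beta>' where zz: "z = (\<alpha>, \<beta>)" "z' = (\<alpha>', \<beta>')" by (metis surj_pair)
      have mem: "\<alpha> \<in> ?A" "\<beta> \<in> ?B" "\<alpha>' \<in> ?A" "\<beta>' \<in> ?B" using z zz by auto
      have E: "[la \<alpha> k + \<phi> k * lb \<beta> (inv g \<otimes> k) = la \<alpha>' k + \<phi> k * lb \<beta>' (inv g \<otimes> k)] (mod (int p))"
        if "k \<in> K" for k
        using eq that unfolding res_eq_iff by (auto simp: T_def zz)
      have "[la \<alpha> k = la \<alpha>' k] (mod (int p))" if "k \<in> K'" for k
      proof -
        have k: "k \<in> K" "[\<phi> k = 0] (mod (int p))" using that h(7) by auto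
        have "[la \<gamma> k + \<phi> k * c = la \<gamma> k] (mod (int p))" for \<gamma> c
          using cong_add[OF cong_refl cong_mult[OF k(2) cong_refl], of "la \<gamma> k" c] by simp
        then show ?thesis using E[OF k(1)] by (meson cong_sym cong_trans)
      qed
      then have \<alpha>: "\<alpha> = \<alpha>'" using la mem res_eq_iff by metis
      have "[lb \<beta> k = lb \<beta>' k] (mod (int p))" if "k \<in> K'" for k
      proof -
        have k: "k \<in> K" "[\<phi> k = 0] (mod (int p))" "k \<in> carrier F" using that h(7,14) by auto
        have gk: "g \<otimes> k \<in> K" "inv g \<otimes> (g \<otimes> k) = k"
          using subgroup.m_closed[OF h(1) h(8) k(1)] h(13) k by (auto simp: m_assoc[symmetric])
        have p1: "[\<phi> (g \<otimes> k) = 1] (mod (int p))"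
          using cong_trans[OF h(15)[OF h(8) k(1)] cong_add[OF h(9) k(2)]] by simp
        have "[\<phi> (g \<otimes> k) * lb \<beta> k = \<phi> (g \<otimes> k) * lb \<beta>' k] (mod (int p))"
          using E[OF gk(1)] by (simp add: gk(2) \<alpha> cong_add_lcancel)
        moreover have "[\<phi> (g \<otimes> k) * c = c] (mod (int p))" for c
          using cong_mult[OF p1 cong_refl, of c] by simp
        ultimately show ?thesis by (meson cong_sym cong_trans)
      qed
      then have "\<beta> = \<beta>'" using lb mem res_eq_iff by metis
      then show "z = z'" using \<alpha> zz by simp
    qed
  qed
  then show ?thesis by (simp add: count_def card_cartesian_product)
qed

text \<open>Each element of K is k' g^a with a < p, so a function on K is determined by its
  differences of order below p along g at the points of K'. As g lies in \<open>lvl i\<close>, every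
  difference costs degree i; that is \<open>Dif_lvl\<close>, which is about R-invariant
  functions.\<close>

lemma count_upper_step:
  assumes "step i K' K"
  shows "count (VR m) K \<le> (\<Prod>a<p. count (VR (m - a * i)) K')"
proof -
  from assms obtain \<phi> g where h: "subgroup K F" "lvl (Suc i) \<subseteq> K" "K \<subseteq> lvl i" "\<phi> \<in> Pol (Suc i)" "\<phi> \<in> Inv R"
    "[\<phi> \<one> = 0] (mod (int p))" "K' = {k \<in> K. [\<phi> k = 0] (mod (int p))}" "g \<in> K" "[\<phi> g = 1] (mod (int p))"
    "subgroup K' F" "lvl (Suc i) \<subseteq> K'" "K' \<subseteq> K" "g \<in> carrier F" "K \<subseteq> carrier F"
    "\<And>g h. g \<in> K \<Longrightarrow> h \<in> K \<Longrightarrow> [\<phi> (g \<otimes> h) = \<phi> g + \<phi> h] (mod (int p))"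
    "\<And>k. k \<in> K \<Longrightarrow> \<exists>a<p. \<exists>k'\<in>K'. k = k' \<otimes> g [^] a"
    by (rule stepE) (rule that)
  define T where "T \<psi> = (\<lambda>a\<in>{..<p}. res K' ((Dif g ^^ a) \<psi>))" for \<psi>
  have pow: "(Dif g ^^ a) \<psi> \<in> VR (m - a * i)" if "\<psi> \<in> VR m" for a \<psi>
  proof (induction a)
    case (Suc a)
    then have "Dif g ((Dif g ^^ a) \<psi>) \<in> VR (m - a * i - i)" using Dif_lvl h(3,8) by blast
    then show ?case by (simp add: add.commute)
  qed (use that in auto)
  let ?P = "\<Pi>\<^sub>E a\<in>{..<p}. res K' ` VR (m - a * i)"
  have fin: "finite ?P" using h(12,14) by (intro finite_PiE finite_res[of _ "m - _ * i"]) auto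
  have sub: "T ` VR m \<subseteq> ?P" using pow by (auto simp: T_def)
  have "card (res K ` VR m) \<le> card (T ` VR m)"
  proof (rule card_image_le_of_kernel(2)[OF finite_subset[OF sub fin]])
    fix \<psi> \<zeta> assume "\<psi> \<in> VR m" "\<zeta> \<in> VR m" and eq: "T \<psi> = T \<zeta>"
    have z: "[(Dif g ^^ b) (\<lambda>f. \<psi> f - \<zeta> f) k = 0] (mod (int p))" if "b < p" "k \<in> K'" for b k
    proof -
      have "res K' ((Dif g ^^ b) \<psi>) = res K' ((Dif g ^^ b) \<zeta>)"
        using fun_cong[OF eq, of b] that by (simp add: T_def)
      then show ?thesis using that unfolding res_eq_iff Dif_pow_diff by (simp add: cong_diff_iff_cong_0)
    qed
    have "[\<psi> k = \<zeta> k] (mod (int p))" if kK: "k \<in> K" for k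
    proof -
      obtain a k' where a: "a < p" "k' \<in> K'" "k = k' \<otimes> g [^] a" using h(16)[OF kK] by blast
      have "[\<psi> k - \<zeta> k = 0] (mod (int p))"
        using Dif_pow_vanish[of k' g a "\<lambda>f. \<psi> f - \<zeta> f"] z a h(12,13,14) by auto
      then show ?thesis by (simp add: cong_diff_iff_cong_0)
    qed
    then show "res K \<psi> = res K \<zeta>" by (simp add: res_eq_iff)
  qed
  also have "\<dots> \<le> card ?P" by (rule card_mono[OF fin sub])
  finally show ?thesis by (simp add: count_def card_PiE)
qed

lemma count_ge_p: assumes "m > 0" "K \<subseteq> carrier F" "K \<noteq> {}" shows "p \<le> count (VL n m) K"
proof -
  have "(\<lambda>c. res K (\<lambda>_. c)) ` {0..<int p} \<subseteq> res K ` VL n m" using Pol_const[OF assms(1)] Inv_const by blast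
  moreover have "inj_on (\<lambda>c. res K (\<lambda>_. c)) {0..<int p}"
    using assms(3) by (auto simp: inj_on_def res_eq_iff cong_def)
  moreover have "finite (res K ` VL n m)" by (rule finite_res[OF _ assms(2)]) auto
  ultimately show ?thesis
    unfolding count_def using card_inj_on_le[of "\<lambda>c. res K (\<lambda>_. c)" "{0..<int p}"] by simp
qed

lemma count_lvl_le_p: assumes "m \<le> n" shows "count (VR m) (lvl n) \<le> p"
proof -
  have "res (lvl n) ` VR m \<subseteq> (\<lambda>c. res (lvl n) (\<lambda>_. c)) ` {0..<int p}"
  proof clarify
    fix \<phi> assume \<phi>: "\<phi> \<in> Pol m" "\<phi> \<in> Inv R"
    have "[\<phi> h = \<phi> \<one> mod int p] (mod (int p))" if "h \<in> lvl n" for h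
      using lvlD[OF that Pol_mono[OF \<phi>(1) assms] \<phi>(2)] by (simp add: cong_def)
    then have "res (lvl n) \<phi> = res (lvl n) (\<lambda>_. \<phi> \<one> mod int p)" by (simp add: res_eq_iff)
    then show "res (lvl n) \<phi> \<in> (\<lambda>c. res (lvl n) (\<lambda>_. c)) ` {0..<int p}" using p_gt_1 by auto
  qed
  then have "card (res (lvl n) ` VR m) \<le> card {0..<int p}"
    by (meson card_image_le card_mono finite_atLeastLessThan_int finite_imageI order_trans)
  then show ?thesis by (simp add: count_def)
qed

lemma count_Pol_0: assumes "V \<subseteq> Pol 0" "K \<subseteq> carrier F" shows "count V K \<le> 1"
proof -
  have "[\<phi> k = 0] (mod (int p))" if "\<phi> \<in> V" "k \<in> K" for \<phi> k
    using assms that Pol_0[of \<phi>] by blast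
  then have "res K ` V \<subseteq> {res K (\<lambda>_. 0)}" by (auto simp: res_eq_iff)
  then show ?thesis unfolding count_def using card_mono[of "{res K (\<lambda>_. 0)}"] by simp
qed

text \<open>Whatever its degree, such a function lives on a finite set of cosets. Uniformity in m is
  what makes the series \<open>SL\<close> converge.\<close>

lemma count_VL_bound: "count (VL n m) (carrier F) \<le> p ^ card ((\<lambda>a. lvl n #> a) ` carrier F)"
proof -
  let ?Q = "(\<lambda>a. lvl n #> a) ` carrier F"
  define T where "T \<phi> = (\<lambda>U\<in>?Q. \<phi> (SOME a. a \<in> U) mod int p)" for \<phi> :: "'a \<Rightarrow> int"
  have fin: "finite (?Q \<rightarrow>\<^sub>E {0..<int p})" using lvl_cosets(1)[of n] by (intro finite_PiE) auto
  have sub: "T ` VL n m \<subseteq> (?Q \<rightarrow>\<^sub>E {0..<int p})" using p_gt_1 by (auto simp: T_def)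
  have rep: "[\<phi> (SOME a. a \<in> lvl n #> f) = \<phi> f] (mod (int p))" if "\<phi> \<in> VL n m" "f \<in> carrier F" for \<phi> f
  proof -
    have "(SOME a. a \<in> lvl n #> f) \<in> lvl n #> f"
      using rcos_self[OF that(2) lvl_subgroup] by (rule someI)
    then obtain h where "h \<in> lvl n" "(SOME a. a \<in> lvl n #> f) = h \<otimes> f" by (auto simp: r_coset_def)
    moreover from this have "h \<in> carrier F" using lvl_subset by auto
    ultimately show ?thesis using InvD[of \<phi> "lvl n" \<one> h f] that by auto
  qed
  have "card (res (carrier F) ` VL n m) \<le> card (T ` VL n m)"
  proof (rule card_image_le_of_kernel(2)[OF finite_subset[OF sub fin]])
    fix \<phi> \<psi> assume a: "\<phi> \<in> VL n m" "\<psi> \<in> VL n m" "T \<phi> = T \<psi>"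
    have "[\<phi> f = \<psi> f] (mod (int p))" if "f \<in> carrier F" for f
      using fun_cong[OF a(3), of "lvl n #> f"] that rep[OF a(1) that] rep[OF a(2) that]
      by (auto simp: T_def cong_def)
    then show "res (carrier F) \<phi> = res (carrier F) \<psi>" by (simp add: res_eq_iff)
  qed
  also have "\<dots> \<le> card (?Q \<rightarrow>\<^sub>E {0..<int p})" by (rule card_mono[OF fin sub])
  also have "\<dots> = p ^ card ?Q" using lvl_cosets(1)[of n] by (simp add: card_PiE)
  finally show ?thesis by (simp add: count_def)
qed

end

section \<open>Golod-Shafarevich inequalities\<close>

context magnus_coefficients
begin

text \<open>Rank-nullity in terms of cardinalities: subtracting a chosen element of the same fibre
  of T moves a function into \<open>A0\<close>, which plays the kernel.\<close>

lemma count_fibres: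
  assumes "finite (T ` A)" "finite (res K ` A0)"
    and "\<And>\<phi> \<psi>. \<phi> \<in> A \<Longrightarrow> \<psi> \<in> A \<Longrightarrow> T \<phi> = T \<psi> \<Longrightarrow> (\<lambda>f. \<phi> f - \<psi> f) \<in> A0"
  shows "count A K \<le> card (T ` A) * count A0 K"
proof -
  define c where "c \<rho> = (SOME \<phi>. \<phi> \<in> A \<and> res K \<phi> = \<rho>)" for \<rho>
  define d where "d \<tau> = (SOME \<phi>. \<phi> \<in> A \<and> T \<phi> = \<tau>)" for \<tau>
  have c: "c \<rho> \<in> A" "res K (c \<rho>) = \<rho>" if "\<rho> \<in> res K ` A" for \<rho>
    using someI_ex[of "\<lambda>\<phi>. \<phi> \<in> A \<and> res K \<phi> = \<rho>"] that by (auto simp: c_def)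
  have d: "d \<tau> \<in> A" "T (d \<tau>) = \<tau>" if "\<tau> \<in> T ` A" for \<tau>
    using someI_ex[of "\<lambda>\<phi>. \<phi> \<in> A \<and> T \<phi> = \<tau>"] that by (auto simp: d_def)
  define h where "h \<rho> = (T (c \<rho>), res K (\<lambda>f. c \<rho> f - d (T (c \<rho>)) f))" for \<rho>
  have "card (res K ` A) \<le> card (T ` A \<times> res K ` A0)"
  proof (rule card_inj_on_le)
    show "inj_on h (res K ` A)"
    proof (rule inj_onI)
      fix \<rho> \<sigma> assume m: "\<rho> \<in> res K ` A" "\<sigma> \<in> res K ` A" and eq: "h \<rho> = h \<sigma>"
      from eq have e0: "T (c \<rho>) = T (c \<sigma>) \<and>
        res K (\<lambda>f. c \<rho> f - d (T (c \<rho>)) f) = res K (\<lambda>f. c \<sigma> f - d (T (c \<sigma>)) f)"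
        unfolding h_def prod.inject .
      note e = conjunct1[OF e0] conjunct2[OF e0]
      from e(2) have "res K (\<lambda>f. c \<rho> f - d (T (c \<rho>)) f) = res K (\<lambda>f. c \<sigma> f - d (T (c \<rho>)) f)"
        by (simp only: e(1))
      then have r: "\<forall>k\<in>K. [c \<rho> k - d (T (c \<rho>)) k = c \<sigma> k - d (T (c \<rho>)) k] (mod (int p))"
        by (simp add: res_eq_iff)
      have "[c \<rho> k = c \<sigma> k] (mod (int p))" if "k \<in> K" for k
        using cong_add[OF bspec[OF r that] cong_refl, of "d (T (c \<rho>)) k"] by simp
      then have "res K (c \<rho>) = res K (c \<sigma>)" by (simp add: res_eq_iff)
      then show "\<rho> = \<sigma>" using c m by simp
    qed
    show "h ` res K ` A \<subseteq> T ` A \<times> res K ` A0"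
      using c d assms(3) by (fastforce simp: h_def)
    show "finite (T ` A \<times> res K ` A0)" using assms by simp
  qed
  then show ?thesis by (simp add: count_def card_cartesian_product)
qed

text \<open>Primitives of S-invariant functions. \<phi> itself may vary along S; the relator
  conditions and \<open>hom_res\<close> measure this variation.\<close>

definition Prim :: "'a set \<Rightarrow> nat \<Rightarrow> ('a \<Rightarrow> int) set" where
  "Prim S i = {\<phi> \<in> Pol i. \<forall>x\<in>X. Dif x \<phi> \<in> Inv S}"

lemma Prim_diff: "\<phi> \<in> Prim S i \<Longrightarrow> \<psi> \<in> Prim S i \<Longrightarrow> (\<lambda>f. \<phi> f - \<psi> f) \<in> Prim S i"
  using Inv_diff Dif_pow_diff[of 1] by (auto simp: Prim_def Pol_diff)

text \<open>The difference along g h is the difference along h translated by g, plus the difference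
  along g; this extends S-invariance from X to the generated subgroup. Any element of F can be
  replaced by one of that subgroup, since \<phi> sees only finitely many coefficients.\<close>

lemma Prim_Dif:
  assumes "\<phi> \<in> Prim S i" "S \<subseteq> carrier F" "g \<in> carrier F"
  shows "Dif g \<phi> \<in> Inv S"
proof -
  have gen: "Dif g \<phi> \<in> Inv S" if "g \<in> generate F X" for g
    using that
  proof induction
    case one
    have "(\<lambda>_. 0) \<in> Inv S" by (rule Inv_const)
    moreover have "Dif \<one> \<phi> \<doteq> (\<lambda>_. 0)" by (simp add: Dif_def)
    ultimately show ?case using Inv_cong assms(2) by blast
  next
    case (incl x)
    then show ?case using assms(1) by (simp add: Prim_def)
  next
    case (inv x)
    then have x: "x \<in> carrier F" "Dif x \<phi> \<in> Inv S" using assms(1) X_subset by (auto simp: Prim_def)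
    have "(\<lambda>f. 0 - Dif x \<phi> (f \<otimes> inv x)) \<in> Inv S"
      using x assms(2) by (intro Inv_diff Inv_const Inv_translate_right) auto
    moreover have "Dif (inv x) \<phi> \<doteq> (\<lambda>f. 0 - Dif x \<phi> (f \<otimes> inv x))"
      using x by (simp add: Dif_def m_assoc)
    ultimately show ?case using Inv_cong assms(2) by blast
  next
    case (eng g h)
    have gh: "g \<in> carrier F" "h \<in> carrier F" using generate_in_carrier[OF X_subset] eng by auto
    have "(\<lambda>f. Dif h \<phi> (f \<otimes> g) + Dif g \<phi> f) \<in> Inv S"
      using eng gh assms(2) by (intro Inv_add Inv_translate_right) auto
    moreover have "Dif (g \<otimes> h) \<phi> \<doteq> (\<lambda>f. Dif h \<phi> (f \<otimes> g) + Dif g \<phi> f)"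
      using gh by (simp add: Dif_def m_assoc)
    ultimately show ?case using Inv_cong assms(2) by blast
  qed
  obtain h where h: "h \<in> generate F X" "\<forall>w\<in>lists X. length w < i \<longrightarrow> [\<nu> w g = \<nu> w h] (mod (int p))"
    using dense[OF assms(3)] by blast
  have hc: "h \<in> carrier F" using generate_in_carrier[OF X_subset h(1)] .
  have "Dif g \<phi> \<doteq> Dif h \<phi>"
  proof
    fix f assume f: "f \<in> carrier F"
    have "(\<lambda>g. \<phi> (f \<otimes> g)) \<in> Pol i" using assms(1) f by (auto simp: Prim_def intro: Pol_translate_left)
    moreover have "[\<nu> w g = \<nu> w h] (mod (int p))" if "w \<in> words i" for w
      using h(2) that length_le_weight[of w] by (auto simp: words_def simp del: in_lists_conv_set)
    ultimately have "[\<phi> (f \<otimes> g) = \<phi> (f \<otimes> h)] (mod (int p))"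
      using Pol_separated assms(3) hc by blast
    then show "[Dif g \<phi> f = Dif h \<phi> f] (mod (int p))" by (simp add: Dif_def cong_diff)
  qed
  then show ?thesis using Inv_cong[OF gen[OF h(1)]] assms(2) by blast
qed

text \<open>The data c and \<Psi> are recovered from \<zeta>, so distinct data give distinct
  functions; existence is \<open>integrate\<close>.\<close>

lemma count_Prim:
  assumes "i > 0" "S \<subseteq> carrier F"
  shows "p * (\<Prod>x\<in>X. count (Pol (i - D x) \<inter> Inv S) (carrier F)) \<le> count (Prim S i) (carrier F)"
proof -
  let ?V = "\<lambda>x. Pol (i - D x) \<inter> Inv S"
  let ?A = "{0..<int p} \<times> (\<Pi>\<^sub>E x\<in>X. res (carrier F) ` ?V x)"
  define good where "good c \<Psi> \<zeta> \<longleftrightarrow> \<zeta> \<in> Prim S i \<and> [\<zeta> \<one> = c] (mod (int p)) \<and>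
      (\<forall>x\<in>X. res (carrier F) (Dif x \<zeta>) = \<Psi> x)" for c \<Psi> \<zeta>
  have ex: "\<exists>\<zeta>. good c \<Psi> \<zeta>" if "\<Psi> \<in> (\<Pi>\<^sub>E x\<in>X. res (carrier F) ` ?V x)" for c \<Psi>
  proof -
    have "\<forall>x\<in>X. \<exists>\<psi>. \<psi> \<in> ?V x \<and> \<Psi> x = res (carrier F) \<psi>" using that by (auto simp: PiE_iff)
    then obtain \<psi> where \<psi>: "\<And>x. x \<in> X \<Longrightarrow> \<psi> x \<in> ?V x" "\<And>x. x \<in> X \<Longrightarrow> \<Psi> x = res (carrier F) (\<psi> x)"
      by metis
    obtain \<zeta> where \<zeta>: "\<zeta> \<in> Pol i" "\<And>x. x \<in> X \<Longrightarrow> Dif x \<zeta> \<doteq> \<psi> x" "[\<zeta> \<one> = c] (mod (int p))"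
      using integrate[OF assms(1), of \<psi> c] \<psi>(1) by blast
    have "Dif x \<zeta> \<in> Inv S" if "x \<in> X" for x
      using Inv_cong[OF _ \<zeta>(2)[OF that] assms(2)] \<psi>(1)[OF that] by blast
    then have "good c \<Psi> \<zeta>" unfolding good_def Prim_def
      using \<zeta> \<psi>(2) by (auto simp: res_eq_iff)
    then show ?thesis by blast
  qed
  define h where "h = (\<lambda>(c, \<Psi>). res (carrier F) (SOME \<zeta>. good c \<Psi> \<zeta>))"
  have "card ?A \<le> card (res (carrier F) ` Prim S i)"
  proof (rule card_inj_on_le)
    show "h ` ?A \<subseteq> res (carrier F) ` Prim S i"
      using someI_ex[OF ex] by (auto simp: h_def good_def)
    show "finite (res (carrier F) ` Prim S i)"
      by (rule finite_res[of _ i]) (auto simp: Prim_def)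
    show "inj_on h ?A"
    proof (rule inj_onI)
      fix y z assume yz: "y \<in> ?A" "z \<in> ?A" and eq: "h y = h z"
      obtain c \<Psi> c' \<Psi>' where d: "y = (c, \<Psi>)" "z = (c', \<Psi>')" by (metis surj_pair)
      have m: "c \<in> {0..<int p}" "c' \<in> {0..<int p}" "\<Psi> \<in> (\<Pi>\<^sub>E x\<in>X. res (carrier F) ` ?V x)"
        "\<Psi>' \<in> (\<Pi>\<^sub>E x\<in>X. res (carrier F) ` ?V x)" using yz d by auto
      define \<zeta> \<zeta>' where "\<zeta> = (SOME \<zeta>. good c \<Psi> \<zeta>)" and "\<zeta>' = (SOME \<zeta>. good c' \<Psi>' \<zeta>)"
      have g: "good c \<Psi> \<zeta>" "good c' \<Psi>' \<zeta>'"
        using someI_ex[OF ex] m by (auto simp: \<zeta>_def \<zeta>'_def)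
      have e: "\<zeta> \<doteq> \<zeta>'" using eq by (simp add: h_def d \<zeta>_def \<zeta>'_def res_eq_iff)
      then have "[c = c'] (mod (int p))"
        using g unfolding good_def by (meson cong_sym cong_trans one_closed)
      then have "c = c'" using m by (simp add: cong_def)
      moreover have "\<Psi> x = \<Psi>' x" if "x \<in> X" for x
      proof -
        have "res (carrier F) (Dif x \<zeta>) = res (carrier F) (Dif x \<zeta>')"
          unfolding res_eq_iff Dif_def using e that X_subset by (intro ballI cong_diff) auto
        then show ?thesis using g that by (simp add: good_def)
      qed
      ultimately show "y = z" using d PiE_ext[OF m(3,4)] by auto
    qed
  qed
  then show ?thesis by (simp add: count_def card_cartesian_product card_PiE finite_X)
qed

end

context golod_shafarevich_coefficients
begin

section \<open>Relator conditions and homomorphisms on a level\<close>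

definition PrimR :: "'a set \<Rightarrow> nat \<Rightarrow> ('a \<Rightarrow> int) set" where
  "PrimR S i = {\<phi> \<in> Prim S i. \<forall>r\<in>R. Dif r \<phi> \<doteq> (\<lambda>_. 0)}"

lemma Dif_relator_Pol: "\<phi> \<in> Pol i \<Longrightarrow> r \<in> R \<Longrightarrow> Dif r \<phi> \<in> Pol (i - e r)"
  using Dif_Pol[of \<phi> i r "e r"] R_subset nu_relator by auto

text \<open>The map T records the differences along the relators of degree below i, and differences
  of elements in one fibre lie in \<open>PrimR\<close>: along the remaining relators the difference
  is in \<open>Pol 0\<close> and vanishes by itself.\<close>

lemma count_PrimR:
  assumes "S \<subseteq> carrier F"
  shows "count (Prim S i) (carrier F)
    \<le> (\<Prod>r\<in>{r \<in> R. e r < i}. count (Pol (i - e r) \<inter> Inv S) (carrier F)) * count (PrimR S i) (carrier F)"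
proof -
  let ?R = "{r \<in> R. e r < i}"
  let ?P = "\<Pi>\<^sub>E r\<in>?R. res (carrier F) ` (Pol (i - e r) \<inter> Inv S)"
  define T where "T \<phi> = (\<lambda>r\<in>?R. res (carrier F) (Dif r \<phi>))" for \<phi>
  have fin: "finite ?P"
  proof (intro finite_PiE finite_relators)
    fix r show "finite (res (carrier F) ` (Pol (i - e r) \<inter> Inv S))"
      by (rule finite_res[of _ "i - e r"]) auto
  qed
  have sub: "T ` Prim S i \<subseteq> ?P"
  proof clarify
    fix \<phi> assume \<phi>: "\<phi> \<in> Prim S i"
    have "Dif r \<phi> \<in> Pol (i - e r) \<inter> Inv S" if "r \<in> R" for r
      using Dif_relator_Pol[of \<phi> i r] Prim_Dif[OF \<phi> assms, of r] R_subset that \<phi>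
      by (auto simp: Prim_def)
    then show "T \<phi> \<in> ?P" by (auto simp: T_def)
  qed
  have "count (Prim S i) (carrier F) \<le> card (T ` Prim S i) * count (PrimR S i) (carrier F)"
  proof (rule count_fibres)
    show "finite (T ` Prim S i)" using finite_subset[OF sub fin] .
    show "finite (res (carrier F) ` PrimR S i)"
      by (rule finite_res[of _ i]) (auto simp: Prim_def PrimR_def)
    fix \<phi> \<psi> assume a: "\<phi> \<in> Prim S i" "\<psi> \<in> Prim S i" and eq: "T \<phi> = T \<psi>"
    have d: "(\<lambda>f. \<phi> f - \<psi> f) \<in> Prim S i" using Prim_diff a by blast
    moreover have "Dif r (\<lambda>f. \<phi> f - \<psi> f) \<doteq> (\<lambda>_. 0)" if r: "r \<in> R" for r
    proof (cases "e r < i")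
      case True
      then have "res (carrier F) (Dif r \<phi>) = res (carrier F) (Dif r \<psi>)"
        using fun_cong[OF eq, of r] r by (simp add: T_def)
      moreover have "Dif r (\<lambda>f. \<phi> f - \<psi> f) = (\<lambda>f. Dif r \<phi> f - Dif r \<psi> f)" by (auto simp: Dif_def)
      ultimately show ?thesis by (simp add: res_eq_iff cong_diff_iff_cong_0)
    next
      case False
      then have "Dif r (\<lambda>f. \<phi> f - \<psi> f) \<in> Pol 0"
        using Dif_relator_Pol[of "\<lambda>f. \<phi> f - \<psi> f" i r] d r by (simp add: Prim_def)
      then show ?thesis by (simp only: Pol_0)
    qed
    ultimately show "(\<lambda>f. \<phi> f - \<psi> f) \<in> PrimR S i" by (simp add: PrimR_def)
  qed
  also have "\<dots> \<le> card ?P * count (PrimR S i) (carrier F)" using card_mono[OF fin sub] by simp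
  finally show ?thesis using finite_relators by (simp add: card_PiE count_def)
qed

text \<open>Invariance of \<open>Dif g \<phi>\<close> under r moves the inserted r to the right end,
  where the vanishing of \<open>Dif r \<phi>\<close> removes it.\<close>

lemma PrimR_Inv_R:
  assumes "R \<subseteq> S" "S \<subseteq> carrier F" "\<phi> \<in> PrimR S i" shows "\<phi> \<in> Inv R"
  unfolding Inv_def
proof (intro CollectI ballI)
  fix f g r assume a: "f \<in> carrier F" "g \<in> carrier F" "r \<in> R"
  then have r: "r \<in> carrier F" "r \<in> S" using R_subset assms by auto
  have "Dif g \<phi> \<in> Inv S" using assms a Prim_Dif by (auto simp: PrimR_def)
  from InvD_right[OF this assms(2) a(1) r(2)]
  have "[\<phi> (f \<otimes> r \<otimes> g) - \<phi> (f \<otimes> r) = \<phi> (f \<otimes> g) - \<phi> f] (mod (int p))" by (simp add: Dif_def)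
  moreover have "[\<phi> (f \<otimes> r) - \<phi> f = 0] (mod (int p))"
    using assms(3) a by (auto simp: PrimR_def Dif_def)
  ultimately have "[\<phi> (f \<otimes> r \<otimes> g) - \<phi> (f \<otimes> r) + (\<phi> (f \<otimes> r) - \<phi> f) = \<phi> (f \<otimes> g) - \<phi> f + 0] (mod (int p))"
    by (rule cong_add)
  from cong_add[OF this cong_refl, of "\<phi> f"] show "[\<phi> (f \<otimes> r \<otimes> g) = \<phi> (f \<otimes> g)] (mod (int p))" by simp
qed

lemma golod_shafarevich_R:
  assumes "i > 0"
  shows "p * (\<Prod>x\<in>X. count (VR (i - D x)) (carrier F))
    \<le> (\<Prod>r\<in>{r \<in> R. e r < i}. count (VR (i - e r)) (carrier F)) * count (VR i) (carrier F)"
proof -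
  have "PrimR R i \<subseteq> VR i" using PrimR_Inv_R[of R] R_subset by (auto simp: PrimR_def Prim_def)
  moreover have "finite (res (carrier F) ` VR i)" by (rule finite_res[of _ i]) auto
  ultimately have "count (PrimR R i) (carrier F) \<le> count (VR i) (carrier F)"
    unfolding count_def by (intro card_mono image_mono)
  then show ?thesis
    using count_Prim[OF assms R_subset] count_PrimR[OF R_subset, of i]
    by (meson mult_le_mono2 order_trans)
qed

text \<open>\<open>Dif l \<phi>\<close> is invariant under \<open>lvl n\<close>, so it has the same
  value at k as at the identity.\<close>

lemma PrimR_hom:
  assumes "\<phi> \<in> PrimR (lvl n) i" "k \<in> lvl n" "l \<in> lvl n"
  shows "[\<phi> (k \<otimes> l) - \<phi> \<one> = (\<phi> k - \<phi> \<one>) + (\<phi> l - \<phi> \<one>)] (mod (int p))"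
proof -
  have c: "k \<in> carrier F" "l \<in> carrier F" using assms lvl_subset by auto
  have "Dif l \<phi> \<in> Inv (lvl n)" using assms(1) c Prim_Dif lvl_subset by (auto simp: PrimR_def)
  from InvD_right[OF this lvl_subset one_closed assms(2)] c
  have "[\<phi> (k \<otimes> l) - \<phi> k = \<phi> l - \<phi> \<one>] (mod (int p))" by (simp add: Dif_def)
  from cong_add[OF this cong_refl, of "\<phi> k - \<phi> \<one>"] show ?thesis by (simp add: algebra_simps)
qed

lemma PrimR_Inv_lvl:
  assumes "\<phi> \<in> PrimR (lvl n) i" "\<And>k. k \<in> lvl n \<Longrightarrow> [\<phi> k = \<phi> \<one>] (mod (int p))"
  shows "\<phi> \<in> Inv (lvl n)"
  unfolding Inv_def
proof (intro CollectI ballI)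
  fix f g k assume a: "f \<in> carrier F" "g \<in> carrier F" "k \<in> lvl n"
  have k: "k \<in> carrier F" using a lvl_subset by auto
  have D: "Dif h \<phi> \<in> Inv (lvl n)" if "h \<in> carrier F" for h
    using assms(1) that Prim_Dif lvl_subset by (auto simp: PrimR_def)
  \<comment> \<open>Invariance of \<open>Dif f \<phi>\<close> controls an insertion to the left of
    f, so k is first carried across f by normality.\<close>
  define k' where "k' = f \<otimes> k \<otimes> inv f"
  have k': "k' \<in> lvl n" unfolding k'_def using normal.inv_op_closed2[OF lvl_normal a(1,3)] .
  then have k'c: "k' \<in> carrier F" using lvl_subset by auto
  have fk: "f \<otimes> k = k' \<otimes> f" using a k by (simp add: k'_def m_assoc)
  have 1: "[\<phi> (f \<otimes> k \<otimes> g) - \<phi> (f \<otimes> k) = \<phi> (f \<otimes> g) - \<phi> f] (mod (int p))"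
    using InvD_right[OF D[OF a(2)] lvl_subset a(1,3)] by (simp add: Dif_def)
  have 2: "[\<phi> (f \<otimes> k) - \<phi> k' = \<phi> f - \<phi> \<one>] (mod (int p))"
    using InvD_right[OF D[OF a(1)] lvl_subset one_closed k'] a k'c by (simp add: Dif_def fk)
  have "[\<phi> (f \<otimes> k \<otimes> g) - \<phi> (f \<otimes> k) + (\<phi> (f \<otimes> k) - \<phi> k' + \<phi> k') = \<phi> (f \<otimes> g) - \<phi> f + (\<phi> f - \<phi> \<one> + \<phi> \<one>)] (mod (int p))"
    by (intro cong_add 1 2 assms(2) k')
  then show "[\<phi> (f \<otimes> k \<otimes> g) = \<phi> (f \<otimes> g)] (mod (int p))" by simp
qed

text \<open>What keeps \<phi> from being \<open>lvl n\<close>-invariant. By \<open>PrimR_hom\<close>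
  these restrictions are homomorphisms to F_p, and by \<open>PrimR_Inv_lvl\<close> a function with
  zero restriction is invariant.\<close>

definition hom_res :: "nat \<Rightarrow> nat \<Rightarrow> ('a \<Rightarrow> int) set" where
  "hom_res n i = (\<lambda>\<phi>. res (lvl n) (\<lambda>f. \<phi> f - \<phi> \<one>)) ` PrimR (lvl n) i"

lemma finite_hom_res: "finite (hom_res n i)"
proof -
  have "(\<lambda>f. \<phi> f - \<phi> \<one>) \<in> Pol (Suc i)" if "\<phi> \<in> PrimR (lvl n) i" for \<phi>
    using that Pol_mono[of \<phi> i "Suc i"] by (intro Pol_diff Pol_const) (auto simp: PrimR_def Prim_def)
  then have "hom_res n i \<subseteq> res (lvl n) ` Pol (Suc i)" by (auto simp: hom_res_def)
  then show ?thesis using finite_res_Pol[OF lvl_subset] finite_subset by blast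
qed

text \<open>For S = \<open>lvl n\<close>, unlike in \<open>golod_shafarevich_R\<close>, the
  functions in \<open>PrimR\<close> can fail to be S-invariant; the factor
  \<open>card (hom_res n i)\<close> pays for this failure.\<close>

lemma golod_shafarevich_lvl:
  assumes "i > 0"
  shows "p * (\<Prod>x\<in>X. count (VL n (i - D x)) (carrier F))
    \<le> (\<Prod>r\<in>{r \<in> R. e r < i}. count (VL n (i - e r)) (carrier F))
       * (card (hom_res n i) * count (VL n i) (carrier F))"
proof -
  have "count (PrimR (lvl n) i) (carrier F) \<le> card (hom_res n i) * count (VL n i) (carrier F)"
    unfolding hom_res_def
  proof (rule count_fibres)
    show "finite ((\<lambda>\<phi>. res (lvl n) (\<lambda>f. \<phi> f - \<phi> \<one>)) ` PrimR (lvl n) i)"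
      using finite_hom_res by (simp add: hom_res_def)
    show "finite (res (carrier F) ` VL n i)" by (rule finite_res[of _ i]) auto
    fix \<phi> \<psi> assume a: "\<phi> \<in> PrimR (lvl n) i" "\<psi> \<in> PrimR (lvl n) i"
      and eq: "res (lvl n) (\<lambda>f. \<phi> f - \<phi> \<one>) = res (lvl n) (\<lambda>f. \<psi> f - \<psi> \<one>)"
    have "Dif r (\<lambda>f. \<phi> f - \<psi> f) \<doteq> (\<lambda>_. 0)" if "r \<in> R" for r
    proof -
      have "Dif r (\<lambda>f. \<phi> f - \<psi> f) = (\<lambda>f. Dif r \<phi> f - Dif r \<psi> f)" by (auto simp: Dif_def)
      then show ?thesis using a that
        by (auto simp: PrimR_def cong_0_iff)
    qed
    then have d: "(\<lambda>f. \<phi> f - \<psi> f) \<in> PrimR (lvl n) i"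
      using a Prim_diff by (auto simp: PrimR_def)
    moreover have "(\<lambda>f. \<phi> f - \<psi> f) \<in> Inv (lvl n)"
    proof (rule PrimR_Inv_lvl[OF d])
      fix k assume "k \<in> lvl n"
      then have "[\<phi> k - \<phi> \<one> = \<psi> k - \<psi> \<one>] (mod (int p))" using eq by (simp add: res_eq_iff)
      from cong_add[OF this cong_refl, of "\<phi> \<one> - \<psi> k"]
      show "[\<phi> k - \<psi> k = \<phi> \<one> - \<psi> \<one>] (mod (int p))" by (simp add: algebra_simps)
    qed
    ultimately show "(\<lambda>f. \<phi> f - \<psi> f) \<in> VL n i" by (auto simp: PrimR_def Prim_def)
  qed
  then show ?thesis
    using count_Prim[OF assms lvl_subset, of n] count_PrimR[OF lvl_subset, of n i]
    by (meson mult_le_mono2 order_trans)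
qed

text \<open>The degree bound i ranges freely, so one set of kernels serves the inequality for every
  i. Summation over i needs such a uniform bound.\<close>

definition kers :: "nat \<Rightarrow> 'a set set" where
  "kers n = {{k \<in> lvl n. [\<phi> k = \<phi> \<one>] (mod (int p))} |\<phi> i.
     \<phi> \<in> PrimR (lvl n) i \<and> (\<exists>k\<in>lvl n. \<not> [\<phi> k = \<phi> \<one>] (mod (int p)))}"

lemma kers_props:
  assumes "H \<in> kers n"
  shows "subgroup H F" "H \<subseteq> lvl n" "card ((\<lambda>a. H #> a) ` lvl n) = p"
    "\<exists>\<phi> i. \<phi> \<in> Pol i \<and> \<phi> \<in> Inv R \<and> H = {k \<in> lvl n. [\<phi> k = \<phi> \<one>] (mod (int p))}"
proof -
  obtain \<phi> i g where \<phi>: "\<phi> \<in> PrimR (lvl n) i" "g \<in> lvl n" "\<not> [\<phi> g = \<phi> \<one>] (mod (int p))"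
    and H: "H = {k \<in> lvl n. [\<phi> k = \<phi> \<one>] (mod (int p))}" using assms by (auto simp: kers_def)
  have H': "H = {k \<in> lvl n. [\<phi> k - \<phi> \<one> = 0] (mod (int p))}" unfolding H by (simp add: cong_diff_iff_cong_0)
  note hm = PrimR_hom[OF \<phi>(1)]
  show "subgroup H F" unfolding H' using hom_mod_kernel_subgroup[OF lvl_subgroup hm] by blast
  show "H \<subseteq> lvl n" by (auto simp: H)
  show "card ((\<lambda>a. H #> a) ` lvl n) = p" unfolding H'
    using hom_mod_kernel_cosets[OF lvl_subgroup hm \<phi>(2)] \<phi>(3) by (auto simp: cong_diff_iff_cong_0)
  show "\<exists>\<phi> i. \<phi> \<in> Pol i \<and> \<phi> \<in> Inv R \<and> H = {k \<in> lvl n. [\<phi> k = \<phi> \<one>] (mod (int p))}"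
    using PrimR_Inv_R[OF R_lvl lvl_subset \<phi>(1)] \<phi>(1) H by (auto simp: PrimR_def Prim_def)
qed

text \<open>A nonzero homomorphism to F_p is determined by its kernel and its value at one chosen
  point outside it, for which there are p - 1 possibilities; the 1 counts the zero
  homomorphism.\<close>

lemma card_hom_res:
  assumes "finite (kers n)"
  shows "card (hom_res n i) \<le> 1 + (p - 1) * card (kers n)"
proof -
  let ?z = "res (lvl n) (\<lambda>_. 0)"
  define ker where "ker \<eta> = {k \<in> lvl n. \<eta> k = 0}" for \<eta> :: "'a \<Rightarrow> int"
  define pt where "pt H = (SOME k. k \<in> lvl n - H)" for H :: "'a set"
  have repr: "\<exists>\<phi>. \<phi> \<in> PrimR (lvl n) i \<and> (\<forall>k\<in>lvl n. \<eta> k = (\<phi> k - \<phi> \<one>) mod int p) \<and> \<eta> \<in> extensional (lvl n) \<and>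
      ker \<eta> = {k \<in> lvl n. [\<phi> k = \<phi> \<one>] (mod (int p))}" if eta: "\<eta> \<in> hom_res n i" for \<eta>
  proof -
    obtain \<phi> where \<phi>: "\<phi> \<in> PrimR (lvl n) i" "\<eta> = res (lvl n) (\<lambda>f. \<phi> f - \<phi> \<one>)"
      using eta by (auto simp: hom_res_def)
    have "ker \<eta> = {k \<in> lvl n. [\<phi> k = \<phi> \<one>] (mod (int p))}"
      unfolding ker_def \<phi>(2) by (auto simp: res_def cong_iff_dvd_diff mod_eq_0_iff_dvd)
    then show ?thesis using \<phi> by (auto simp: res_def)
  qed
  have nz: "\<exists>k\<in>lvl n. k \<notin> ker \<eta>" if "\<eta> \<in> hom_res n i" "\<eta> \<noteq> ?z" for \<eta>
  proof (rule ccontr)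
    assume "\<not> ?thesis"
    then have "\<eta> k = ?z k" if "k \<in> lvl n" for k using that by (auto simp: ker_def res_def)
    moreover have "\<eta> \<in> extensional (lvl n)" "?z \<in> extensional (lvl n)"
      using repr[OF \<open>\<eta> \<in> hom_res n i\<close>] by (auto simp: res_def)
    ultimately show False using that(2) extensionalityI by metis
  qed
  have ptl: "pt (ker \<eta>) \<in> lvl n" "pt (ker \<eta>) \<notin> ker \<eta>" if "\<eta> \<in> hom_res n i" "\<eta> \<noteq> ?z" for \<eta>
    using someI_ex[of "\<lambda>k. k \<in> lvl n - ker \<eta>"] nz[OF that] by (auto simp: pt_def)
  have inj: "inj_on (\<lambda>\<eta>. (ker \<eta>, \<eta> (pt (ker \<eta>)))) (hom_res n i - {?z})"
  proof (rule inj_onI)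
    fix \<eta> \<theta> assume a: "\<eta> \<in> hom_res n i - {?z}" "\<theta> \<in> hom_res n i - {?z}"
      and eq: "(ker \<eta>, \<eta> (pt (ker \<eta>))) = (ker \<theta>, \<theta> (pt (ker \<theta>)))"
    define g where "g = pt (ker \<eta>)"
    have g: "g \<in> lvl n" "g \<notin> ker \<eta>" "\<eta> g = \<theta> g" using ptl[of \<eta>] a eq by (auto simp: g_def)
    have \<eta>: "\<eta> \<in> hom_res n i" and \<theta>: "\<theta> \<in> hom_res n i" using a by auto
    from repr[OF \<eta>] obtain \<phi> where \<phi>: "\<phi> \<in> PrimR (lvl n) i"
      "\<forall>k\<in>lvl n. \<eta> k = (\<phi> k - \<phi> \<one>) mod int p" "\<eta> \<in> extensional (lvl n)"
      "ker \<eta> = {k \<in> lvl n. [\<phi> k = \<phi> \<one>] (mod (int p))}" by blast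
    from repr[OF \<theta>] obtain \<psi> where \<psi>: "\<psi> \<in> PrimR (lvl n) i"
      "\<forall>k\<in>lvl n. \<theta> k = (\<psi> k - \<psi> \<one>) mod int p" "\<theta> \<in> extensional (lvl n)"
      "ker \<theta> = {k \<in> lvl n. [\<psi> k = \<psi> \<one>] (mod (int p))}" by blast
    have hp1: "[\<phi> (g [^] b) - \<phi> \<one> = int b * (\<phi> g - \<phi> \<one>)] (mod (int p))" for b :: nat
      by (rule hom_mod_pow[where \<phi>="\<lambda>f. \<phi> f - \<phi> \<one>", OF lvl_subgroup _ g(1)])
        (rule PrimR_hom[OF \<phi>(1)])
    have hd1: "[\<phi> (k \<otimes> inv l) - \<phi> \<one> = (\<phi> k - \<phi> \<one>) - (\<phi> l - \<phi> \<one>)] (mod (int p))"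
      if "k \<in> lvl n" "l \<in> lvl n" for k l
      by (rule hom_mod_div[where \<phi>="\<lambda>f. \<phi> f - \<phi> \<one>", OF lvl_subgroup _ that])
        (rule PrimR_hom[OF \<phi>(1)])
    have hp2: "[\<psi> (g [^] b) - \<psi> \<one> = int b * (\<psi> g - \<psi> \<one>)] (mod (int p))" for b :: nat
      by (rule hom_mod_pow[where \<phi>="\<lambda>f. \<psi> f - \<psi> \<one>", OF lvl_subgroup _ g(1)])
        (rule PrimR_hom[OF \<psi>(1)])
    have hd2: "[\<psi> (k \<otimes> inv l) - \<psi> \<one> = (\<psi> k - \<psi> \<one>) - (\<psi> l - \<psi> \<one>)] (mod (int p))"
      if "k \<in> lvl n" "l \<in> lvl n" for k l
      by (rule hom_mod_div[where \<phi>="\<lambda>f. \<psi> f - \<psi> \<one>", OF lvl_subgroup _ that])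
        (rule PrimR_hom[OF \<psi>(1)])
    have gn: "\<not> [\<phi> g - \<phi> \<one> = 0] (mod (int p))" using g \<phi>(4) by (auto simp: cong_diff_iff_cong_0)
    then have "coprime (\<phi> g - \<phi> \<one>) (int p)"
      using prime_p by (metis cong_0_iff coprime_commute prime_imp_coprime prime_nat_int_transfer)
    then obtain u where u: "[(\<phi> g - \<phi> \<one>) * u = 1] (mod (int p))" using cong_solve_coprime_int by blast
    have gg: "[\<phi> g - \<phi> \<one> = \<psi> g - \<psi> \<one>] (mod (int p))"
      using g \<phi>(2) \<psi>(2) by (simp add: cong_def)
    have "\<eta> k = \<theta> k" if k: "k \<in> lvl n" for k
    proof -
      \<comment> \<open>With this exponent g^b and k have the same value under \<phi> - \<phi>
        \<one>, so their quotient lies in the common kernel and the second homomorphism agrees on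
        them as well.\<close>
      define b where "b = nat ((u * (\<phi> k - \<phi> \<one>)) mod int p)"
      have b: "[int b = u * (\<phi> k - \<phi> \<one>)] (mod (int p))" using p_gt_1 by (simp add: b_def)
      have gb: "g [^] b \<in> lvl n" by (rule pow_in_subgroup[OF lvl_subgroup g(1)])
      have "[int b * (\<phi> g - \<phi> \<one>) = u * (\<phi> k - \<phi> \<one>) * (\<phi> g - \<phi> \<one>)] (mod (int p))"
        by (intro cong_mult b cong_refl)
      also have "u * (\<phi> k - \<phi> \<one>) * (\<phi> g - \<phi> \<one>) = (\<phi> g - \<phi> \<one>) * u * (\<phi> k - \<phi> \<one>)" by simp
      also have "[(\<phi> g - \<phi> \<one>) * u * (\<phi> k - \<phi> \<one>) = 1 * (\<phi> k - \<phi> \<one>)] (mod (int p))"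
        by (intro cong_mult u cong_refl)
      finally have e1: "[int b * (\<phi> g - \<phi> \<one>) = \<phi> k - \<phi> \<one>] (mod (int p))" by simp
      have "[\<phi> (k \<otimes> inv (g [^] b)) - \<phi> \<one> = (\<phi> k - \<phi> \<one>) - (\<phi> (g [^] b) - \<phi> \<one>)] (mod (int p))"
        by (rule hd1[OF k gb])
      moreover have "[(\<phi> k - \<phi> \<one>) - (\<phi> (g [^] b) - \<phi> \<one>) = (\<phi> k - \<phi> \<one>) - (\<phi> k - \<phi> \<one>)] (mod (int p))"
        by (intro cong_diff cong_refl cong_trans[OF hp1 e1])
      ultimately have "[\<phi> (k \<otimes> inv (g [^] b)) - \<phi> \<one> = 0] (mod (int p))" by (auto intro: cong_trans)
      then have "k \<otimes> inv (g [^] b) \<in> ker \<eta>"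
        using subgroup.m_closed[OF lvl_subgroup k subgroup.m_inv_closed[OF lvl_subgroup gb]] \<phi>(4)
        by (simp add: cong_diff_iff_cong_0)
      then have "k \<otimes> inv (g [^] b) \<in> ker \<theta>" using eq by simp
      then have "[\<psi> (k \<otimes> inv (g [^] b)) - \<psi> \<one> = 0] (mod (int p))"
        using \<psi>(4) by (simp add: cong_diff_iff_cong_0)
      then have "[(\<psi> k - \<psi> \<one>) - (\<psi> (g [^] b) - \<psi> \<one>) = 0] (mod (int p))"
        using hd2[OF k gb] by (meson cong_sym cong_trans)
      then have "[\<psi> k - \<psi> \<one> = \<psi> (g [^] b) - \<psi> \<one>] (mod (int p))" by (simp only: cong_diff_iff_cong_0)
      also have "[\<psi> (g [^] b) - \<psi> \<one> = int b * (\<psi> g - \<psi> \<one>)] (mod (int p))" by (rule hp2)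
      also have "[int b * (\<psi> g - \<psi> \<one>) = int b * (\<phi> g - \<phi> \<one>)] (mod (int p))"
        by (intro cong_mult cong_refl cong_sym[OF gg])
      also note e1
      finally show ?thesis using \<phi>(2) \<psi>(2) k by (simp add: cong_def)
    qed
    then show "\<eta> = \<theta>" using extensionalityI[OF \<phi>(3) \<psi>(3)] by blast
  qed
  have sub: "(\<lambda>\<eta>. (ker \<eta>, \<eta> (pt (ker \<eta>)))) ` (hom_res n i - {?z}) \<subseteq> kers n \<times> {1..<int p}"
  proof (rule image_subsetI)
    fix \<eta> assume "\<eta> \<in> hom_res n i - {?z}"
    then have a: "\<eta> \<in> hom_res n i" "\<eta> \<noteq> ?z" by auto
    from repr[OF a(1)] obtain \<phi> where \<phi>: "\<phi> \<in> PrimR (lvl n) i"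
      "\<forall>k\<in>lvl n. \<eta> k = (\<phi> k - \<phi> \<one>) mod int p"
      "ker \<eta> = {k \<in> lvl n. [\<phi> k = \<phi> \<one>] (mod (int p))}" by blast
    have "ker \<eta> \<in> kers n" unfolding kers_def using \<phi> nz[OF a] by blast
    moreover have "\<eta> (pt (ker \<eta>)) \<in> {1..<int p}"
    proof -
      have "\<eta> (pt (ker \<eta>)) \<noteq> 0" using ptl[OF a] by (auto simp: ker_def)
      moreover have "0 \<le> \<eta> (pt (ker \<eta>))" "\<eta> (pt (ker \<eta>)) < int p"
        using \<phi>(2) ptl(1)[OF a] p_gt_1 by auto
      ultimately show ?thesis by simp
    qed
    ultimately show "(ker \<eta>, \<eta> (pt (ker \<eta>))) \<in> kers n \<times> {1..<int p}" by simp
  qed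
  have "card (hom_res n i - {?z}) \<le> card (kers n \<times> {1..<int p})"
    by (rule card_inj_on_le[OF inj sub]) (use assms in simp)
  also have "\<dots> = card (kers n) * (p - 1)" by (simp add: card_cartesian_product nat_diff_distrib')
  finally have "card (hom_res n i - {?z}) \<le> (p - 1) * card (kers n)" by (simp add: mult.commute)
  moreover have "card (hom_res n i) \<le> card (insert ?z (hom_res n i - {?z}))"
    using finite_hom_res by (intro card_mono) auto
  moreover have "card (insert ?z (hom_res n i - {?z})) = Suc (card (hom_res n i - {?z}))"
    by (rule card_insert_disjoint) (use finite_hom_res in auto)
  ultimately show ?thesis by linarith
qed

end

section \<open>Growth estimates\<close>

text \<open>\<open>l 0 = 0\<close> makes the truncated \<open>i - d\<close> a shift padded by zeros,
  which multiplies the generating series by t^d.\<close>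

lemma sums_shift_weighted:
  fixes t :: real
  assumes "summable (\<lambda>i. t ^ i * l i)" "l 0 = 0"
  shows "(\<lambda>i. t ^ i * l (i - d)) sums (t ^ d * (\<Sum>i. t ^ i * l i))"
proof -
  have "(\<lambda>i. t ^ d * (t ^ i * l i)) sums (t ^ d * (\<Sum>i. t ^ i * l i))"
    by (intro sums_mult summable_sums assms)
  moreover have "(\<Sum>i<d. t ^ i * l (i - d)) = 0" using assms(2) by (intro sum.neutral) auto
  ultimately show ?thesis
    using sums_iff_shift[of "\<lambda>i. t ^ i * l (i - d)" d "t ^ d * (\<Sum>i. t ^ i * l i)"]
    by (simp add: power_add mult_ac)
qed

text \<open>Multiplying by t^i and summing over i > 0 turns the shifts into factors t^D(x) and
  t^e(r), while the constants 1 and E give multiples of t / (1 - t). E is 0 for R-invariant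
  functions and the logarithm of a bound on the number of homomorphisms for
  \<open>lvl n\<close>.\<close>

lemma weighted_golod_shafarevich:
  fixes t E H :: real and l :: "nat \<Rightarrow> real" and D :: "'x \<Rightarrow> nat" and e :: "'r \<Rightarrow> nat"
  assumes t: "0 < t" "t < 1" and X: "finite X" and R: "\<And>i. finite {r \<in> R. e r < i}"
    and l: "l 0 = 0" "\<And>i. 0 \<le> l i" "summable (\<lambda>i. t ^ i * l i)"
    and H: "\<And>A. finite A \<Longrightarrow> A \<subseteq> R \<Longrightarrow> (\<Sum>r\<in>A. t ^ e r) \<le> H"
    and ineq: "\<And>i. i > 0 \<Longrightarrow> 1 + (\<Sum>x\<in>X. l (i - D x)) \<le> E + (\<Sum>r\<in>{r \<in> R. e r < i}. l (i - e r)) + l i"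
  shows "(1 - E) * (t / (1 - t)) + ((\<Sum>x\<in>X. t ^ D x) - 1 - H) * (\<Sum>i. t ^ i * l i) \<le> 0"
proof -
  define S where "S = (\<Sum>i. t ^ i * l i)"
  have S0: "0 \<le> S" unfolding S_def by (intro suminf_nonneg l) (use t l in auto)
  have shift: "(\<lambda>i. t ^ i * l (i - d)) sums (t ^ d * S)" for d
    unfolding S_def by (rule sums_shift_weighted[OF l(3,1)])
  have geo: "(\<lambda>i. t ^ Suc i) sums (t / (1 - t))"
    using sums_mult[OF geometric_sums[of t], of t] t by simp
  \<comment> \<open>R may be infinite, so partial sums are estimated. Up to M only the relators in
    \<open>?A\<close> occur, and enlarging every inner sum to \<open>?A\<close> adds zeros because
    \<open>l 0 = 0\<close>.\<close>
  have part: "(\<Sum>i<M. (1 - E) * t ^ Suc i + (\<Sum>x\<in>X. t ^ Suc i * l (Suc i - D x)) - t ^ Suc i * l (Suc i)) \<le> H * S" for M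
  proof -
    let ?A = "{r \<in> R. e r < Suc M}"
    have "(\<Sum>i<M. (1 - E) * t ^ Suc i + (\<Sum>x\<in>X. t ^ Suc i * l (Suc i - D x)) - t ^ Suc i * l (Suc i))
        \<le> (\<Sum>i<M. \<Sum>r\<in>?A. t ^ Suc i * l (Suc i - e r))"
    proof (rule sum_mono)
      fix i assume "i \<in> {..<M}"
      then have "(\<Sum>r\<in>{r \<in> R. e r < Suc i}. l (Suc i - e r)) = (\<Sum>r\<in>?A. l (Suc i - e r))"
      proof (intro sum.mono_neutral_left R ballI)
        fix r assume "r \<in> ?A - {r \<in> R. e r < Suc i}"
        then have "Suc i - e r = 0" by auto
        then show "l (Suc i - e r) = 0" using l(1) by simp
      qed auto
      then have "(1 - E) + (\<Sum>x\<in>X. l (Suc i - D x)) - l (Suc i) \<le> (\<Sum>r\<in>?A. l (Suc i - e r))"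
        using ineq[of "Suc i"] by linarith
      then have "t ^ Suc i * ((1 - E) + (\<Sum>x\<in>X. l (Suc i - D x)) - l (Suc i)) \<le> t ^ Suc i * (\<Sum>r\<in>?A. l (Suc i - e r))"
        using t by (intro mult_left_mono) auto
      then show "(1 - E) * t ^ Suc i + (\<Sum>x\<in>X. t ^ Suc i * l (Suc i - D x)) - t ^ Suc i * l (Suc i)
          \<le> (\<Sum>r\<in>?A. t ^ Suc i * l (Suc i - e r))"
        unfolding sum_distrib_left[symmetric] by (simp add: algebra_simps)
    qed
    also have "\<dots> = (\<Sum>r\<in>?A. \<Sum>i<M. t ^ Suc i * l (Suc i - e r))" by (rule sum.swap)
    also have "\<dots> \<le> (\<Sum>r\<in>?A. t ^ e r * S)"
    proof (rule sum_mono)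
      fix r
      have "(\<Sum>i<M. t ^ Suc i * l (Suc i - e r)) \<le> (\<Sum>i<Suc M. t ^ i * l (i - e r))"
        unfolding sum.lessThan_Suc_shift using l t by simp
      also have "\<dots> \<le> (\<Sum>i. t ^ i * l (i - e r))"
        using sums_summable[OF shift] t l(2) by (intro sum_le_suminf) auto
      finally show "(\<Sum>i<M. t ^ Suc i * l (Suc i - e r)) \<le> t ^ e r * S"
        using sums_unique[OF shift[of "e r"]] by simp
    qed
    also have "\<dots> \<le> H * S"
      unfolding sum_distrib_right[symmetric] using H[OF R[of "Suc M"]] S0 by (intro mult_right_mono) auto
    finally show ?thesis .
  qed
  have shift': "(\<lambda>i. t ^ Suc i * l (Suc i - d)) sums (t ^ d * S)" for d
    using shift[of d] l(1) by (subst sums_Suc_iff) simp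
  have "(\<lambda>i. (1 - E) * t ^ Suc i + (\<Sum>x\<in>X. t ^ Suc i * l (Suc i - D x)) - t ^ Suc i * l (Suc i))
      sums ((1 - E) * (t / (1 - t)) + (\<Sum>x\<in>X. t ^ D x * S) - S)"
    using shift'[of 0] by (intro sums_diff sums_add sums_mult geo sums_sum shift') auto
  then have "(1 - E) * (t / (1 - t)) + (\<Sum>x\<in>X. t ^ D x * S) - S \<le> H * S"
    unfolding sums_def using part by (intro LIMSEQ_le_const2) auto
  then show ?thesis unfolding S_def[symmetric] sum_distrib_right[symmetric] by (simp add: algebra_simps)
qed

lemma divergence_imp_exponential:
  fixes c :: "nat \<Rightarrow> nat" and s t :: real
  assumes "0 < s" "s < t" "\<not> summable (\<lambda>i. c i * s ^ i)"
  obtains \<kappa> :: real where "\<kappa> > 1" "infinite {n. \<kappa> ^ n \<le> (\<Sum>i\<in>{1..<n}. c i * t ^ i)}"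
proof -
  \<comment> \<open>The square root splits t / s evenly: if the partial sums stayed below \<kappa>^n
    from some point on, c i * s^i = c i * t^i / \<kappa>^(2 i) would be at most \<kappa> times
    \<kappa>^(-i), the terms of a convergent series.\<close>
  define \<kappa> where "\<kappa> = sqrt (t / s)"
  have l1: "\<kappa> > 1" using assms by (simp add: \<kappa>_def)
  have "infinite {n. \<kappa> ^ n \<le> (\<Sum>i\<in>{1..<n}. c i * t ^ i)}"
  proof
    assume "finite {n. \<kappa> ^ n \<le> (\<Sum>i\<in>{1..<n}. c i * t ^ i)}"
    then obtain N where N: "\<And>n. n > N \<Longrightarrow> (\<Sum>i\<in>{1..<n}. c i * t ^ i) < \<kappa> ^ n"
      by (metis (no_types, lifting) finite_nat_set_iff_bounded_le mem_Collect_eq not_le)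
    have bd: "c i * s ^ i \<le> \<kappa> * (1 / \<kappa>) ^ i" if "i > N" for i
    proof -
      have "c i * t ^ i \<le> (\<Sum>i\<in>{1..<Suc i}. c i * t ^ i)"
        using that assms by (intro member_le_sum) auto
      also have "\<dots> < \<kappa> ^ Suc i" using N[of "Suc i"] that by simp
      finally have 1: "c i * t ^ i \<le> \<kappa> ^ Suc i" by simp
      have st: "s = t / \<kappa>\<^sup>2" using assms by (simp add: \<kappa>_def)
      have "c i * s ^ i = (c i * t ^ i) / (\<kappa>\<^sup>2) ^ i" by (simp add: st power_divide)
      also have "\<dots> \<le> \<kappa> ^ Suc i / (\<kappa>\<^sup>2) ^ i" using 1 l1 by (intro divide_right_mono) auto
      also have "\<dots> = \<kappa> * (1 / \<kappa>) ^ i" using l1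
        by (simp add: power_mult[symmetric] mult_2 power_add power_divide)
      finally show ?thesis .
    qed
    have "summable (\<lambda>i. \<kappa> * (1 / \<kappa>) ^ i)" using l1 by (intro summable_mult summable_geometric) auto
    then have "summable (\<lambda>i. c i * s ^ i)"
      by (rule summable_comparison_test'[of _ "Suc N"]) (use bd assms in auto)
    then show False using assms by simp
  qed
  then show ?thesis using that l1 by blast
qed

text \<open>exp x <= 1 + 2 x for 0 <= x <= 1/2, applied to x = t^i / 2.\<close>

lemma prod_one_plus_ge_exp:
  fixes c :: "nat \<Rightarrow> nat" and t :: real
  assumes "0 \<le> t" "t \<le> 1"
  shows "exp ((\<Sum>i\<in>A. c i * t ^ i) / 2) \<le> (\<Prod>i\<in>A. (1 + t ^ i) ^ c i)"
proof (cases "finite A")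
  case True
  have 1: "exp (t ^ i / 2) \<le> 1 + t ^ i" for i
    using exp_bound_lemma[of "t ^ i / 2"] assms by (simp add: power_le_one)
  have "exp ((\<Sum>i\<in>A. c i * t ^ i) / 2) = (\<Prod>i\<in>A. exp (t ^ i / 2) ^ c i)"
    using True by (simp add: exp_sum sum_divide_distrib exp_of_nat_mult[symmetric])
  also have "\<dots> \<le> (\<Prod>i\<in>A. (1 + t ^ i) ^ c i)" using 1 by (intro prod_mono conjI power_mono) auto
  finally show ?thesis .
qed auto

text \<open>With x = t^i, 1 / (1 - x) = 1 + x / (1 - x) <= exp (x / (1 - x)); as i >= 1, x <= t
  gives the uniform denominator.\<close>

lemma prod_inverse_one_minus_le_exp:
  fixes c :: "nat \<Rightarrow> nat" and t :: real
  assumes "0 < t" "t < 1"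
  shows "(\<Prod>i\<in>{1..<n}. (1 / (1 - t ^ i)) ^ c i) \<le> exp ((\<Sum>i\<in>{1..<n}. c i * t ^ i) / (1 - t))"
proof -
  have 1: "1 / (1 - t ^ i) \<le> exp (t ^ i / (1 - t))" if "i \<ge> 1" for i
  proof -
    have le: "t ^ i \<le> t" using that assms power_decreasing[of 1 i t] by simp
    then have lt: "t ^ i < 1" using assms by linarith
    have "1 / (1 - t ^ i) = 1 + t ^ i / (1 - t ^ i)" using lt by (simp add: field_simps)
    also have "\<dots> \<le> exp (t ^ i / (1 - t ^ i))" by (rule exp_ge_add_one_self)
    also have "\<dots> \<le> exp (t ^ i / (1 - t))"
      using le lt assms by (simp add: frac_le)
    finally show ?thesis .
  qed
  have "(\<Prod>i\<in>{1..<n}. (1 / (1 - t ^ i)) ^ c i) \<le> (\<Prod>i\<in>{1..<n}. exp (t ^ i / (1 - t)) ^ c i)"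
    using 1 assms by (intro prod_mono conjI power_mono) (auto simp: power_le_one)
  also have "\<dots> = exp ((\<Sum>i\<in>{1..<n}. c i * t ^ i) / (1 - t))"
    by (simp add: exp_sum sum_divide_distrib exp_of_nat_mult[symmetric])
  finally show ?thesis .
qed

text \<open>Positive weights bound lengths by n, and the resulting geometric sum is dominated
  termwise by a binomial expansion.\<close>

lemma (in magnus_coefficients) card_words_le: "card (words n) \<le> (card X + 1) ^ n"
proof -
  have "card (words n) \<le> card {w. set w \<subseteq> X \<and> length w \<le> n}"
    by (intro card_mono words_subset finite_lists_length_le finite_X)
  also have "\<dots> = (\<Sum>i\<le>n. card X ^ i)" by (rule card_lists_length_le[OF finite_X])
  also have "\<dots> \<le> (\<Sum>i\<le>n. (n choose i) * card X ^ i)"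
    by (intro sum_mono) (auto simp: Suc_le_eq zero_less_binomial)
  also have "\<dots> = (card X + 1) ^ n" using binomial[of "card X" 1 n] by simp
  finally show ?thesis .
qed

context golod_shafarevich_coefficients
begin

section \<open>Weighted dimension series\<close>

abbreviation lg :: "nat \<Rightarrow> real" where "lg k \<equiv> log p k"

lemma count_VR_pos: "K \<subseteq> carrier F \<Longrightarrow> count (VR m) K > 0"
  and count_VL_pos: "K \<subseteq> carrier F \<Longrightarrow> count (VL n m) K > 0"
  by (rule count_pos[of _ m]; use Pol_zero Inv_const in blast)+

lemma count_mono: assumes "V \<subseteq> Pol m" "K' \<subseteq> K" "K \<subseteq> carrier F" shows "count V K' \<le> count V K"
  unfolding count_def
  by (rule card_image_le_of_kernel(2)[OF finite_res[OF assms(1,3)]]) (use assms in \<open>auto simp: res_eq_iff\<close>)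

lemma lg_mono: "0 < a \<Longrightarrow> a \<le> b \<Longrightarrow> lg a \<le> lg b"
  using p_gt_1 by simp

lemma lg_mult: "0 < a \<Longrightarrow> 0 < b \<Longrightarrow> lg (a * b) = lg a + lg b"
  by (simp add: log_mult)

lemma lg_prod: "(\<And>i. i \<in> I \<Longrightarrow> f i > 0) \<Longrightarrow> lg (\<Prod>i\<in>I. f i) = (\<Sum>i\<in>I. lg (f i))"
proof (induction I rule: infinite_finite_induct)
  case (insert i I)
  then have "(\<Prod>i\<in>I. f i) > 0" by (intro prod_pos) auto
  then show ?case using insert by (simp add: log_mult)
qed auto

lemma lg_nonneg: "0 < a \<Longrightarrow> 0 \<le> lg a"
  using p_gt_1 by (simp add: zero_le_log_cancel_iff Suc_le_eq)

lemma lg_count_0: "V \<subseteq> Pol 0 \<Longrightarrow> K \<subseteq> carrier F \<Longrightarrow> lg (count V K) = 0"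
  using count_Pol_0[of V K] by (auto simp: le_Suc_eq log_def)

lemma golod_shafarevich_R_log:
  assumes "i > 0"
  shows "1 + (\<Sum>x\<in>X. lg (count (VR (i - D x)) (carrier F)))
    \<le> 0 + (\<Sum>r\<in>{r \<in> R. e r < i}. lg (count (VR (i - e r)) (carrier F))) + lg (count (VR i) (carrier F))"
proof -
  have "lg (p * (\<Prod>x\<in>X. count (VR (i - D x)) (carrier F)))
    \<le> lg ((\<Prod>r\<in>{r \<in> R. e r < i}. count (VR (i - e r)) (carrier F)) * count (VR i) (carrier F))"
    using golod_shafarevich_R[OF assms] p_gt_1 count_VR_pos[OF order_refl]
    by (intro lg_mono) (auto intro!: prod_pos)
  then show ?thesis
    using p_gt_1 count_VR_pos[OF order_refl] by (simp add: lg_mult lg_prod prod_pos del: of_nat_mult of_nat_prod)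
qed

lemma golod_shafarevich_lvl_log:
  assumes "i > 0" "finite (kers n)"
  shows "1 + (\<Sum>x\<in>X. lg (count (VL n (i - D x)) (carrier F)))
    \<le> lg (1 + (p - 1) * card (kers n))
      + (\<Sum>r\<in>{r \<in> R. e r < i}. lg (count (VL n (i - e r)) (carrier F))) + lg (count (VL n i) (carrier F))"
proof -
  define Z where "Z = 1 + (p - 1) * card (kers n)"
  have Z: "Z > 0" by (simp add: Z_def)
  have "p * (\<Prod>x\<in>X. count (VL n (i - D x)) (carrier F))
    \<le> (\<Prod>r\<in>{r \<in> R. e r < i}. count (VL n (i - e r)) (carrier F))
       * (Z * count (VL n i) (carrier F))"
    using golod_shafarevich_lvl[OF assms(1), of n] card_hom_res[OF assms(2), of i, folded Z_def]
    by (meson mult_le_mono1 mult_le_mono2 order_trans)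
  then have "lg (p * (\<Prod>x\<in>X. count (VL n (i - D x)) (carrier F)))
    \<le> lg ((\<Prod>r\<in>{r \<in> R. e r < i}. count (VL n (i - e r)) (carrier F))
       * (Z * count (VL n i) (carrier F)))"
    using Z p_gt_1 count_VL_pos[OF order_refl] by (intro lg_mono) (auto intro!: prod_pos)
  then show ?thesis unfolding Z_def[symmetric]
    using Z p_gt_1 count_VL_pos[OF order_refl]
    by (simp add: lg_mult lg_prod prod_pos del: of_nat_mult of_nat_prod of_nat_add of_nat_Suc)
qed

text \<open>By summation by parts this is t / (1 - t) times the Hilbert series, in which the part of
  degree j counts with t^j. Hence the factor t / (1 - t) in the estimates.\<close>

definition SL :: "nat \<Rightarrow> real \<Rightarrow> 'a set \<Rightarrow> real" where
  "SL n t K = (\<Sum>m. t ^ m * lg (count (VL n m) K))"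

lemma summable_SL:
  assumes "0 < t" "t < 1" "K \<subseteq> carrier F"
  shows "summable (\<lambda>m. t ^ m * lg (count (VL n m) K))"
proof -
  define B where "B = card ((\<lambda>a. lvl n #> a) ` carrier F)"
  have b: "0 \<le> lg (count (VL n m) K)" "lg (count (VL n m) K) \<le> B" for m
  proof -
    have "count (VL n m) K \<le> count (VL n m) (carrier F)"
      by (rule count_mono[of _ m]) (use assms in auto)
    also have "\<dots> \<le> p ^ B" unfolding B_def by (rule count_VL_bound)
    finally have "lg (count (VL n m) K) \<le> lg (p ^ B)"
      using count_VL_pos[OF assms(3)] by (intro lg_mono) auto
    then show "lg (count (VL n m) K) \<le> B" using p_gt_1 by (simp add: log_nat_power)
    show "0 \<le> lg (count (VL n m) K)" using count_VL_pos[OF assms(3)] by (intro lg_nonneg)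
  qed
  have "summable (\<lambda>m. t ^ m * B)" using assms by (intro summable_mult2 summable_geometric) auto
  then show ?thesis
    by (rule summable_comparison_test'[of _ 0]) (use b assms in \<open>auto simp: abs_mult intro!: mult_left_mono\<close>)
qed

lemma SL_step:
  assumes t: "0 < t" "t < 1" and "step i K' K" "i < n"
  shows "(1 + t ^ i) * SL n t K' \<le> SL n t K"
proof -
  have K: "K \<subseteq> carrier F" "K' \<subseteq> K" using assms(3) subgroup.subset by (auto simp: step_def)
  then have K': "K' \<subseteq> carrier F" by auto
  let ?l = "\<lambda>m. lg (count (VL n m) K')"
  have sh: "(\<lambda>m. t ^ m * ?l (m - i)) sums (t ^ i * SL n t K')"
    unfolding SL_def by (rule sums_shift_weighted[OF summable_SL[OF t K']]) (use lg_count_0[OF _ K'] in auto)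
  have s1: "(\<lambda>m. t ^ m * ?l m + t ^ m * ?l (m - i)) sums (SL n t K' + t ^ i * SL n t K')"
    unfolding SL_def by (intro sums_add summable_sums summable_SL t K' sh[unfolded SL_def])
  have s2: "(\<lambda>m. t ^ m * lg (count (VL n m) K)) sums SL n t K"
    unfolding SL_def by (intro summable_sums summable_SL t K)
  have "t ^ m * ?l m + t ^ m * ?l (m - i) \<le> t ^ m * lg (count (VL n m) K)" for m
  proof -
    have "lg (count (VL n m) K' * count (VL n (m - i)) K') \<le> lg (count (VL n m) K)"
      using count_lower_step[OF assms(3,4)] count_VL_pos[OF K'] by (intro lg_mono) auto
    then have "?l m + ?l (m - i) \<le> lg (count (VL n m) K)"
      using count_VL_pos[OF K'] by (simp add: lg_mult del: of_nat_mult)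
    then have "t ^ m * (?l m + ?l (m - i)) \<le> t ^ m * lg (count (VL n m) K)"
      using t by (intro mult_left_mono) auto
    then show ?thesis by (simp add: algebra_simps)
  qed
  from sums_le[OF this s1 s2] have "SL n t K' + t ^ i * SL n t K' \<le> SL n t K" .
  then show ?thesis by (simp add: algebra_simps)
qed

lemma SL_steps:
  assumes t: "0 < t" "t < 1" and "steps i K c" "i < n"
  shows "(1 + t ^ i) ^ c * SL n t (lvl (Suc i)) \<le> SL n t K"
  using assms(3)
proof induction
  case (step K' c K)
  have "(1 + t ^ i) ^ Suc c * SL n t (lvl (Suc i)) = (1 + t ^ i) * ((1 + t ^ i) ^ c * SL n t (lvl (Suc i)))"
    by simp
  also have "\<dots> \<le> (1 + t ^ i) * SL n t K'" using step t by (intro mult_left_mono) auto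
  also have "\<dots> \<le> SL n t K" by (rule SL_step[OF t step(2) assms(4)])
  finally show ?case .
qed simp

text \<open>The climb starts at \<open>lvl n\<close> with the constants, worth t / (1 - t), and each
  of the \<open>cdim i\<close> steps of level i multiplies by at least 1 + t^i. These are the first
  two terms of the factor 1 + t^i + ... + t^((p - 1) i) in Jennings' formula.\<close>

lemma SL_lower:
  assumes t: "0 < t" "t < 1" and "k \<le> n"
  shows "(\<Prod>i\<in>{k..<n}. (1 + t ^ i) ^ cdim i) * (t / (1 - t)) \<le> SL n t (lvl k)"
  using assms(3)
proof (induction "n - k" arbitrary: k)
  case 0
  have geo: "(\<lambda>i. t ^ Suc i) sums (t / (1 - t))"
    using sums_mult[OF geometric_sums[of t], of t] t by simp
  have "(\<lambda>m. t ^ m * lg (count (VL n m) (lvl n))) sums SL n t (lvl n)"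
    unfolding SL_def by (intro summable_sums summable_SL t lvl_subset)
  then have s1: "(\<lambda>m. t ^ Suc m * lg (count (VL n (Suc m)) (lvl n))) sums SL n t (lvl n)"
    by (subst sums_Suc_iff) (use lg_count_0[OF _ lvl_subset, of "VL n 0" n] in simp)
  have "t ^ Suc m \<le> t ^ Suc m * lg (count (VL n (Suc m)) (lvl n))" for m
  proof -
    have "p \<le> count (VL n (Suc m)) (lvl n)"
      using count_ge_p[of "Suc m" "lvl n" n] lvl_subset subgroup.one_closed[OF lvl_subgroup] by blast
    then have "1 \<le> lg (count (VL n (Suc m)) (lvl n))"
      using p_gt_1 lg_mono[of p "count (VL n (Suc m)) (lvl n)"] by simp
    then have "t ^ Suc m * 1 \<le> t ^ Suc m * lg (count (VL n (Suc m)) (lvl n))"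
      using t by (intro mult_left_mono) auto
    then show ?thesis by simp
  qed
  from sums_le[OF this geo s1] have "t / (1 - t) \<le> SL n t (lvl n)" .
  then show ?case using 0 by simp
next
  case (Suc d)
  have IH: "(\<Prod>i\<in>{Suc k..<n}. (1 + t ^ i) ^ cdim i) * (t / (1 - t)) \<le> SL n t (lvl (Suc k))"
    by (rule Suc.hyps(1)) (use Suc in auto)
  have "(\<Prod>i\<in>{k..<n}. (1 + t ^ i) ^ cdim i) * (t / (1 - t))
      = (1 + t ^ k) ^ cdim k * ((\<Prod>i\<in>{Suc k..<n}. (1 + t ^ i) ^ cdim i) * (t / (1 - t)))"
    using Suc by (simp add: prod.atLeast_Suc_lessThan)
  also have "\<dots> \<le> (1 + t ^ k) ^ cdim k * SL n t (lvl (Suc k))"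
    using IH t by (intro mult_left_mono) auto
  also have "\<dots> \<le> SL n t (lvl k)"
    by (rule SL_steps[OF t steps_cdim]) (use Suc in auto)
  finally show ?case .
qed

text \<open>The full series can diverge, and on \<open>lvl n\<close> only the functions in
  \<open>VR m\<close> with m <= n are known to be constant; hence the cut-off at n.\<close>

definition SR :: "nat \<Rightarrow> real \<Rightarrow> 'a set \<Rightarrow> real" where
  "SR n t K = (\<Sum>m\<le>n. t ^ m * lg (count (VR m) K))"

lemma sum_shift_le:
  fixes l :: "nat \<Rightarrow> real"
  assumes "0 \<le> t" "\<And>i. 0 \<le> l i" "l 0 = 0"
  shows "(\<Sum>m\<le>n. t ^ m * l (m - d)) \<le> t ^ d * (\<Sum>m\<le>n. t ^ m * l m)"
proof -
  have "(\<Sum>m\<le>n. t ^ m * l (m - d)) = (\<Sum>m\<in>{d..n}. t ^ m * l (m - d))"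
    using assms(3) by (intro sum.mono_neutral_right) auto
  also have "\<dots> = (\<Sum>m\<in>{..n - d} \<inter> {m. m + d \<le> n}. t ^ (m + d) * l m)"
    by (rule sum.reindex_bij_witness[where i="\<lambda>m. m + d" and j="\<lambda>m. m - d"]) auto
  also have "\<dots> = t ^ d * (\<Sum>m\<in>{..n - d} \<inter> {m. m + d \<le> n}. t ^ m * l m)"
    by (simp add: sum_distrib_left power_add mult_ac)
  also have "\<dots> \<le> t ^ d * (\<Sum>m\<le>n. t ^ m * l m)"
    using assms by (intro mult_left_mono sum_mono2) auto
  finally show ?thesis .
qed

text \<open>The a-th difference shifts the series by a i, so the p terms of
  \<open>count_upper_step\<close> sum to at most the geometric series in t^i.\<close>

lemma SR_step:
  assumes t: "0 < t" "t < 1" and "step i K' K" "i > 0"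
  shows "SR n t K \<le> 1 / (1 - t ^ i) * SR n t K'"
proof -
  have K: "K \<subseteq> carrier F" "K' \<subseteq> K" using assms(3) subgroup.subset by (auto simp: step_def)
  then have K': "K' \<subseteq> carrier F" by auto
  let ?l = "\<lambda>m. lg (count (VR m) K')"
  have l0: "?l 0 = 0" using lg_count_0[OF _ K', of "VR 0"] by simp
  have lp: "0 \<le> ?l m" for m using count_VR_pos[OF K'] by (intro lg_nonneg)
  have SR0: "0 \<le> SR n t K'" unfolding SR_def using lp t by (intro sum_nonneg) auto
  have u: "lg (count (VR m) K) \<le> (\<Sum>a<p. ?l (m - a * i))" for m
  proof -
    have "lg (count (VR m) K) \<le> lg (\<Prod>a<p. count (VR (m - a * i)) K')"
      using count_upper_step[OF assms(3)] count_VR_pos[OF K(1)] by (intro lg_mono) auto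
    then show ?thesis using count_VR_pos[OF K'] by (simp add: lg_prod del: of_nat_prod)
  qed
  have "SR n t K \<le> (\<Sum>m\<le>n. t ^ m * (\<Sum>a<p. ?l (m - a * i)))"
    unfolding SR_def using u t by (intro sum_mono mult_left_mono) auto
  also have "\<dots> = (\<Sum>a<p. \<Sum>m\<le>n. t ^ m * ?l (m - a * i))"
    by (simp add: sum_distrib_left) (rule sum.swap)
  also have "\<dots> \<le> (\<Sum>a<p. t ^ (a * i) * SR n t K')"
    unfolding SR_def using t lp l0 by (intro sum_mono sum_shift_le) auto
  also have "\<dots> = (\<Sum>a<p. (t ^ i) ^ a) * SR n t K'"
    by (simp add: sum_distrib_right power_mult[symmetric] mult.commute)
  also have "\<dots> \<le> 1 / (1 - t ^ i) * SR n t K'"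
  proof (rule mult_right_mono[OF _ SR0])
    have ti: "0 < t ^ i" "t ^ i < 1" using t assms(4) by (auto simp: power_less_one_iff)
    have "(\<Sum>a<p. (t ^ i) ^ a) \<le> (\<Sum>a. (t ^ i) ^ a)"
      using ti by (intro sum_le_suminf summable_geometric) auto
    also have "\<dots> = 1 / (1 - t ^ i)" using ti by (intro suminf_geometric) auto
    finally show "(\<Sum>a<p. (t ^ i) ^ a) \<le> 1 / (1 - t ^ i)" .
  qed
  finally show ?thesis .
qed

lemma SR_steps:
  assumes t: "0 < t" "t < 1" and "steps i K c" "i > 0"
  shows "SR n t K \<le> (1 / (1 - t ^ i)) ^ c * SR n t (lvl (Suc i))"
  using assms(3)
proof induction
  case (step K' c K)
  have ti: "t ^ i < 1" using t assms(4) by (auto simp: power_less_one_iff)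
  have "SR n t K \<le> 1 / (1 - t ^ i) * SR n t K'" by (rule SR_step[OF t step(2) assms(4)])
  also have "\<dots> \<le> 1 / (1 - t ^ i) * ((1 / (1 - t ^ i)) ^ c * SR n t (lvl (Suc i)))"
    using step ti by (intro mult_left_mono) auto
  finally show ?case by (simp add: mult.assoc)
qed simp

lemma SR_upper:
  assumes t: "0 < t" "t < 1" and "k \<le> n" "k > 0"
  shows "SR n t (lvl k) \<le> (\<Prod>i\<in>{k..<n}. (1 / (1 - t ^ i)) ^ cdim i) * (t / (1 - t))"
  using assms(3,4)
proof (induction "n - k" arbitrary: k)
  case 0
  have geo: "(\<lambda>i. t ^ Suc i) sums (t / (1 - t))"
    using sums_mult[OF geometric_sums[of t], of t] t by simp
  have "SR n t (lvl n) = (\<Sum>m<n. t ^ Suc m * lg (count (VR (Suc m)) (lvl n)))"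
    unfolding SR_def lessThan_Suc_atMost[symmetric] sum.lessThan_Suc_shift
    using lg_count_0[OF _ lvl_subset, of "VR 0" n] by simp
  also have "\<dots> \<le> (\<Sum>m<n. t ^ Suc m)"
  proof (rule sum_mono)
    fix m assume "m \<in> {..<n}"
    then have "lg (count (VR (Suc m)) (lvl n)) \<le> lg p"
      using count_lvl_le_p[of "Suc m" n] count_VR_pos[OF lvl_subset] by (intro lg_mono) auto
    then have "t ^ Suc m * lg (count (VR (Suc m)) (lvl n)) \<le> t ^ Suc m * 1"
      using t p_gt_1 by (intro mult_left_mono) auto
    then show "t ^ Suc m * lg (count (VR (Suc m)) (lvl n)) \<le> t ^ Suc m" by simp
  qed
  also have "\<dots> \<le> (\<Sum>m. t ^ Suc m)" using sums_summable[OF geo] t by (intro sum_le_suminf) auto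
  also have "\<dots> = t / (1 - t)" using sums_unique[OF geo] by simp
  finally show ?case using 0 by simp
next
  case (Suc d)
  have IH: "SR n t (lvl (Suc k)) \<le> (\<Prod>i\<in>{Suc k..<n}. (1 / (1 - t ^ i)) ^ cdim i) * (t / (1 - t))"
    by (rule Suc.hyps(1)) (use Suc in auto)
  have tk: "t ^ k < 1" using t Suc by (auto simp: power_less_one_iff)
  have "SR n t (lvl k) \<le> (1 / (1 - t ^ k)) ^ cdim k * SR n t (lvl (Suc k))"
    by (rule SR_steps[OF t steps_cdim]) (use Suc in auto)
  also have "\<dots> \<le> (1 / (1 - t ^ k)) ^ cdim k * ((\<Prod>i\<in>{Suc k..<n}. (1 / (1 - t ^ i)) ^ cdim i) * (t / (1 - t)))"
    using IH tk by (intro mult_left_mono) auto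
  also have "\<dots> = (\<Prod>i\<in>{k..<n}. (1 / (1 - t ^ i)) ^ cdim i) * (t / (1 - t))"
    using Suc by (simp add: prod.atLeast_Suc_lessThan)
  finally show ?case .
qed

text \<open>Were the sum finite, \<open>SR_upper\<close> would make the weighted dimensions of the
  R-invariant functions summable, and the Golod-Shafarevich inequality would bound a positive number
  by 0.\<close>

lemma cdim_divergent:
  fixes t H :: real
  assumes t: "0 < t" "t < 1" and H: "\<And>A. finite A \<Longrightarrow> A \<subseteq> R \<Longrightarrow> (\<Sum>r\<in>A. t ^ e r) \<le> H"
    and GS: "1 + H < (\<Sum>x\<in>X. t ^ D x)"
  shows "\<not> summable (\<lambda>i. cdim i * t ^ i)"
proof
  assume s: "summable (\<lambda>i. cdim i * t ^ i)"
  let ?l = "\<lambda>m. lg (count (VR m) (carrier F))"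
  have lp: "0 \<le> ?l m" for m using count_VR_pos[OF order_refl] by (intro lg_nonneg)
  define B where "B = exp ((\<Sum>i. cdim i * t ^ i) / (1 - t)) * (t / (1 - t))"
  have "(\<Sum>m<n. t ^ m * ?l m) \<le> B" for n
  proof -
    have "(\<Sum>m<n. t ^ m * ?l m) \<le> SR (Suc n) t (carrier F)"
      unfolding SR_def using lp t by (intro sum_mono2) auto
    also have "\<dots> \<le> (\<Prod>i\<in>{1..<Suc n}. (1 / (1 - t ^ i)) ^ cdim i) * (t / (1 - t))"
      using SR_upper[OF t, of 1 "Suc n"] by (simp add: lvl_1)
    also have "\<dots> \<le> exp ((\<Sum>i\<in>{1..<Suc n}. cdim i * t ^ i) / (1 - t)) * (t / (1 - t))"
      using t by (intro mult_right_mono prod_inverse_one_minus_le_exp) auto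
    also have "\<dots> \<le> B" unfolding B_def
    proof -
      have "(\<Sum>i\<in>{1..<Suc n}. cdim i * t ^ i) \<le> (\<Sum>i. cdim i * t ^ i)"
        using s t by (intro sum_le_suminf) auto
      then have "(\<Sum>i\<in>{1..<Suc n}. cdim i * t ^ i) / (1 - t) \<le> (\<Sum>i. cdim i * t ^ i) / (1 - t)"
        using t by (intro divide_right_mono) auto
      then show "exp ((\<Sum>i\<in>{1..<Suc n}. cdim i * t ^ i) / (1 - t)) * (t / (1 - t))
          \<le> exp ((\<Sum>i. cdim i * t ^ i) / (1 - t)) * (t / (1 - t))"
        using t by (intro mult_right_mono) auto
    qed
    finally show ?thesis .
  qed
  then have "summable (\<lambda>m. t ^ m * ?l m)"
    using lp t by (intro summableI_nonneg_bounded[where x=B]) auto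
  from weighted_golod_shafarevich[OF t finite_X finite_relators _ lp this H golod_shafarevich_R_log]
  have "(1 - 0) * (t / (1 - t)) + ((\<Sum>x\<in>X. t ^ D x) - 1 - H) * (\<Sum>m. t ^ m * ?l m) \<le> 0"
    using lg_count_0[of "VR 0" "carrier F"] by auto
  moreover have "0 \<le> ((\<Sum>x\<in>X. t ^ D x) - 1 - H) * (\<Sum>m. t ^ m * ?l m)"
    using \<open>summable (\<lambda>m. t ^ m * ?l m)\<close> lp t GS by (intro mult_nonneg_nonneg suminf_nonneg) auto
  moreover have "0 < (1 - 0) * (t / (1 - t))" using t by simp
  ultimately show False by linarith
qed

text \<open>The weighted Schreier formula: the factor t / (1 - t) in the lower bound for
  \<open>SL\<close> cancels against the one produced by the constants 1 and
  \<open>?E\<close>.\<close>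

lemma kers_lower:
  fixes t H :: real
  assumes t: "0 < t" "t < 1" and H: "\<And>A. finite A \<Longrightarrow> A \<subseteq> R \<Longrightarrow> (\<Sum>r\<in>A. t ^ e r) \<le> H"
    and GS: "1 + H < (\<Sum>x\<in>X. t ^ D x)" and fin: "finite (kers n)" and "n > 0"
  shows "1 + ((\<Sum>x\<in>X. t ^ D x) - 1 - H) * exp ((\<Sum>i\<in>{1..<n}. cdim i * t ^ i) / 2)
    \<le> lg (1 + (p - 1) * card (kers n))"
proof -
  let ?l = "\<lambda>m. lg (count (VL n m) (carrier F))"
  let ?\<delta> = "(\<Sum>x\<in>X. t ^ D x) - 1 - H" and ?E = "lg (1 + (p - 1) * card (kers n))"
  have lp: "0 \<le> ?l m" for m using count_VL_pos[OF order_refl] by (intro lg_nonneg)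
  have "(1 - ?E) * (t / (1 - t)) + ?\<delta> * SL n t (carrier F) \<le> 0"
    unfolding SL_def
    by (rule weighted_golod_shafarevich[OF t finite_X finite_relators _ lp summable_SL[OF t order_refl] H])
      (use lg_count_0[of "VL n 0" "carrier F"] golod_shafarevich_lvl_log[OF _ fin] in auto)
  moreover have "?\<delta> * (exp ((\<Sum>i\<in>{1..<n}. cdim i * t ^ i) / 2) * (t / (1 - t))) \<le> ?\<delta> * SL n t (carrier F)"
  proof (rule mult_left_mono)
    have "exp ((\<Sum>i\<in>{1..<n}. cdim i * t ^ i) / 2) * (t / (1 - t))
        \<le> (\<Prod>i\<in>{1..<n}. (1 + t ^ i) ^ cdim i) * (t / (1 - t))"
      using t by (intro mult_right_mono prod_one_plus_ge_exp) auto
    also have "\<dots> \<le> SL n t (carrier F)" using SL_lower[OF t, of 1 n] assms(6) by (simp add: lvl_1)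
    finally show "exp ((\<Sum>i\<in>{1..<n}. cdim i * t ^ i) / 2) * (t / (1 - t)) \<le> SL n t (carrier F)" .
  qed (use GS in simp)
  ultimately have "(1 - ?E + ?\<delta> * exp ((\<Sum>i\<in>{1..<n}. cdim i * t ^ i) / 2)) * (t / (1 - t)) \<le> 0"
    unfolding distrib_right mult.assoc by linarith
  moreover have "0 < t / (1 - t)" using t by simp
  ultimately have "1 - ?E + ?\<delta> * exp ((\<Sum>i\<in>{1..<n}. cdim i * t ^ i) / 2) \<le> 0"
    by (meson linorder_not_le mult_pos_pos)
  then show ?thesis by linarith
qed

lemma sum_cdim_le: "(\<Sum>i\<in>{1..<n}. cdim i) \<le> (card X + 1) ^ n" if "n > 0"
proof -
  have "p ^ (\<Sum>i\<in>{1..<n}. cdim i) \<le> p ^ card (words n)"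
    using lvl_cosets(2)[of n] index_lvl[of 1 n] that by (simp add: lvl_1)
  then have "(\<Sum>i\<in>{1..<n}. cdim i) \<le> card (words n)" using p_gt_1 by simp
  then show ?thesis using card_words_le[of n] by linarith
qed

lemma double_exponential_growth:
  fixes t\<^sub>0 H :: real and a :: "nat \<Rightarrow> nat"
  assumes t\<^sub>0: "0 < t\<^sub>0" "t\<^sub>0 < 1"
    and H: "\<And>A. finite A \<Longrightarrow> A \<subseteq> R \<Longrightarrow> (\<Sum>r\<in>A. t\<^sub>0 ^ e r) \<le> H"
    and GS: "1 + H < (\<Sum>x\<in>X. t\<^sub>0 ^ D x)"
    and fin: "\<And>n. n > 0 \<Longrightarrow> finite (kers n)"
    and a: "\<And>n. n > 0 \<Longrightarrow> card (kers n) \<le> a (p ^ Suc (\<Sum>i\<in>{1..<n}. cdim i))"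
  shows "\<exists>\<beta>::real. \<beta> > 0 \<and> infinite {m. log 2 (log 2 (a m)) \<ge> (log 2 m) powr \<beta>}"
proof -
  \<comment> \<open>Strictness leaves room: by continuity the inequality persists at some
    \<open>t\<^sub>1\<close> below \<open>t\<^sub>0\<close>, with the same H because the relator
    sums only decrease.\<close>
  have "((\<lambda>t. \<Sum>x\<in>X. t ^ D x) \<longlongrightarrow> (\<Sum>x\<in>X. t\<^sub>0 ^ D x)) (at_left t\<^sub>0)"
    by (intro tendsto_intros)
  then have "\<forall>\<^sub>F t in at_left t\<^sub>0. 1 + H < (\<Sum>x\<in>X. t ^ D x)" using GS by (rule order_tendstoD)
  moreover have "\<forall>\<^sub>F t in at_left t\<^sub>0. t \<in> {0<..<t\<^sub>0}"
    using t\<^sub>0 by (intro eventually_at_left_real)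
  ultimately have "\<forall>\<^sub>F t in at_left t\<^sub>0. 1 + H < (\<Sum>x\<in>X. t ^ D x) \<and> t \<in> {0<..<t\<^sub>0}"
    by (rule eventually_conj)
  then obtain t\<^sub>1 where t\<^sub>1: "1 + H < (\<Sum>x\<in>X. t\<^sub>1 ^ D x)" "0 < t\<^sub>1" "t\<^sub>1 < t\<^sub>0"
    using eventually_happens'[OF trivial_limit_at_left_real] by auto
  have t\<^sub>1': "t\<^sub>1 < 1" using t\<^sub>0 t\<^sub>1 by simp
  have H\<^sub>1: "(\<Sum>r\<in>A. t\<^sub>1 ^ e r) \<le> H" if "finite A" "A \<subseteq> R" for A
  proof -
    have "(\<Sum>r\<in>A. t\<^sub>1 ^ e r) \<le> (\<Sum>r\<in>A. t\<^sub>0 ^ e r)"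
      using t\<^sub>1 by (intro sum_mono power_mono) auto
    then show ?thesis using H[OF that] by linarith
  qed
  have "\<not> summable (\<lambda>i. cdim i * t\<^sub>1 ^ i)"
    by (rule cdim_divergent[OF t\<^sub>1(2) t\<^sub>1' H\<^sub>1 t\<^sub>1(1)])
  then obtain \<kappa> :: real where \<kappa>: "\<kappa> > 1" "infinite {n. \<kappa> ^ n \<le> (\<Sum>i\<in>{1..<n}. cdim i * t\<^sub>0 ^ i)}"
    using divergence_imp_exponential[OF t\<^sub>1(2,3)] by blast
  define \<delta> where "\<delta> = (\<Sum>x\<in>X. t\<^sub>0 ^ D x) - 1 - H"
  define C where "C = real (card X + 1)"
  define q where "q = sqrt \<kappa>"
  \<comment> \<open>For the indices m produced below, log2 m is at most a constant times C^n, and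
    C^n raised to \<beta> is sqrt \<kappa> to the power n. Against the lower bound, of order
    \<kappa>^n, half of the exponent is left to absorb the constants.\<close>
  define \<beta> where "\<beta> = ln \<kappa> / (2 * ln C)"
  have \<delta>: "\<delta> > 0" using GS by (simp add: \<delta>_def)
  have "X \<noteq> {}" using GS H[of "{}"] by auto
  then have C: "C > 1" using finite_X by (simp add: C_def card_gt_0_iff)
  have q: "q > 1" "q\<^sup>2 = \<kappa>" using \<kappa> by (auto simp: q_def)
  have \<beta>: "\<beta> > 0" using \<kappa> C by (simp add: \<beta>_def)
  define k\<^sub>1 k\<^sub>2 where "k\<^sub>1 = log 2 \<delta>" and "k\<^sub>2 = (2 * log 2 p) powr \<beta>"
  \<comment> \<open>Once y = q^n is this large, y / 2 - \<open>k\<^sub>2\<close> is at least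
    |\<open>k\<^sub>1\<close>| + 1, so \<open>k\<^sub>2\<close> y + |\<open>k\<^sub>1\<close>| stays
    below y^2 / 2.\<close>
  obtain n\<^sub>0 where n\<^sub>0: "2 * k\<^sub>2 + 2 * \<bar>k\<^sub>1\<bar> + 2 < q ^ n\<^sub>0" using real_arch_pow[OF q(1)] by blast
  define N where "N n = (\<Sum>i\<in>{1..<n}. cdim i)" for n
  have log2p: "1 \<le> log 2 p" using p_gt_1 by (simp add: le_log_iff)
  have main: "log 2 (log 2 (a (p ^ Suc (N n)))) \<ge> (log 2 (real (p ^ Suc (N n)))) powr \<beta>"
    if n: "\<kappa> ^ n \<le> (\<Sum>i\<in>{1..<n}. cdim i * t\<^sub>0 ^ i)" "n > 0" "n \<ge> n\<^sub>0" for n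
  proof -
    define k where "k = card (kers n)"
    define E where "E = \<delta> * exp (\<kappa> ^ n / 2)"
    have E: "E > 0" using \<delta> by (simp add: E_def)
    have "E \<le> \<delta> * exp ((\<Sum>i\<in>{1..<n}. cdim i * t\<^sub>0 ^ i) / 2)"
      unfolding E_def using \<delta> n(1) by (intro mult_left_mono) auto
    then have lk: "1 + E \<le> lg (1 + (p - 1) * k)"
      using kers_lower[OF t\<^sub>0 H GS fin[OF n(2)] n(2)] by (simp add: k_def \<delta>_def)
    have k0: "k > 0"
    proof (rule ccontr)
      assume "\<not> k > 0"
      then have "1 + E \<le> 0" using lk by simp
      then show False using E by simp
    qed
    \<comment> \<open>The summand 1 in \<open>lk\<close> pays for the factor p, so that E bounds
      \<open>lg k\<close> itself from below.\<close>
    have "1 + (p - 1) * k \<le> p * k"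
      using k0 p_gt_1 by (cases p) auto
    then have "1 + E \<le> lg (p * k)" using lk lg_mono[of "1 + (p - 1) * k" "p * k"] by linarith
    then have Ek: "E \<le> lg k" using k0 p_gt_1 by (simp add: log_mult)
    have "lg k * 1 \<le> lg k * log 2 p" using log2p lg_nonneg[OF k0] by (intro mult_left_mono) auto
    also have "\<dots> = log 2 k" using p_gt_1 k0 by (simp add: log_def)
    also have "\<dots> \<le> log 2 (a (p ^ Suc (N n)))"
      using a[OF n(2)] k0 by (simp add: k_def N_def)
    finally have "E \<le> log 2 (a (p ^ Suc (N n)))" using Ek by simp
    then have "log 2 E \<le> log 2 (log 2 (a (p ^ Suc (N n))))" using E by simp
    moreover have "k\<^sub>1 + \<kappa> ^ n / 2 \<le> log 2 E"
    proof -
      have "ln E = ln \<delta> + \<kappa> ^ n / 2" using \<delta> by (simp add: E_def ln_mult)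
      then have "log 2 E = k\<^sub>1 + (\<kappa> ^ n / 2) / ln 2"
        by (simp add: k\<^sub>1_def log_def add_divide_distrib)
      moreover have "(\<kappa> ^ n / 2) * 1 \<le> (\<kappa> ^ n / 2) * (1 / ln 2)"
        using ln_2_less_1 \<kappa> by (intro mult_left_mono) auto
      ultimately show ?thesis by simp
    qed
    moreover have "(log 2 (real (p ^ Suc (N n)))) powr \<beta> \<le> k\<^sub>2 * q ^ n"
    proof -
      have "real (N n) \<le> C ^ n"
        using sum_cdim_le[OF n(2)] unfolding N_def C_def by (metis of_nat_le_iff of_nat_power)
      moreover have "1 \<le> C ^ n" using C by simp
      ultimately have "real (Suc (N n)) \<le> 2 * C ^ n" by simp
      then have "real (Suc (N n)) * log 2 p \<le> 2 * C ^ n * log 2 p"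
        using log2p by (intro mult_right_mono) auto
      moreover have "log 2 (real (p ^ Suc (N n))) = real (Suc (N n)) * log 2 p"
        using p_gt_1 by (simp add: log_nat_power del: power_Suc)
      ultimately have "log 2 (real (p ^ Suc (N n))) \<le> (2 * log 2 p) * C ^ n" by (simp add: mult_ac)
      then have "(log 2 (real (p ^ Suc (N n)))) powr \<beta> \<le> ((2 * log 2 p) * C ^ n) powr \<beta>"
        using \<beta> p_gt_1 by (intro powr_mono2) (auto simp: log_nat_power simp del: power_Suc)
      also have "\<dots> = k\<^sub>2 * (C ^ n) powr \<beta>" using log2p C by (simp add: k\<^sub>2_def powr_mult)
      also have "(C ^ n) powr \<beta> = exp (real n * (ln \<kappa> / 2))"
        using C by (simp add: powr_def \<beta>_def ln_realpow)
      also have "\<dots> = q ^ n"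
        using \<kappa> by (simp add: exp_of_nat_mult q_def ln_sqrt[symmetric])
      finally show ?thesis .
    qed
    moreover have "k\<^sub>2 * q ^ n \<le> k\<^sub>1 + \<kappa> ^ n / 2"
    proof -
      define y where "y = q ^ n"
      have "q ^ n\<^sub>0 \<le> y" unfolding y_def using q n by (intro power_increasing) auto
      then have y: "2 * k\<^sub>2 + 2 * \<bar>k\<^sub>1\<bar> + 2 \<le> y" using n\<^sub>0 by linarith
      have k2: "k\<^sub>2 \<ge> 0" by (simp add: k\<^sub>2_def)
      then have "1 \<le> y" using y by linarith
      have "\<bar>k\<^sub>1\<bar> \<le> y * (y / 2 - k\<^sub>2)"
      proof -
        have "\<bar>k\<^sub>1\<bar> = 1 * \<bar>k\<^sub>1\<bar>" by simp
        also have "\<dots> \<le> y * (y / 2 - k\<^sub>2)"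
          using y \<open>1 \<le> y\<close> by (intro mult_mono) auto
        finally show ?thesis .
      qed
      moreover have "\<kappa> ^ n = y * y"
        by (simp add: y_def q(2)[symmetric] power_mult[symmetric] power_mult_distrib power2_eq_square)
      ultimately show ?thesis by (simp add: y_def[symmetric] algebra_simps)
    qed
    ultimately show ?thesis by linarith
  qed
  have "infinite {m. log 2 (log 2 (a m)) \<ge> (log 2 m) powr \<beta>}"
  proof
    assume "finite {m. log 2 (log 2 (a m)) \<ge> (log 2 m) powr \<beta>}"
    then obtain B where B: "\<And>m. log 2 (log 2 (a m)) \<ge> (log 2 m) powr \<beta> \<Longrightarrow> m \<le> B"
      by (metis (no_types, lifting) finite_nat_set_iff_bounded_le mem_Collect_eq)
    \<comment> \<open>Different n may give the same index, so the indices have to be shown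
      unbounded: the index exceeds \<open>N n\<close>, which is at least \<kappa>^n for the n in
      question.\<close>
    obtain n\<^sub>1 where n\<^sub>1: "real B < \<kappa> ^ n\<^sub>1" using real_arch_pow[OF \<kappa>(1)] by blast
    obtain n where n: "n \<ge> Suc (max n\<^sub>0 n\<^sub>1)" "\<kappa> ^ n \<le> (\<Sum>i\<in>{1..<n}. cdim i * t\<^sub>0 ^ i)"
      using \<kappa>(2) unfolding infinite_nat_iff_unbounded_le by blast
    have "p ^ Suc (N n) \<le> B" by (rule B) (use main[of n] n in auto)
    moreover have "N n < p ^ Suc (N n)"
      using power_gt_expt[of p "Suc (N n)"] p_gt_1 by simp
    ultimately have "real (N n) \<le> B" by linarith
    moreover have "(\<Sum>i\<in>{1..<n}. cdim i * t\<^sub>0 ^ i) \<le> (\<Sum>i\<in>{1..<n}. real (cdim i))"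
      using t\<^sub>0 by (intro sum_mono) (auto intro!: mult_left_le power_le_one)
    moreover have "\<kappa> ^ n\<^sub>1 \<le> \<kappa> ^ n" using \<kappa> n by (intro power_increasing) auto
    ultimately show False using n(2) n\<^sub>1 by (simp add: N_def)
  qed
  then show ?thesis using \<beta> by blast
qed

end

section \<open>The Magnus expansion of the free pro-\<open>p\<close> group\<close>

lemma rcosets_eq_image: "rcosets\<^bsub>G\<^esub> H = (\<lambda>a. H #>\<^bsub>G\<^esub> a) ` carrier G"
  by (auto simp: RCOSETS_def)

context pro_p_group
begin

lemma openin_rcos: assumes "openin T N" "a \<in> carrier G" shows "openin T (N #> a)"
proof -
  have N: "N \<subseteq> carrier G" using openin_subset[OF assms(1)] topspace_eq by simp
  have "continuous_map T (prod_topology T T) (\<lambda>x. (x, inv a))"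
    using assms(2) by (simp add: continuous_map_pairwise o_def topspace_eq)
  from continuous_map_compose[OF this continuous_mult]
  have "continuous_map T T (\<lambda>x. x \<otimes> inv a)" by (simp add: o_def)
  from openin_continuous_map_preimage[OF this assms(1)]
  have "openin T {x \<in> carrier G. x \<otimes> inv a \<in> N}" by (simp add: topspace_eq)
  moreover have "{x \<in> carrier G. x \<otimes> inv a \<in> N} = N #> a"
  proof (intro equalityI subsetI)
    fix x assume "x \<in> {x \<in> carrier G. x \<otimes> inv a \<in> N}"
    then have x: "x \<in> carrier G" "x \<otimes> inv a \<in> N" by auto
    have "x = x \<otimes> inv a \<otimes> a" using x assms(2) by (simp add: m_assoc)
    then show "x \<in> N #> a" using x(2) unfolding r_coset_def by blast
  qed (use N assms(2) in \<open>auto simp: r_coset_def m_assoc\<close>)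
  ultimately show ?thesis by simp
qed

lemma continuous_map_rcos:
  assumes "openin T N" "subgroup N G"
  shows "continuous_map T (discrete_topology (rcosets N)) (\<lambda>a. N #> a)"
  unfolding continuous_map_def
proof (intro conjI allI impI)
  fix U assume "openin (discrete_topology (rcosets N)) U"
  then have U: "U \<subseteq> rcosets N" by simp
  have "{x \<in> topspace T. N #> x \<in> U} = \<Union>U"
  proof (intro equalityI subsetI)
    fix x assume "x \<in> {x \<in> topspace T. N #> x \<in> U}"
    then show "x \<in> \<Union>U" using rcos_self[OF _ assms(2)] by (auto simp: topspace_eq)
  next
    fix x assume "x \<in> \<Union>U"
    then obtain a where a: "a \<in> carrier G" "x \<in> N #> a" "N #> a \<in> U"
      using U by (auto simp: RCOSETS_def)
    then have "x \<in> carrier G" "N #> a = N #> x"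
      using repr_independence[OF a(2,1) assms(2)] r_coset_subset_G[OF subgroup.subset[OF assms(2)] a(1)] by auto
    then show "x \<in> {x \<in> topspace T. N #> x \<in> U}" using a by (auto simp: topspace_eq)
  qed
  moreover have "openin T (\<Union>U)"
    using U openin_rcos[OF assms(1)] by (intro openin_Union) (auto simp: RCOSETS_def)
  ultimately show "openin T {x \<in> topspace T. N #> x \<in> U}" by simp
qed (auto simp: topspace_eq RCOSETS_def)

lemma finite_cosets: assumes "openin T N" "subgroup N G" shows "finite (rcosets N)"
proof -
  from image_compactin[OF _ continuous_map_rcos[OF assms], of "carrier G"] compact
  have "finite ((\<lambda>a. N #> a) ` carrier G)"
    by (simp add: compact_space_def topspace_eq compactin_discrete_topology)
  then show ?thesis by (simp add: rcosets_eq_image)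
qed

end

locale continuum_free_pro_p_group = free_pro_p_group p F T X
  for p :: nat and F :: "continuum monoid" (structure) and T X
begin

text \<open>The quotient by an open normal subgroup is carried by a set of coset representatives, so
  that it lives on the type \<^typ>\<open>continuum\<close> and the universal property applies to it.\<close>

lemma open_normal_containing_basis:
  assumes N: "N \<lhd> F" "openin T N" "X \<subseteq> N"
  shows "N = carrier F"
proof -
  interpret N: normal N F by (rule N(1))
  define \<rho> where "\<rho> f = (SOME g. g \<in> N #> f)" for f
  have \<rho>: "\<rho> f \<in> N #> f" if "f \<in> carrier F" for f
    using someI[of "\<lambda>g. g \<in> N #> f" f] rcos_self[OF that N.subgroup_axioms]
    by (simp add: \<rho>_def)
  have \<rho>c: "\<rho> f \<in> carrier F" if "f \<in> carrier F" for f
    using \<rho>[OF that] r_coset_subset_G[OF N.subset that] by auto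
  have \<rho>N: "N #> \<rho> f = N #> f" if "f \<in> carrier F" for f
    using repr_independence[OF \<rho>[OF that] that N.subgroup_axioms] by simp
  have \<rho>eq: "\<rho> f = \<rho> g \<longleftrightarrow> N #> f = N #> g" if "f \<in> carrier F" "g \<in> carrier F" for f g
  proof
    show "N #> f = N #> g" if "\<rho> f = \<rho> g"
      using \<rho>N[OF \<open>f \<in> carrier F\<close>] \<rho>N[OF \<open>g \<in> carrier F\<close>] that by simp
    show "\<rho> f = \<rho> g" if "N #> f = N #> g" unfolding \<rho>_def that ..
  qed
  have l: "\<rho> (\<rho> f \<otimes> g) = \<rho> (f \<otimes> g)" and r: "\<rho> (f \<otimes> \<rho> g) = \<rho> (f \<otimes> g)"
    if "f \<in> carrier F" "g \<in> carrier F" for f g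
    using that \<rho>c[OF that(1)] \<rho>c[OF that(2)] \<rho>N[OF that(1)] \<rho>N[OF that(2)]
      N.rcos_sum[of f g] N.rcos_sum[of "\<rho> f" g] N.rcos_sum[of f "\<rho> g"]
    by (simp_all add: \<rho>eq)
  define H :: "continuum monoid" where
    "H = \<lparr>carrier = \<rho> ` carrier F, monoid.mult = \<lambda>a b. \<rho> (a \<otimes> b), one = \<rho> \<one>\<rparr>"
  have idem: "\<rho> (\<rho> f) = \<rho> f" if "f \<in> carrier F" for f
    using \<rho>eq[OF \<rho>c[OF that] that] \<rho>N[OF that] by simp
  have H: "group H"
  proof (rule groupI)
    show "\<one>\<^bsub>H\<^esub> \<in> carrier H" by (simp add: H_def)
  next
    fix a b assume "a \<in> carrier H" "b \<in> carrier H"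
    then show "a \<otimes>\<^bsub>H\<^esub> b \<in> carrier H" using \<rho>c by (auto simp: H_def)
  next
    fix a b c assume "a \<in> carrier H" "b \<in> carrier H" "c \<in> carrier H"
    then obtain f g h where f: "f \<in> carrier F" "g \<in> carrier F" "h \<in> carrier F"
      "a = \<rho> f" "b = \<rho> g" "c = \<rho> h" by (auto simp: H_def)
    then have "\<rho> (\<rho> (\<rho> f \<otimes> \<rho> g) \<otimes> \<rho> h) = \<rho> (f \<otimes> g \<otimes> h)"
      "\<rho> (\<rho> f \<otimes> \<rho> (\<rho> g \<otimes> \<rho> h)) = \<rho> (f \<otimes> (g \<otimes> h))"
      using \<rho>c by (simp_all add: l r)
    then show "a \<otimes>\<^bsub>H\<^esub> b \<otimes>\<^bsub>H\<^esub> c = a \<otimes>\<^bsub>H\<^esub> (b \<otimes>\<^bsub>H\<^esub> c)"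
      using f by (simp add: H_def m_assoc)
  next
    fix a assume "a \<in> carrier H"
    then obtain f where f: "f \<in> carrier F" "a = \<rho> f" by (auto simp: H_def)
    show "\<one>\<^bsub>H\<^esub> \<otimes>\<^bsub>H\<^esub> a = a" using f \<rho>c[OF f(1)] by (simp add: H_def l idem)
    have "\<rho> (inv f) \<otimes>\<^bsub>H\<^esub> a = \<one>\<^bsub>H\<^esub>" using f \<rho>c[OF f(1)] by (simp add: H_def l r)
    moreover have "\<rho> (inv f) \<in> carrier H" using f by (simp add: H_def)
    ultimately show "\<exists>b\<in>carrier H. b \<otimes>\<^bsub>H\<^esub> a = \<one>\<^bsub>H\<^esub>" by blast
  qed
  interpret H: group H by (rule H)
  have carrier_H: "carrier H = \<rho> ` carrier F" and mult_H: "\<And>a b. a \<otimes>\<^bsub>H\<^esub> b = \<rho> (a \<otimes> b)"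
    by (simp_all add: H_def)
  have hom: "\<rho> \<in> hom F H"
  proof (rule homI)
    fix f g assume "f \<in> carrier F" "g \<in> carrier F"
    then show "\<rho> (f \<otimes> g) = \<rho> f \<otimes>\<^bsub>H\<^esub> \<rho> g" using \<rho>c by (simp add: mult_H l r)
  qed (simp add: carrier_H)
  interpret h: group_hom F H \<rho> by unfold_locales (rule hom)
  let ?T = "discrete_topology (carrier H)"
  have "continuous_map (discrete_topology (rcosets N)) ?T (\<lambda>U. SOME g. g \<in> U)"
  proof -
    have "(SOME g. g \<in> U) \<in> carrier H" if "U \<in> rcosets N" for U
      using that by (auto simp: RCOSETS_def \<rho>_def[symmetric] carrier_H)
    then show ?thesis by (auto simp: continuous_map_def)
  qed
  from continuous_map_compose[OF continuous_map_rcos[OF N(2) N.subgroup_axioms] this]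
  have cont: "continuous_map T ?T \<rho>" by (simp add: o_def \<rho>_def[abs_def])
  have fin: "finite (carrier H)"
  proof -
    have "carrier H = (\<lambda>U. SOME g. g \<in> U) ` (rcosets N)" by (auto simp: carrier_H \<rho>_def RCOSETS_def)
    then show ?thesis using finite_cosets[OF N(2) N.subgroup_axioms] by simp
  qed
  have "pro_p_group p H ?T"
  proof unfold_locales
    show "topspace ?T = carrier H" by simp
    show "continuous_map (prod_topology ?T ?T) ?T (\<lambda>(x, y). x \<otimes>\<^bsub>H\<^esub> y)"
      unfolding prod_topology_discrete_topology[symmetric] by (auto simp: continuous_map_def)
    show "continuous_map ?T ?T (\<lambda>x. inv\<^bsub>H\<^esub> x)" by (auto simp: continuous_map_def)
    show "compact_space ?T" using fin by (simp add: compact_space_discrete_topology)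
    show "Hausdorff_space ?T" by simp
    show "\<exists>a. S \<subseteq> {a}" if "connectedin ?T S" for S using that by (simp add: connectedin_discrete_topology)
    \<comment> \<open>The index of M in H equals that of its preimage in F, which is a power of
      p.\<close>
    fix M assume M: "M \<lhd> H" "openin ?T M"
    interpret M: normal M H by (rule M(1))
    define M' where "M' = {f \<in> carrier F. \<rho> f \<in> M}"
    have M': "M' \<lhd> F"
    proof (rule normal_invI)
      show "subgroup M' F"
        by (rule subgroupI) (auto simp: M'_def intro: M.m_inv_closed M.m_closed exI[of _ \<one>])
      show "x \<otimes> k \<otimes> inv x \<in> M'" if "x \<in> carrier F" "k \<in> M'" for x k
        using that M.inv_op_closed2 by (auto simp: M'_def)
    qed
    have "openin T M'"
      using openin_continuous_map_preimage[OF cont M(2)] by (simp add: M'_def topspace_eq)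
    from p_power_index[OF M' this] obtain k where k: "card (rcosets M') = p ^ k" by blast
    have "card ((\<lambda>f. M #>\<^bsub>H\<^esub> \<rho> f) ` carrier F) = card ((\<lambda>f. M' #> f) ` carrier F)"
    proof (rule card_image_eq_of_kernel)
      fix x y assume xy: "x \<in> carrier F" "y \<in> carrier F"
      have "M #>\<^bsub>H\<^esub> \<rho> x = M #>\<^bsub>H\<^esub> \<rho> y \<longleftrightarrow> \<rho> x \<otimes>\<^bsub>H\<^esub> inv\<^bsub>H\<^esub> \<rho> y \<in> M"
        by (rule H.rcos_eq_iff[OF M.subgroup_axioms]) (use xy in auto)
      also have "\<dots> \<longleftrightarrow> M' #> x = M' #> y"
        using rcos_eq_iff[OF normal_imp_subgroup[OF M'] xy] xy by (simp add: M'_def)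
      finally show "(M' #> x = M' #> y) = (M #>\<^bsub>H\<^esub> \<rho> x = M #>\<^bsub>H\<^esub> \<rho> y)" by simp
    qed
    then show "\<exists>k. card (rcosets\<^bsub>H\<^esub> M) = p ^ k"
      using k by (auto simp: rcosets_eq_image carrier_H image_image)
  qed
  \<comment> \<open>Both \<rho> and the trivial map send all of X to the identity of H. Uniqueness
    in the universal property identifies them, so F / N is trivial.\<close>
  then have "\<exists>!\<phi>. \<phi> \<in> hom F H \<inter> extensional (carrier F) \<and> continuous_map T ?T \<phi> \<and> (\<forall>x\<in>X. \<phi> x = \<rho> \<one>)"
    by (intro universal) auto
  moreover have "restrict \<rho> (carrier F) \<in> hom F H \<inter> extensional (carrier F)
      \<and> continuous_map T ?T (restrict \<rho> (carrier F)) \<and> (\<forall>x\<in>X. restrict \<rho> (carrier F) x = \<rho> \<one>)"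
  proof (intro conjI ballI)
    show "restrict \<rho> (carrier F) \<in> hom F H \<inter> extensional (carrier F)"
      using hom by (auto simp: hom_def)
    show "continuous_map T ?T (restrict \<rho> (carrier F))"
      using cont by (rule continuous_map_eq) (simp add: topspace_eq)
    fix x assume x: "x \<in> X"
    then have "x \<in> carrier F" "N #> x = N #> \<one>"
      using basis_subset N(3) coset_join2[OF _ N.subgroup_axioms] by auto
    then show "restrict \<rho> (carrier F) x = \<rho> \<one>" using \<rho>eq by (simp del: h.hom_one)
  qed
  moreover have "(\<lambda>f\<in>carrier F. \<rho> \<one>) \<in> hom F H \<inter> extensional (carrier F)
      \<and> continuous_map T ?T (\<lambda>f\<in>carrier F. \<rho> \<one>) \<and> (\<forall>x\<in>X. (\<lambda>f\<in>carrier F. \<rho> \<one>) x = \<rho> \<one>)"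
  proof (intro conjI ballI)
    have "(\<lambda>f\<in>carrier F. \<rho> \<one>) \<in> hom F H" by (rule homI) simp_all
    then show "(\<lambda>f\<in>carrier F. \<rho> \<one>) \<in> hom F H \<inter> extensional (carrier F)" by simp
    have "continuous_map T ?T (\<lambda>f. \<rho> \<one>)" by simp
    then show "continuous_map T ?T (\<lambda>f\<in>carrier F. \<rho> \<one>)"
      by (rule continuous_map_eq) (simp add: topspace_eq)
  qed (use basis_subset in auto)
  ultimately have "restrict \<rho> (carrier F) = (\<lambda>f\<in>carrier F. \<rho> \<one>)" by blast
  then have "\<rho> f = \<rho> \<one>" if "f \<in> carrier F" for f
    using that by (metis restrict_apply')
  then have "N #> f = N #> \<one>" if "f \<in> carrier F" for f using that \<rho>eq[OF that one_closed] by blast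
  then have "f \<in> N" if "f \<in> carrier F" for f
    using that rcos_self[OF that N.subgroup_axioms] coset_mult_one[OF N.subset] by auto
  then show ?thesis using N.subset by auto
qed

end

locale magnus_embedded_group = continuum_free_pro_p_group p F T X
  for p :: nat and F :: "continuum monoid" (structure) and T X +
  fixes \<mu> :: "continuum \<Rightarrow> continuum list \<Rightarrow> int"
  assumes prime: "prime p"
    and magnus: "magnus_embedding p F T X \<mu>"
begin

abbreviation S where "S \<equiv> Fp_series p X"

lemma residues: "residues (int p)"
  using prime_gt_1_nat[OF prime] by (simp add: residues_def)

lemma ring_S: "ring S"
  using residues.cring[OF residues] cring.axioms(1) ring.ring_nc_power_series by blast

lemma carrier_S: "carrier S = lists X \<rightarrow>\<^sub>E {0..int p - 1}"
  by (simp add: nc_power_series_def residues.res_carrier_eq[OF residues])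

lemma mu_Units: "f \<in> carrier F \<Longrightarrow> \<mu> f \<in> Units S"
  using magnus by (auto simp: magnus_embedding_def hom_def units_of_def)

lemma mu_carrier: "f \<in> carrier F \<Longrightarrow> \<mu> f \<in> carrier S"
  using mu_Units by (auto simp: Units_def)

lemma mu_range: "f \<in> carrier F \<Longrightarrow> w \<in> lists X \<Longrightarrow> \<mu> f w \<in> {0..int p - 1}"
  using mu_carrier[of f] by (auto simp only: carrier_S PiE_iff)

lemma mu_mod: "f \<in> carrier F \<Longrightarrow> w \<in> lists X \<Longrightarrow> \<mu> f w mod int p = \<mu> f w"
  using mu_range[of f w] by simp

lemma mult_S:
  assumes "a \<in> carrier S" "b \<in> carrier S" "w \<in> lists X"
  shows "(a \<otimes>\<^bsub>S\<^esub> b) w = (\<Sum>i\<le>length w. a (take i w) * b (drop i w)) mod int p"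
proof -
  have "(a \<otimes>\<^bsub>S\<^esub> b) w
      = (\<Oplus>\<^bsub>residue_ring (int p)\<^esub>i\<in>{..length w}. (a (take i w) * b (drop i w)) mod int p)"
    using assms(3) by (simp add: nc_power_series_def residues.res_mult_eq[OF residues] del: in_lists_conv_set)
  also have "\<dots> = (\<Sum>i\<le>length w. a (take i w) * b (drop i w)) mod int p"
    by (rule residues.sum_cong[OF residues]) simp
  finally show ?thesis .
qed

lemma add_S: "w \<in> lists X \<Longrightarrow> (a \<oplus>\<^bsub>S\<^esub> b) w = (a w + b w) mod int p"
  by (simp add: nc_power_series_def residues.res_add_eq[OF residues])

lemma one_S: "w \<in> lists X \<Longrightarrow> \<one>\<^bsub>S\<^esub> w = of_bool (w = [])"
  by (simp add: nc_power_series_def residues.res_one_eq[OF residues] residues.res_zero_eq[OF residues])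

lemma zero_S: "w \<in> lists X \<Longrightarrow> \<zero>\<^bsub>S\<^esub> w = 0"
  by (simp add: nc_power_series_def residues.res_zero_eq[OF residues])

lemma monom_S: "w \<in> lists X \<Longrightarrow> nc_monom (residue_ring (int p)) X v w = of_bool (w = v)"
  by (simp add: nc_monom_def residues.res_one_eq[OF residues] residues.res_zero_eq[OF residues])

lemma monom_carrier: "nc_monom (residue_ring (int p)) X v \<in> carrier S"
  using prime_gt_1_nat[OF prime]
  by (auto simp: nc_monom_def carrier_S residues.res_one_eq[OF residues] residues.res_zero_eq[OF residues])

lemma mu_mult:
  assumes "w \<in> lists X" "f \<in> carrier F" "g \<in> carrier F"
  shows "[\<mu> (f \<otimes> g) w = (\<Sum>i\<le>length w. \<mu> f (take i w) * \<mu> g (drop i w))] (mod (int p))"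
proof -
  have "\<mu> (f \<otimes> g) = \<mu> f \<otimes>\<^bsub>S\<^esub> \<mu> g"
    using magnus assms by (auto simp: magnus_embedding_def hom_def units_of_def)
  then show ?thesis using mult_S[OF mu_carrier mu_carrier, of f g w] assms by (simp add: cong_def)
qed

lemma mu_one: "\<mu> \<one> = \<one>\<^bsub>S\<^esub>"
proof -
  interpret S: ring S by (rule ring_S)
  have "\<mu> \<in> hom F (units_of S)" using magnus by (simp add: magnus_embedding_def)
  from hom_one[OF this group_axioms S.units_group] have "\<mu> \<one> = \<one>\<^bsub>units_of S\<^esub>" .
  then show ?thesis by (simp add: units_of_def)
qed

lemma mu_gen: "x \<in> X \<Longrightarrow> w \<in> lists X \<Longrightarrow> [\<mu> x w = of_bool (w = []) + of_bool (w = [x])] (mod (int p))"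
  using magnus by (auto simp: magnus_embedding_def add_S one_S monom_S cong_def simp del: in_lists_conv_set)

section \<open>Finite truncations of the Magnus expansion\<close>

definition agree :: "continuum list set \<Rightarrow> continuum \<Rightarrow> continuum \<Rightarrow> bool" where
  "agree W f g \<longleftrightarrow> (\<forall>w\<in>W. [\<mu> f w = \<mu> g w] (mod (int p)))"

definition short :: "nat \<Rightarrow> continuum list set" where
  "short n = {w \<in> lists X. length w < n}"

lemma finite_short: "finite (short n)"
proof -
  have "short n \<subseteq> {w. set w \<subseteq> X \<and> length w \<le> n}" by (auto simp: short_def)
  then show ?thesis using finite_lists_length_le[OF finite_basis] finite_subset by blast
qed

lemma short_lists: "short n \<subseteq> lists X" by (auto simp: short_def)

lemma short_take_drop:
  "w \<in> short n \<Longrightarrow> take i w \<in> short n" "w \<in> short n \<Longrightarrow> drop i w \<in> short n"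
  by (auto simp: short_def dest: in_set_takeD in_set_dropD)

lemma agree_refl: "agree W f f" by (simp add: agree_def)

lemma agree_sym: "agree W f g \<Longrightarrow> agree W g f" by (simp add: agree_def cong_sym)

lemma agree_trans: "agree W f g \<Longrightarrow> agree W g h \<Longrightarrow> agree W f h"
  by (auto simp: agree_def intro: cong_trans)

lemma agree_mult:
  assumes "agree (short n) f f'" "agree (short n) g g'"
    "f \<in> carrier F" "f' \<in> carrier F" "g \<in> carrier F" "g' \<in> carrier F"
  shows "agree (short n) (f \<otimes> g) (f' \<otimes> g')"
  unfolding agree_def
proof
  fix w assume w: "w \<in> short n"
  then have wl: "w \<in> lists X" using short_lists by auto
  have "[(\<Sum>i\<le>length w. \<mu> f (take i w) * \<mu> g (drop i w)) = (\<Sum>i\<le>length w. \<mu> f' (take i w) * \<mu> g' (drop i w))] (mod (int p))"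
    using assms(1,2) short_take_drop[OF w] unfolding agree_def by (intro cong_sum cong_mult) auto
  then show "[\<mu> (f \<otimes> g) w = \<mu> (f' \<otimes> g') w] (mod (int p))"
    using mu_mult[OF wl assms(3,5)] mu_mult[OF wl assms(4,6)] by (meson cong_sym cong_trans)
qed

text \<open>A is a union of sets prescribing finitely many coefficients, and every coefficient is a
  continuous function with values in a discrete space.\<close>

lemma open_saturated:
  assumes W: "finite W" "W \<subseteq> lists X" and A: "A \<subseteq> carrier F"
    and sat: "\<And>f g. f \<in> A \<Longrightarrow> g \<in> carrier F \<Longrightarrow> agree W f g \<Longrightarrow> g \<in> A"
  shows "openin T A"
proof -
  have cyl: "openin T {g \<in> carrier F. \<forall>w\<in>W. \<mu> g w = c w}" for c
    using W
  proof (induction W rule: finite_induct)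
    case empty
    then show ?case using openin_topspace[of T] by (simp add: topspace_eq)
  next
    case (insert w W)
    have w: "w \<in> lists X" using insert by auto
    have "continuous_map T (nc_power_series_topology (residue_ring (int p)) X) \<mu>"
      using magnus by (simp add: magnus_embedding_def)
    from continuous_map_compose[OF this[unfolded nc_power_series_topology_def] continuous_map_product_projection[OF w]]
    have "continuous_map T (discrete_topology (carrier (residue_ring (int p)))) (\<lambda>f. \<mu> f w)" by (simp add: o_def)
    moreover have "openin (discrete_topology (carrier (residue_ring (int p)))) {a \<in> carrier (residue_ring (int p)). a = c w}"
      by auto
    ultimately have "openin T {g \<in> topspace T. \<mu> g w \<in> {a \<in> carrier (residue_ring (int p)). a = c w}}"
      by (rule openin_continuous_map_preimage)
    moreover have "{g \<in> topspace T. \<mu> g w \<in> {a \<in> carrier (residue_ring (int p)). a = c w}} = {g \<in> carrier F. \<mu> g w = c w}"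
      using mu_range[OF _ w] by (auto simp: topspace_eq residues.res_carrier_eq[OF residues])
    ultimately have "openin T ({g \<in> carrier F. \<mu> g w = c w} \<inter> {g \<in> carrier F. \<forall>w\<in>W. \<mu> g w = c w})"
      using insert by (intro openin_Int) auto
    moreover have "{g \<in> carrier F. \<mu> g w = c w} \<inter> {g \<in> carrier F. \<forall>w\<in>W. \<mu> g w = c w}
        = {g \<in> carrier F. \<forall>w\<in>insert w W. \<mu> g w = c w}" by auto
    ultimately show ?case by simp
  qed
  have "A = (\<Union>f\<in>A. {g \<in> carrier F. \<forall>w\<in>W. \<mu> g w = \<mu> f w})"
  proof (intro equalityI subsetI)
    fix g assume "g \<in> (\<Union>f\<in>A. {g \<in> carrier F. \<forall>w\<in>W. \<mu> g w = \<mu> f w})"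
    then obtain f where f: "f \<in> A" "g \<in> carrier F" "\<forall>w\<in>W. \<mu> g w = \<mu> f w" by blast
    show "g \<in> A" by (rule sat[OF f(1,2)]) (use f(3) in \<open>simp add: agree_def\<close>)
  qed (use A in blast)
  moreover have "openin T (\<Union>f\<in>A. {g \<in> carrier F. \<forall>w\<in>W. \<mu> g w = \<mu> f w})"
    using cyl by (intro openin_Union) auto
  ultimately show ?thesis by simp
qed

lemma closed_saturated:
  assumes "finite W" "W \<subseteq> lists X" "A \<subseteq> carrier F"
    and "\<And>f g. f \<in> A \<Longrightarrow> g \<in> carrier F \<Longrightarrow> agree W f g \<Longrightarrow> g \<in> A"
  shows "closedin T A"
proof -
  have "openin T (carrier F - A)"
    by (rule open_saturated[OF assms(1,2)]) (use assms(3,4) agree_sym in blast)+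
  then show ?thesis using assms(3) by (simp add: closedin_def topspace_eq)
qed

text \<open>The constant term is a homomorphism into the group of units of \<open>\<F>\<^sub>p\<close>, whose order is prime
  to \<open>p\<close>.\<close>

lemma mu_Nil: assumes f: "f \<in> carrier F" shows "[\<mu> f [] = 1] (mod (int p))"
proof -
  have mult: "[\<mu> (f \<otimes> g) [] = \<mu> f [] * \<mu> g []] (mod (int p))" if "f \<in> carrier F" "g \<in> carrier F" for f g
    using mu_mult[of "[]" f g] that by simp
  have one: "\<mu> \<one> [] = 1" using mu_one one_S[of "[]"] by simp
  have pow: "[\<mu> (f [^] n) [] = \<mu> f [] ^ n] (mod (int p))" if "f \<in> carrier F" for f and n :: nat
  proof (induction n)
    case (Suc n)
    have "[\<mu> (f [^] n) [] * \<mu> f [] = \<mu> f [] ^ n * \<mu> f []] (mod (int p))" by (intro cong_mult Suc cong_refl)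
    then show ?case using cong_trans[OF mult[of "f [^] n" f]] that by (simp add: mult.commute)
  qed (simp add: one)
  have inv: "[\<mu> f [] * \<mu> (inv f) [] = 1] (mod (int p))" if "f \<in> carrier F" for f
    using mult[of f "inv f"] that one by (simp add: cong_sym_eq)
  define N where "N = {f \<in> carrier F. [\<mu> f [] = 1] (mod (int p))}"
  have N: "N \<lhd> F"
  proof (rule normal_invI)
    show "subgroup N F"
    proof (rule subgroupI)
      show "N \<subseteq> carrier F" by (auto simp: N_def)
      show "N \<noteq> {}" using one by (auto simp: N_def)
      show "inv a \<in> N" if "a \<in> N" for a
      proof -
        have a: "a \<in> carrier F" "[\<mu> a [] = 1] (mod (int p))" using that by (auto simp: N_def)
        have "[\<mu> a [] * \<mu> (inv a) [] = 1 * \<mu> (inv a) []] (mod (int p))" by (intro cong_mult a cong_refl)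
        from cong_trans[OF cong_sym[OF this] inv[OF a(1)]] show ?thesis using a by (simp add: N_def)
      qed
      show "a \<otimes> b \<in> N" if "a \<in> N" "b \<in> N" for a b
      proof -
        have ab: "a \<in> carrier F" "b \<in> carrier F" "[\<mu> a [] * \<mu> b [] = 1 * 1] (mod (int p))"
          using that unfolding N_def by (blast intro: cong_mult)+
        then show ?thesis using cong_trans[OF mult[OF ab(1,2)] ab(3)] by (simp add: N_def)
      qed
    qed
    fix x k assume x: "x \<in> carrier F" and "k \<in> N"
    then have k: "k \<in> carrier F" "[\<mu> k [] = 1] (mod (int p))" by (auto simp: N_def)
    have "[\<mu> (x \<otimes> k \<otimes> inv x) [] = \<mu> (x \<otimes> k) [] * \<mu> (inv x) []] (mod (int p))"
      using x k by (intro mult) auto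
    also have "[\<mu> (x \<otimes> k) [] * \<mu> (inv x) [] = (\<mu> x [] * \<mu> k []) * \<mu> (inv x) []] (mod (int p))"
      using x k by (intro mult cong_mult cong_refl) auto
    also have "[(\<mu> x [] * \<mu> k []) * \<mu> (inv x) [] = (\<mu> x [] * 1) * \<mu> (inv x) []] (mod (int p))"
      by (intro cong_mult cong_refl k)
    also have "[(\<mu> x [] * 1) * \<mu> (inv x) [] = 1] (mod (int p))" using inv[OF x] by simp
    finally show "x \<otimes> k \<otimes> inv x \<in> N" using x k by (simp add: N_def)
  qed
  interpret N: normal N F by (rule N)
  have "openin T N"
  proof (rule open_saturated[of "{[]}"])
    fix f g assume a: "f \<in> N" "g \<in> carrier F" "agree {[]} f g"
    then have "[\<mu> f [] = 1] (mod (int p))" "[\<mu> f [] = \<mu> g []] (mod (int p))"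
      unfolding N_def agree_def by blast+
    from cong_trans[OF cong_sym[OF this(2)] this(1)] show "g \<in> N" using a(2) unfolding N_def by blast
  qed (use N.subset in auto)
  then obtain k where k: "card (rcosets N) = p ^ k" using p_power_index[OF N] by blast
  interpret Q: group "F Mod N" by (rule N.factorgroup_is_group)
  have "(N #> f) [^]\<^bsub>F Mod N\<^esub> (p ^ k) = \<one>\<^bsub>F Mod N\<^esub>"
  proof -
    have c: "N #> f \<in> carrier (F Mod N)" unfolding carrier_FactGroup using f by (rule imageI)
    have o: "Coset.order (F Mod N) = p ^ k" unfolding Coset.order_def FactGroup_def using k by simp
    show ?thesis using Q.pow_order_eq_1[OF c] unfolding o .
  qed
  then have "N #> (f [^] (p ^ k)) = N" using N.FactGroup_pow[OF f] by simp
  then have "f [^] (p ^ k) \<in> N" using rcos_self[OF _ N.subgroup_axioms, of "f [^] (p ^ k)"] f by simp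
  then have "[\<mu> (f [^] (p ^ k)) [] = 1] (mod (int p))" unfolding N_def by blast
  from cong_trans[OF cong_sym[OF pow[OF f]] this] have 1: "[\<mu> f [] ^ (p ^ k) = 1] (mod (int p))" .
  define a where "a = nat (\<mu> f [])"
  have a: "\<mu> f [] = int a" using mu_range[OF f, of "[]"] by (simp add: a_def)
  have ndvd: "\<not> p dvd a"
  proof
    assume "p dvd a"
    moreover have "a dvd a ^ (p ^ k)" by (rule dvd_power) (use prime_gt_0_nat[OF prime] in simp)
    ultimately have "p dvd a ^ (p ^ k)" by (rule dvd_trans)
    then have "int p dvd int (a ^ (p ^ k))" by (simp only: of_nat_dvd_iff)
    then have "[\<mu> f [] ^ (p ^ k) = 0] (mod (int p))" unfolding a cong_0_iff of_nat_power .
    from cong_trans[OF cong_sym[OF 1] this] have "int p dvd 1" unfolding cong_0_iff .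
    then show False using prime_gt_1_nat[OF prime] by simp
  qed
  \<comment> \<open>Coprimality of the orders enters as follows: by Fermat a^(p^k) is congruent to
    a, while f^(p^k) in N makes it congruent to 1.\<close>
  have "[a ^ (p - 1) * a = 1 * a] (mod p)" by (rule cong_mult[OF fermat_theorem[OF prime ndvd] cong_refl])
  moreover have "a ^ (p - 1) * a = a ^ p" by (rule power_minus_mult) (rule prime_gt_0_nat[OF prime])
  ultimately have ap: "[a ^ p = a] (mod p)" by simp
  have "[a ^ (p ^ j) = a] (mod p)" for j
  proof (induction j)
    case (Suc j)
    have "a ^ (p ^ Suc j) = (a ^ (p ^ j)) ^ p" unfolding power_mult[symmetric] power_Suc2 ..
    then show ?case using cong_trans[OF cong_pow[OF Suc, of p] ap] by (simp only:)
  qed simp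
  then have 2: "[int (a ^ (p ^ k)) = int a] (mod (int p))" by (simp only: cong_int_iff)
  have e: "int (a ^ (p ^ k)) = \<mu> f [] ^ (p ^ k)" by (simp only: a of_nat_power)
  have 3: "[\<mu> f [] = int (a ^ (p ^ k))] (mod (int p))" unfolding a using 2 by (rule cong_sym)
  show ?thesis by (rule cong_trans[OF 3]) (simp only: e 1)
qed

text \<open>In a coefficient of a product with h at a word of length at most n only the two extreme
  factorisations survive, and they give the same sum for both orders. So h is central one length
  further than it is trivial.\<close>

lemma commute_mod_next:
  assumes "h \<in> carrier F" "a \<in> carrier F" "n > 0" "agree (short n) h \<one>"
  shows "agree (short (Suc n)) (h \<otimes> a) (a \<otimes> h)"
  unfolding agree_def
proof
  fix w assume "w \<in> short (Suc n)"
  then have w: "w \<in> lists X" "length w \<le> n" by (auto simp: short_def)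
  have h0: "[\<mu> h v = 0] (mod (int p))" if "v \<in> lists X" "length v < n" "v \<noteq> []" for v
    using assms(4) that one_S[of v] mu_one by (auto simp: agree_def short_def)
  have sub: "take i w \<in> lists X" "drop i w \<in> lists X" for i
    using w by (auto dest: in_set_takeD in_set_dropD)
  show "[\<mu> (h \<otimes> a) w = \<mu> (a \<otimes> h) w] (mod (int p))"
  proof (cases "w = []")
    case True
    then show ?thesis
      using cong_trans[OF mu_Nil[of "h \<otimes> a"] cong_sym[OF mu_Nil[of "a \<otimes> h"]]] assms by simp
  next
    case False
    then obtain m where m: "length w = Suc m" by (cases w) auto
    have ends: "(\<Sum>i\<le>Suc m. if i = 0 then c else if i = Suc m then d else 0) = c + d" for c d :: int
    proof -
      have "(\<Sum>i\<le>Suc m. if i = 0 then c else if i = Suc m then d else 0)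
          = (\<Sum>i\<le>Suc m. (if i = 0 then c else 0) + (if i = Suc m then d else 0))"
        by (intro sum.cong) auto
      then show ?thesis by (simp add: sum.distrib)
    qed
    have "[\<mu> (h \<otimes> a) w = (\<Sum>i\<le>Suc m. \<mu> h (take i w) * \<mu> a (drop i w))] (mod (int p))"
      using mu_mult[OF w(1) assms(1,2)] m by simp
    also have "[(\<Sum>i\<le>Suc m. \<mu> h (take i w) * \<mu> a (drop i w))
        = (\<Sum>i\<le>Suc m. if i = 0 then \<mu> a w else if i = Suc m then \<mu> h w else 0)] (mod (int p))"
    proof (rule cong_sum)
      fix i assume i: "i \<in> {..Suc m}"
      consider "i = 0" | "i = Suc m" | "0 < i" "i < Suc m" using i by fastforce
      then show "[\<mu> h (take i w) * \<mu> a (drop i w) = (if i = 0 then \<mu> a w else if i = Suc m then \<mu> h w else 0)] (mod (int p))"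
      proof cases
        case 1
        then show ?thesis using cong_mult[OF mu_Nil[OF assms(1)] cong_refl, of "\<mu> a w"] by simp
      next
        case 2
        then show ?thesis using cong_mult[OF cong_refl mu_Nil[OF assms(2)], of "\<mu> h w"] m by simp
      next
        case 3
        then have "[\<mu> h (take i w) = 0] (mod (int p))" using w m False by (intro h0 sub) auto
        from cong_mult[OF this cong_refl] 3 show ?thesis by simp
      qed
    qed
    finally have 1: "[\<mu> (h \<otimes> a) w = (\<Sum>i\<le>Suc m. if i = 0 then \<mu> a w else if i = Suc m then \<mu> h w else 0)] (mod (int p))" .
    have "[\<mu> (a \<otimes> h) w = (\<Sum>i\<le>Suc m. \<mu> a (take i w) * \<mu> h (drop i w))] (mod (int p))"
      using mu_mult[OF w(1) assms(2,1)] m by simp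
    also have "[(\<Sum>i\<le>Suc m. \<mu> a (take i w) * \<mu> h (drop i w))
        = (\<Sum>i\<le>Suc m. if i = 0 then \<mu> h w else if i = Suc m then \<mu> a w else 0)] (mod (int p))"
    proof (rule cong_sum)
      fix i assume i: "i \<in> {..Suc m}"
      consider "i = 0" | "i = Suc m" | "0 < i" "i < Suc m" using i by fastforce
      then show "[\<mu> a (take i w) * \<mu> h (drop i w) = (if i = 0 then \<mu> h w else if i = Suc m then \<mu> a w else 0)] (mod (int p))"
      proof cases
        case 1
        then show ?thesis using cong_mult[OF mu_Nil[OF assms(2)] cong_refl, of "\<mu> h w"] by simp
      next
        case 2
        then show ?thesis using cong_mult[OF cong_refl mu_Nil[OF assms(1)], of "\<mu> a w"] m by simp
      next
        case 3
        then have "[\<mu> h (drop i w) = 0] (mod (int p))" using w m False by (intro h0 sub) auto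
        from cong_mult[OF cong_refl this] 3 show ?thesis by simp
      qed
    qed
    also have "(\<Sum>i\<le>Suc m. if i = 0 then \<mu> h w else if i = Suc m then \<mu> a w else 0)
        = (\<Sum>i\<le>Suc m. if i = 0 then \<mu> a w else if i = Suc m then \<mu> h w else 0)"
      by (simp only: ends add.commute)
    finally have 2: "[\<mu> (a \<otimes> h) w = (\<Sum>i\<le>Suc m. if i = 0 then \<mu> a w else if i = Suc m then \<mu> h w else 0)] (mod (int p))" .
    from cong_trans[OF 1 cong_sym[OF 2]] show ?thesis .
  qed
qed

text \<open>The elements agreeing up to a given length with the generated subgroup form an open
  subgroup containing X, but \<open>open_normal_containing_basis\<close> also asks for normality.
  Induction on the length supplies it: by density one length earlier a conjugating element is g h,
  with g in the generated subgroup and h central at the current length.\<close>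

lemma generate_dense:
  assumes "f \<in> carrier F" shows "\<exists>g\<in>generate F X. agree (short n) f g"
proof -
  define A where "A n = {f \<in> carrier F. \<exists>g\<in>generate F X. agree (short n) f g}" for n
  have gc: "g \<in> carrier F" if "g \<in> generate F X" for g using generate_in_carrier[OF basis_subset that] .
  have agree_inv: "agree (short n) (inv f) (inv g)" if "f \<in> carrier F" "g \<in> carrier F" "agree (short n) f g" for f g n
  proof -
    have "agree (short n) (inv f \<otimes> g \<otimes> inv g) (inv f \<otimes> f \<otimes> inv g)"
      using that by (intro agree_mult agree_refl agree_sym[OF that(3)]) auto
    then show ?thesis using that by (simp add: m_assoc)
  qed
  have sub: "subgroup (A n) F" for n
  proof (rule subgroupI)
    show "A n \<noteq> {}" using generate.one[of F X] agree_refl by (auto simp: A_def)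
    show "inv a \<in> A n" if "a \<in> A n" for a
    proof -
      obtain g where g: "a \<in> carrier F" "g \<in> generate F X" "agree (short n) a g"
        using \<open>a \<in> A n\<close> unfolding A_def by blast
      have "agree (short n) (inv a) (inv g)" by (rule agree_inv[OF g(1) gc[OF g(2)] g(3)])
      moreover have "inv g \<in> generate F X" by (rule generate_m_inv_closed[OF basis_subset g(2)])
      ultimately show ?thesis unfolding A_def using g(1) by blast
    qed
    show "a \<otimes> b \<in> A n" if "a \<in> A n" "b \<in> A n" for a b
    proof -
      obtain g where g: "a \<in> carrier F" "g \<in> generate F X" "agree (short n) a g"
        using \<open>a \<in> A n\<close> unfolding A_def by blast
      obtain h where h: "b \<in> carrier F" "h \<in> generate F X" "agree (short n) b h"
        using \<open>b \<in> A n\<close> unfolding A_def by blast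
      have "agree (short n) (a \<otimes> b) (g \<otimes> h)"
        by (rule agree_mult[OF g(3) h(3) g(1) gc[OF g(2)] h(1) gc[OF h(2)]])
      moreover have "g \<otimes> h \<in> generate F X" using g(2) h(2) by (rule generate.eng)
      ultimately show ?thesis unfolding A_def using g(1) h(1) by blast
    qed
  qed (auto simp: A_def)
  have "A (Suc n) = carrier F" for n
  proof (induction n)
    case 0
    have "agree (short (Suc 0)) f \<one>" if "f \<in> carrier F" for f
      using cong_trans[OF mu_Nil[OF that] cong_sym[OF mu_Nil[OF one_closed]]] by (auto simp: agree_def short_def)
    then show ?case using generate.one[of F X] by (auto simp: A_def)
  next
    case (Suc n)
    show ?case
    proof (rule open_normal_containing_basis)
      show "X \<subseteq> A (Suc (Suc n))"
      proof
        fix x assume "x \<in> X"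
        then show "x \<in> A (Suc (Suc n))"
          using generate.incl[of x X F] basis_subset agree_refl unfolding A_def by blast
      qed
      show "openin T (A (Suc (Suc n)))"
      proof (rule open_saturated[OF finite_short[of "Suc (Suc n)"] short_lists])
        fix f g assume f: "f \<in> A (Suc (Suc n))" "g \<in> carrier F" "agree (short (Suc (Suc n))) f g"
        then obtain h where "h \<in> generate F X" "agree (short (Suc (Suc n))) f h" unfolding A_def by blast
        then show "g \<in> A (Suc (Suc n))"
          using agree_trans[OF agree_sym[OF f(3)], of h] f(2) unfolding A_def by blast
      qed (auto simp: A_def)
      show "A (Suc (Suc n)) \<lhd> F"
      proof (rule normal_invI[OF sub])
        fix x k assume x: "x \<in> carrier F" and k: "k \<in> A (Suc (Suc n))"
        have kc: "k \<in> carrier F" using k by (simp add: A_def)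
        have "x \<in> A (Suc n)" using Suc x by simp
        then obtain g where g: "g \<in> generate F X" "agree (short (Suc n)) x g" by (auto simp: A_def)
        have gc': "g \<in> carrier F" using gc g by auto
        define h where "h = inv g \<otimes> x"
        have hc: "h \<in> carrier F" and xh: "x = g \<otimes> h"
          using gc' x by (auto simp: h_def m_assoc[symmetric])
        have "agree (short (Suc n)) h (inv g \<otimes> g)"
          unfolding h_def using g gc' x by (intro agree_mult agree_refl) auto
        then have "agree (short (Suc n)) h \<one>" using gc' by simp
        from commute_mod_next[OF hc kc _ this]
        have "agree (short (Suc (Suc n))) (h \<otimes> k) (k \<otimes> h)" by simp
        then have "agree (short (Suc (Suc n))) (h \<otimes> k \<otimes> inv h) (k \<otimes> h \<otimes> inv h)"
          by (rule agree_mult[OF _ agree_refl]) (use hc kc in auto)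
        then have "agree (short (Suc (Suc n))) (h \<otimes> k \<otimes> inv h) k" using hc kc by (simp add: m_assoc)
        moreover obtain l where "l \<in> generate F X" "agree (short (Suc (Suc n))) k l"
          using k unfolding A_def by blast
        ultimately have "h \<otimes> k \<otimes> inv h \<in> A (Suc (Suc n))"
          using hc kc agree_trans[of _ "h \<otimes> k \<otimes> inv h" k l] unfolding A_def by blast
        moreover have "g \<in> A (Suc (Suc n))" using g(1) gc' agree_refl unfolding A_def by blast
        ultimately have "g \<otimes> (h \<otimes> k \<otimes> inv h) \<otimes> inv g \<in> A (Suc (Suc n))"
          using subgroup.m_closed[OF sub] subgroup.m_inv_closed[OF sub] by blast
        moreover have "g \<otimes> (h \<otimes> k \<otimes> inv h) \<otimes> inv g = x \<otimes> k \<otimes> inv x"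
          using gc' hc kc by (simp add: xh inv_mult_group m_assoc)
        ultimately show "x \<otimes> k \<otimes> inv x \<in> A (Suc (Suc n))" by simp
      qed
    qed
  qed
  then have "f \<in> A (Suc n)" using assms by simp
  then obtain g where "g \<in> generate F X" "agree (short (Suc n)) f g" unfolding A_def by blast
  moreover have "short n \<subseteq> short (Suc n)" by (auto simp: short_def)
  ultimately show ?thesis unfolding agree_def by blast
qed

lemma magnus_coefficients:
  assumes "\<And>x. x \<in> X \<Longrightarrow> D x > 0"
  shows "magnus_coefficients F p X D (\<lambda>w f. \<mu> f w)"
proof (intro magnus_coefficients.intro magnus_coefficients_axioms.intro)
  show "[\<mu> \<one> w = of_bool (w = [])] (mod (int p))" if "w \<in> lists X" for w
    using mu_one one_S[OF that] by simp
  show "\<exists>g\<in>generate F X. \<forall>w\<in>lists X. length w < n \<longrightarrow> [\<mu> f w = \<mu> g w] (mod (int p))"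
    if f: "f \<in> carrier F" for f n
    using generate_dense[OF f, of n] unfolding agree_def short_def by blast
qed (fact group_axioms prime finite_basis basis_subset mu_mult mu_gen mu_Nil assms)+

text \<open>The sets of elements outside U agreeing with f up to length n are closed and decreasing.
  Were all nonempty, compactness would give a common element, equal to f by injectivity of \<mu>. So
  U contains a truncation neighbourhood of f, and \<open>generate_dense\<close> applies.\<close>

lemma open_meets_generate:
  assumes U: "openin T U" "f \<in> U"
  shows "\<exists>g\<in>generate F X. g \<in> U"
proof -
  have f: "f \<in> carrier F" using openin_subset[OF U(1)] U(2) topspace_eq by auto
  define C where "C n = (carrier F - U) \<inter> {g \<in> carrier F. agree (short n) f g}" for n
  have "\<exists>n. C n = {}"
  proof (rule ccontr)
    assume "\<not> ?thesis"
    then have ne: "C n \<noteq> {}" for n by blast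
    have clo: "closedin T (C n)" for n unfolding C_def
    proof (rule closedin_Int)
      show "closedin T (carrier F - U)" using U(1) topspace_eq by (metis openin_closedin_eq)
      show "closedin T {g \<in> carrier F. agree (short n) f g}"
        by (rule closed_saturated[OF finite_short[of n] short_lists]) (auto intro: agree_trans)
    qed
    have dec: "decseq C"
      unfolding decseq_def C_def agree_def short_def by auto
    have "(\<Inter>n. C n) \<noteq> {}" by (rule compact_space_imp_nest[OF compact clo ne dec])
    then obtain g where g: "\<And>n. g \<in> C n" by blast
    have gc: "g \<in> carrier F" "g \<notin> U" using g[of 0] by (auto simp: C_def)
    have "\<mu> f w = \<mu> g w" if w: "w \<in> lists X" for w
    proof -
      have "[\<mu> f w = \<mu> g w] (mod (int p))"
        using g[of "Suc (length w)"] w unfolding C_def agree_def short_def by blast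
      then show ?thesis using mu_mod[OF f w] mu_mod[OF gc(1) w] by (simp add: Cong.cong_def)
    qed
    moreover have "\<mu> f \<in> extensional (lists X)" "\<mu> g \<in> extensional (lists X)"
      using mu_carrier[OF f] mu_carrier[OF gc(1)] unfolding carrier_S PiE_def by auto
    ultimately have "\<mu> f = \<mu> g" by (intro extensionalityI)
    then have "f = g" using magnus f gc(1) by (auto simp: magnus_embedding_def dest: inj_onD)
    then show False using U gc by simp
  qed
  then obtain n where n: "C n = {}" by blast
  obtain g where g: "g \<in> generate F X" "agree (short n) f g" using generate_dense[OF f] by blast
  then have "g \<in> carrier F" using generate_in_carrier[OF basis_subset] by blast
  then have "g \<in> U" using n g unfolding C_def by blast
  then show ?thesis using g by blast
qed

text \<open>A subgroup of index \<open>m\<close> is determined by the action of the basis on a numbering of its cosets,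
  the basis generating a dense subgroup.\<close>

lemma finite_open_subgroups: "finite {H. subgroup H F \<and> openin T H \<and> card (rcosets H) = m}"
proof -
  let ?S = "{H. subgroup H F \<and> openin T H \<and> card (rcosets H) = m}"
  define b where "b H = (SOME h. bij_betw h {0..<m} (rcosets H))" for H
  have b: "bij_betw (b H) {0..<m} (rcosets H)" if "H \<in> ?S" for H
  proof -
    have "finite (rcosets H)" "card (rcosets H) = m" using that finite_cosets by auto
    then have "\<exists>h. bij_betw h {0..<m} (rcosets H)" using ex_bij_betw_nat_finite by metis
    then show ?thesis unfolding b_def by (rule someI_ex)
  qed
  \<comment> \<open>The first component is the Schreier graph of the basis on the numbered cosets,
    the second its base point.\<close>
  define data where "data H =
    ({(x, i, j). x \<in> X \<and> i < m \<and> j < m \<and> b H i #> x = b H j}, {i. i < m \<and> b H i = H})" for H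
  have mem: "(x, i, j) \<in> fst (data L) \<longleftrightarrow> x \<in> X \<and> i < m \<and> j < m \<and> b L i #> x = b L j"
    for x i j L by (simp add: data_def)
  have "finite (data ` ?S)"
  proof (rule finite_subset)
    show "data ` ?S \<subseteq> Pow (X \<times> {0..<m} \<times> {0..<m}) \<times> Pow {0..<m}" by (auto simp: data_def)
    show "finite (Pow (X \<times> {0..<m} \<times> {0..<m}) \<times> Pow {0..<m})" using finite_basis by simp
  qed
  moreover have "inj_on data ?S"
  proof (rule inj_onI)
    have cos: "b H i \<in> rcosets H" "b H i \<subseteq> carrier F" if "H \<in> ?S" "i < m" for H i
    proof -
      show r: "b H i \<in> rcosets H" using bij_betwE[OF b[OF that(1)]] that(2) by simp
      have "H \<subseteq> carrier F" using that(1) subgroup.subset by blast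
      then show "b H i \<subseteq> carrier F" using r r_coset_subset_G unfolding rcosets_eq_image by blast
    qed
    have shift: "\<exists>k<m. b H i #> g = b H k" if H: "H \<in> ?S" "i < m" and g: "g \<in> carrier F" for H i g
    proof -
      obtain a where a: "a \<in> carrier F" "b H i = H #> a" using cos(1)[OF H] by (auto simp: RCOSETS_def)
      have "H \<subseteq> carrier F" using H(1) subgroup.subset by auto
      then have "b H i #> g = H #> (a \<otimes> g)" using a g by (simp add: coset_mult_assoc)
      then have "b H i #> g \<in> b H ` {0..<m}"
        unfolding bij_betw_imp_surj_on[OF b[OF H(1)]] rcosets_eq_image using a g by blast
      then show ?thesis by auto
    qed
    have inj: "b H i = b H j \<longleftrightarrow> i = j" if "H \<in> ?S" "i < m" "j < m" for H i j
      using inj_onD[OF bij_betw_imp_inj_on[OF b[OF that(1)]], of i j] that(2,3) by auto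
    have sub: "H \<subseteq> K" if H: "H \<in> ?S" and K: "K \<in> ?S" and eq: "data H = data K" for H K
    proof -
      \<comment> \<open>The graph over X determines the action of the whole generated subgroup;
        inverses of generators reverse the edges.\<close>
      have act: "b H i #> g = b H j \<longleftrightarrow> b K i #> g = b K j" if g: "g \<in> generate F X" "i < m" "j < m" for g i j
        using g
      proof (induction g arbitrary: i j)
        case one
        have e: "b L i #> \<one> = b L i" if "L \<in> ?S" for L by (rule coset_mult_one[OF cos(2)[OF that one(1)]])
        show ?case unfolding e[OF H] e[OF K] inj[OF H one] inj[OF K one] ..
      next
        case (incl x)
        have "(x, i, j) \<in> fst (data H) \<longleftrightarrow> (x, i, j) \<in> fst (data K)" by (simp only: eq)
        then show ?case unfolding mem using incl by blast
      next
        case (inv x)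
        have x: "x \<in> carrier F" using inv basis_subset by auto
        have flip: "b L i #> inv x = b L j \<longleftrightarrow> b L j #> x = b L i" if L: "L \<in> ?S" for L
        proof -
          have c: "M #> inv x #> x = M" "M #> x #> inv x = M" if M: "M \<subseteq> carrier F" for M
            using coset_mult_assoc[OF M inv_closed[OF x] x] coset_mult_assoc[OF M x inv_closed[OF x]]
            by (simp_all only: l_inv[OF x] r_inv[OF x] coset_mult_one[OF M])
          show ?thesis
            using c(1)[OF cos(2)[OF L inv(2)]] c(2)[OF cos(2)[OF L inv(3)]] by metis
        qed
        have "(x, j, i) \<in> fst (data H) \<longleftrightarrow> (x, j, i) \<in> fst (data K)" by (simp only: eq)
        then show ?case unfolding mem flip[OF H] flip[OF K] using inv by blast
      next
        case (eng g h)
        have gh: "g \<in> carrier F" "h \<in> carrier F" using generate_in_carrier[OF basis_subset] eng by auto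
        have comp: "b L i #> (g \<otimes> h) = b L j \<longleftrightarrow> (\<exists>k<m. b L i #> g = b L k \<and> b L k #> h = b L j)" if L: "L \<in> ?S" for L
        proof -
          obtain k where k: "k < m" "b L i #> g = b L k" using shift[OF L eng.prems(1) gh(1)] by blast
          have e: "b L i #> (g \<otimes> h) = b L k #> h"
            using coset_mult_assoc[OF cos(2)[OF L eng.prems(1)] gh] by (simp only: k(2))
          show ?thesis unfolding e
          proof
            assume "b L k #> h = b L j"
            then show "\<exists>k<m. b L i #> g = b L k \<and> b L k #> h = b L j" using k by blast
          next
            assume "\<exists>k<m. b L i #> g = b L k \<and> b L k #> h = b L j"
            then obtain l where "l < m" "b L i #> g = b L l" "b L l #> h = b L j" by blast
            then show "b L k #> h = b L j" unfolding k(2) by (simp only:)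
          qed
        qed
        have "b H i #> g = b H k \<and> b H k #> h = b H j \<longleftrightarrow> b K i #> g = b K k \<and> b K k #> h = b K j"
          if "k < m" for k
          using eng.IH(1)[OF eng.prems(1) that] eng.IH(2)[OF that eng.prems(2)] by blast
        then show ?case unfolding comp[OF H] comp[OF K] by blast
      qed
      have base: "b H i = H \<longleftrightarrow> b K i = K" if "i < m" for i
      proof -
        have "i \<in> snd (data H) \<longleftrightarrow> i \<in> snd (data K)" using eq by simp
        then show ?thesis using that by (simp add: data_def)
      qed
      have HS: "subgroup H F" "openin T H" and KS: "subgroup K F" "openin T K" using H K by auto
      have "H \<in> b H ` {0..<m}" unfolding bij_betw_imp_surj_on[OF b[OF H]]
        by (rule subgroup.subgroup_in_rcosets[OF HS(1) is_group])
      then obtain i where i: "i < m" "b H i = H" by auto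
      have iK: "b K i = K" using base i by simp
      show "H \<subseteq> K"
      proof
        fix f assume f: "f \<in> H"
        have fc: "f \<in> carrier F" using f subgroup.mem_carrier[OF HS(1)] by simp
        \<comment> \<open>f need not lie in the generated subgroup, but this open set contains an
          element g that does; g in K then gives f in K.\<close>
        have "openin T (H \<inter> (K #> f))" using HS(2) openin_rcos[OF KS(2) fc] by (rule openin_Int)
        moreover have "f \<in> H \<inter> (K #> f)" using f rcos_self[OF fc KS(1)] by simp
        ultimately obtain g where g: "g \<in> generate F X" "g \<in> H" "g \<in> K #> f"
          using open_meets_generate by blast
        have gc: "g \<in> carrier F" using g subgroup.mem_carrier[OF HS(1)] by simp
        have "b H i #> g = b H i" using coset_join2[OF gc HS(1) g(2)] i by simp
        then have "b K i #> g = b K i" using act[OF g(1) i(1) i(1)] by simp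
        then have gK: "g \<in> K" using coset_join1[OF _ gc KS(1)] iK by simp
        obtain k where k: "k \<in> K" "g = k \<otimes> f" using g(3) by (auto simp: r_coset_def)
        have kc: "k \<in> carrier F" using k subgroup.mem_carrier[OF KS(1)] by simp
        have "f = inv k \<otimes> g" using k(2) kc fc by (simp add: m_assoc[symmetric])
        then show "f \<in> K" using subgroup.m_closed[OF KS(1) subgroup.m_inv_closed[OF KS(1) k(1)] gK] by simp
      qed
    qed
    fix H K assume "H \<in> ?S" "K \<in> ?S" "data H = data K"
    then show "H = K" using sub[of H K] sub[of K H] by simp
  qed
  ultimately show ?thesis using finite_imageD by blast
qed

section \<open>Monomials and degree functions on power series\<close>

abbreviation monom :: "continuum list \<Rightarrow> continuum list \<Rightarrow> int" where
  "monom \<equiv> nc_monom (residue_ring (int p)) X"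

lemma monom_Cons:
  assumes "x \<in> X" "w \<in> lists X"
  shows "monom (x # w) = monom [x] \<otimes>\<^bsub>S\<^esub> monom w"
proof -
  have p1: "1 mod int p = 1" using prime_gt_1_nat[OF prime] by simp
  have "monom (x # w) v = (monom [x] \<otimes>\<^bsub>S\<^esub> monom w) v" if v: "v \<in> lists X" for v
  proof -
    have sub: "take i v \<in> lists X" "drop i v \<in> lists X" for i
      using v by (auto dest: in_set_takeD in_set_dropD)
    have "(monom [x] \<otimes>\<^bsub>S\<^esub> monom w) v = (\<Sum>i\<le>length v. monom [x] (take i v) * monom w (drop i v)) mod int p"
      by (rule mult_S[OF monom_carrier monom_carrier v])
    also have "(\<Sum>i\<le>length v. monom [x] (take i v) * monom w (drop i v))
        = (\<Sum>i\<le>length v. if i = 1 then of_bool (v = x # w) else 0)"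
    proof (rule sum.cong[OF refl])
      fix i assume "i \<in> {..length v}"
      then have i: "i \<le> length v" by simp
      have "take i v = [x] \<and> drop i v = w \<longleftrightarrow> i = 1 \<and> v = x # w"
      proof
        assume a: "take i v = [x] \<and> drop i v = w"
        have "v = take i v @ drop i v" by simp
        then have "v = x # w" using a by simp
        moreover have "i = 1"
        proof -
          have "i = length (take i v)" using i by simp
          also have "\<dots> = 1" unfolding conjunct1[OF a] by simp
          finally show ?thesis .
        qed
        ultimately show "i = 1 \<and> v = x # w" by blast
      qed auto
      then show "monom [x] (take i v) * monom w (drop i v) = (if i = 1 then of_bool (v = x # w) else 0)"
        unfolding monom_S[OF sub(1)] monom_S[OF sub(2)] by auto
    qed
    also have "\<dots> = (if 1 \<le> length v then of_bool (v = x # w) else 0)" by (simp add: sum.delta)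
    also have "\<dots> = of_bool (v = x # w)" by (cases "v = x # w") simp_all
    finally have e: "(monom [x] \<otimes>\<^bsub>S\<^esub> monom w) v = of_bool (v = x # w) mod int p" .
    show ?thesis unfolding e monom_S[OF v] using p1 by (cases "v = x # w") simp_all
  qed
  moreover have "monom (x # w) \<in> extensional (lists X)" by (simp add: nc_monom_def)
  moreover have "monom [x] \<otimes>\<^bsub>S\<^esub> monom w \<in> extensional (lists X)"
    by (simp add: nc_power_series_def)
  ultimately show ?thesis by (intro extensionalityI)
qed

context
  fixes d :: "(continuum list \<Rightarrow> int) \<Rightarrow> enat"
  assumes d: "series_degree_function p X d"
begin

lemmas degree_axioms = d[unfolded series_degree_function_def Let_def]

lemma degree_infinite_iff: "f \<in> carrier S \<Longrightarrow> d f = \<infinity> \<longleftrightarrow> f = \<zero>\<^bsub>S\<^esub>"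
  by (rule bspec[OF conjunct1[OF degree_axioms]])

lemma degree_zero_iff: "f \<in> carrier S \<Longrightarrow> d f = 0 \<longleftrightarrow> f \<in> Units S"
  by (rule bspec[OF conjunct1[OF conjunct2[OF degree_axioms]]])

lemma degree_mult: "f \<in> carrier S \<Longrightarrow> g \<in> carrier S \<Longrightarrow> d (f \<otimes>\<^bsub>S\<^esub> g) = d f + d g"
  by (rule bspec[OF bspec[OF conjunct1[OF conjunct2[OF conjunct2[OF degree_axioms]]]]])

lemma degree_INF: "f \<in> carrier S \<Longrightarrow>
    d f = (INF w\<in>{w \<in> lists X. f w \<noteq> \<zero>\<^bsub>residue_ring (int p)\<^esub>}. d (monom w))"
  by (rule bspec[OF conjunct2[OF conjunct2[OF conjunct2[OF degree_axioms]]]])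

lemma degree_gen: assumes "x \<in> X" shows "d (monom [x]) \<noteq> \<infinity>" "d (monom [x]) \<noteq> 0"
proof -
  interpret S: ring S by (rule ring_S)
  have x: "[x] \<in> lists X" using assms by simp
  have "monom [x] \<noteq> \<zero>\<^bsub>S\<^esub>" using monom_S[OF x, of "[x]"] zero_S[OF x] by auto
  then show "d (monom [x]) \<noteq> \<infinity>" using degree_infinite_iff[OF monom_carrier] by simp
  have "monom [x] \<notin> Units S"
  proof
    assume "monom [x] \<in> Units S"
    then obtain u where u: "u \<in> carrier S" "monom [x] \<otimes>\<^bsub>S\<^esub> u = \<one>\<^bsub>S\<^esub>" by (auto simp: Units_def)
    have N: "[] \<in> lists X" by simp
    have "(monom [x] \<otimes>\<^bsub>S\<^esub> u) [] = 0"
      using mult_S[OF monom_carrier u(1) N, of "[x]"] monom_S[OF N, of "[x]"] by simp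
    then show False using u(2) one_S[OF N] by simp
  qed
  then show "d (monom [x]) \<noteq> 0" using degree_zero_iff[OF monom_carrier] by simp
qed

text \<open>Multiplicativity reduces d on monomials to its values at the u_x; these become the
  weights D in the abstract part.\<close>

lemma degree_monom:
  assumes "w \<in> lists X"
  shows "d (monom w) = enat (sum_list (map (\<lambda>x. the_enat (d (monom [x]))) w))"
proof -
  interpret S: ring S by (rule ring_S)
  have "set w \<subseteq> X" using assms by auto
  then show ?thesis
  proof (induction w)
    case Nil
    have "monom [] = \<one>\<^bsub>S\<^esub>" by (simp add: nc_monom_def nc_power_series_def)
    then have "d (monom []) = 0" using degree_zero_iff[OF S.one_closed] by simp
    then show ?case by (simp add: zero_enat_def)
  next
    case (Cons x w)
    have "d (monom (x # w)) = d (monom [x]) + d (monom w)"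
    proof -
      have "x \<in> X" "w \<in> lists X" using Cons.prems by auto
      then show ?thesis unfolding monom_Cons[OF \<open>x \<in> X\<close> \<open>w \<in> lists X\<close>]
        by (intro degree_mult monom_carrier)
    qed
    moreover obtain k where "d (monom [x]) = enat k"
      using degree_gen(1)[of x] Cons.prems by (cases "d (monom [x])") auto
    moreover have "d (monom w) = enat (sum_list (map (\<lambda>x. the_enat (d (monom [x]))) w))"
      using Cons by simp
    ultimately show ?case by simp
  qed
qed

lemma mu_minus_one:
  assumes "f \<in> carrier F" "w \<in> lists X" "w \<noteq> []"
  shows "(\<mu> f \<ominus>\<^bsub>S\<^esub> \<one>\<^bsub>S\<^esub>) w = \<mu> f w"
proof -
  interpret S: ring S by (rule ring_S)
  let ?g = "\<ominus>\<^bsub>S\<^esub> \<one>\<^bsub>S\<^esub>"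
  have gc: "?g \<in> carrier S" by simp
  then have gw: "?g w \<in> {0..int p - 1}" using assms(2) by (auto simp only: carrier_S PiE_iff)
  have "(\<one>\<^bsub>S\<^esub> \<oplus>\<^bsub>S\<^esub> ?g) w = 0" using S.r_neg[OF S.one_closed] zero_S[OF assms(2)] by simp
  then have "?g w mod int p = 0" using add_S[OF assms(2), of "\<one>\<^bsub>S\<^esub>" ?g] one_S[OF assms(2)] assms(3) by simp
  then have "?g w = 0" using gw by simp
  then show ?thesis
    unfolding a_minus_def using add_S[OF assms(2), of "\<mu> f" ?g] mu_mod[OF assms(1,2)] by simp
qed

text \<open>d is the infimum over the monomials that occur, so no monomial of smaller degree occurs.
  The empty word is excluded because subtracting 1 alters exactly that coefficient.\<close>

lemma degree_relator:
  assumes "f \<in> carrier F" "w \<in> lists X" "w \<noteq> []"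
    "enat (sum_list (map (\<lambda>x. the_enat (d (monom [x]))) w)) < d (\<mu> f \<ominus>\<^bsub>S\<^esub> \<one>\<^bsub>S\<^esub>)"
  shows "\<mu> f w = 0"
proof (rule ccontr)
  interpret S: ring S by (rule ring_S)
  assume nz: "\<mu> f w \<noteq> 0"
  have c: "\<mu> f \<ominus>\<^bsub>S\<^esub> \<one>\<^bsub>S\<^esub> \<in> carrier S" using mu_carrier[OF assms(1)] by simp
  let ?W = "{w \<in> lists X. (\<mu> f \<ominus>\<^bsub>S\<^esub> \<one>\<^bsub>S\<^esub>) w \<noteq> \<zero>\<^bsub>residue_ring (int p)\<^esub>}"
  have "d (\<mu> f \<ominus>\<^bsub>S\<^esub> \<one>\<^bsub>S\<^esub>) = (INF w\<in>?W. d (monom w))"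
    by (rule degree_INF[OF c])
  moreover have "w \<in> ?W"
    unfolding mem_Collect_eq mu_minus_one[OF assms(1-3)] residues.res_zero_eq[OF residues]
    using assms(2) nz by blast
  then have "(INF w\<in>?W. d (monom w)) \<le> d (monom w)" by (rule INF_lower)
  ultimately have "d (\<mu> f \<ominus>\<^bsub>S\<^esub> \<one>\<^bsub>S\<^esub>) \<le> d (monom w)" by (simp only:)
  then show False using assms(4) degree_monom[OF assms(2)] by simp
qed

lemma degree_generator: assumes "x \<in> X" shows "\<mu> x \<ominus>\<^bsub>S\<^esub> \<one>\<^bsub>S\<^esub> = monom [x]"
proof -
  interpret S: ring S by (rule ring_S)
  have "\<mu> x = \<one>\<^bsub>S\<^esub> \<oplus>\<^bsub>S\<^esub> monom [x]" using magnus assms by (simp add: magnus_embedding_def)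
  then show ?thesis
    using monom_carrier[of "[x]"] by (simp add: a_minus_def S.a_ac S.r_neg2 S.r_neg1) (simp add: S.a_assoc[symmetric] S.r_neg S.a_comm)
qed

text \<open>The series f - 1 is zero and \<mu> is injective. This allows relators of infinite degree
  to be dropped.\<close>

lemma degree_infinite: assumes "f \<in> carrier F" "d (\<mu> f \<ominus>\<^bsub>S\<^esub> \<one>\<^bsub>S\<^esub>) = \<infinity>" shows "f = \<one>"
proof -
  interpret S: ring S by (rule ring_S)
  have "\<mu> f \<ominus>\<^bsub>S\<^esub> \<one>\<^bsub>S\<^esub> = \<zero>\<^bsub>S\<^esub>"
    using degree_infinite_iff[of "\<mu> f \<ominus>\<^bsub>S\<^esub> \<one>\<^bsub>S\<^esub>"] assms(2) mu_carrier[OF assms(1)] by simp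
  then have "\<mu> f = \<mu> \<one>" using S.r_right_minus_eq[of "\<mu> f" "\<one>\<^bsub>S\<^esub>"] mu_carrier[OF assms(1)] mu_one by simp
  then show ?thesis using magnus assms(1) by (auto simp: magnus_embedding_def dest: inj_onD)
qed

end

end

section \<open>Open subgroups of the presented group\<close>

lemma (in topological_group) closed_normal_closure_normal:
  assumes "R \<subseteq> carrier G" shows "closed_normal_closure G T R \<lhd> G"
proof -
  let ?N = "{N. N \<lhd> G \<and> closedin T N \<and> R \<subseteq> N}"
  have "carrier G \<lhd> G" by (rule normal_invI[OF subgroup_self]) simp
  moreover have "closedin T (carrier G)" unfolding topspace_eq[symmetric] by (rule closedin_topspace)
  ultimately have "carrier G \<in> ?N" using assms by blast
  then have ne: "?N \<noteq> {}" by blast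
  have "\<Inter>?N \<lhd> G"
  proof (rule normal_invI)
    show "subgroup (\<Inter>?N) G"
      by (rule subgroups_Inter[OF _ ne]) (use normal_imp_subgroup in blast)
    fix x h assume x: "x \<in> carrier G" and h: "h \<in> \<Inter>?N"
    show "x \<otimes> h \<otimes> inv x \<in> \<Inter>?N"
    proof
      fix M assume M: "M \<in> ?N"
      then have "h \<in> M" using h by blast
      then show "x \<otimes> h \<otimes> inv x \<in> M" using normal.inv_op_closed2[of M G x h] M x by blast
    qed
  qed
  then show ?thesis by (simp add: closed_normal_closure_def)
qed

text \<open>Taking preimages in F preserves openness and index and is injective. It first shows the
  set counted for G to be finite, which matters because \<open>card\<close> of an infinite set is 0;
  then \<K> injects into that set by taking images, since its members contain the kernel.\<close>

lemma presented_num_open_subgroups: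
  fixes F :: "'a monoid" and G :: "'g monoid"
  assumes F: "topological_group F T" and G: "group G" and R: "R \<subseteq> carrier F"
    and pres: "presented_by G T\<^sub>G F T R"
    and fin: "finite {H. subgroup H F \<and> openin T H \<and> card (rcosets\<^bsub>F\<^esub> H) = m}"
    and K: "\<And>H. H \<in> \<K> \<Longrightarrow> subgroup H F \<and> openin T H \<and> card (rcosets\<^bsub>F\<^esub> H) = m \<and> closed_normal_closure F T R \<subseteq> H"
  shows "card \<K> \<le> num_open_subgroups G T\<^sub>G m"
proof -
  interpret F: topological_group F T by (rule F)
  interpret G: group G by (rule G)
  define N where "N = closed_normal_closure F T R"
  have "N \<lhd> F" unfolding N_def by (rule F.closed_normal_closure_normal[OF R])
  then interpret N: normal N F .
  obtain \<phi> where \<phi>: "\<phi> \<in> iso (F Mod N) G" "homeomorphic_map (coset_topology F T N) T\<^sub>G \<phi>"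
    using pres by (auto simp: presented_by_def Let_def N_def)
  define q where "q f = \<phi> (N #>\<^bsub>F\<^esub> f)" for f
  have \<phi>b: "bij_betw \<phi> (carrier (F Mod N)) (carrier G)" and \<phi>h: "\<phi> \<in> hom (F Mod N) G"
    using \<phi>(1) by (auto simp: iso_def)
  have qc: "q f \<in> carrier G" if "f \<in> carrier F" for f
    using bij_betwE[OF \<phi>b] that by (auto simp: q_def carrier_FactGroup)
  have qm: "q (f \<otimes>\<^bsub>F\<^esub> g) = q f \<otimes>\<^bsub>G\<^esub> q g" if "f \<in> carrier F" "g \<in> carrier F" for f g
    using hom_mult[OF \<phi>h, of "N #>\<^bsub>F\<^esub> f" "N #>\<^bsub>F\<^esub> g"] that
    by (auto simp: q_def carrier_FactGroup N.rcos_sum)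
  interpret q: group_hom F G q by unfold_locales (auto simp: hom_def qc qm)
  have qs: "q ` carrier F = carrier G"
    using bij_betw_imp_surj_on[OF \<phi>b] by (simp add: q_def carrier_FactGroup image_image)
  have cF: "N #>\<^bsub>F\<^esub> f \<in> carrier (F Mod N)" if "f \<in> carrier F" for f
    unfolding carrier_FactGroup using that by blast
  have qk: "f \<otimes>\<^bsub>F\<^esub> inv\<^bsub>F\<^esub> g \<in> N" if f: "f \<in> carrier F" and g: "g \<in> carrier F" and "q f = q g" for f g
  proof -
    have "\<phi> (N #>\<^bsub>F\<^esub> f) = \<phi> (N #>\<^bsub>F\<^esub> g)" using \<open>q f = q g\<close> unfolding q_def .
    from inj_onD[OF bij_betw_imp_inj_on[OF \<phi>b] this cF[OF f] cF[OF g]]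
    show ?thesis unfolding F.rcos_eq_iff[OF N.subgroup_axioms f g] .
  qed
  define P where "P H = {f \<in> carrier F. q f \<in> H}" for H
  have ts: "topspace (coset_topology F T N) = carrier (F Mod N)"
  proof
    have "{x \<in> carrier F. N #>\<^bsub>F\<^esub> x \<in> carrier (F Mod N)} = carrier F" by (auto simp: carrier_FactGroup)
    then have "openin (coset_topology F T N) (carrier (F Mod N))"
      using openin_topspace[of T] F.topspace_eq by (simp add: openin_coset_topology)
    then show "carrier (F Mod N) \<subseteq> topspace (coset_topology F T N)" by (rule openin_subset)
    show "topspace (coset_topology F T N) \<subseteq> carrier (F Mod N)"
      using openin_topspace[of "coset_topology F T N"] unfolding openin_coset_topology by blast
  qed
  have op: "openin T\<^sub>G H \<longleftrightarrow> openin T (P H)" if "H \<subseteq> carrier G" for H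
  proof -
    define U where "U = {c \<in> carrier (F Mod N). \<phi> c \<in> H}"
    have "\<phi> ` U = H" using that bij_betw_imp_surj_on[OF \<phi>b] by (auto simp: U_def)
    then have "openin T\<^sub>G H \<longleftrightarrow> openin (coset_topology F T N) U"
      using homeomorphic_map_openness[OF \<phi>(2), of U] ts by (auto simp: U_def)
    also have "\<dots> \<longleftrightarrow> openin T {x \<in> carrier F. N #>\<^bsub>F\<^esub> x \<in> U}"
      unfolding openin_coset_topology by (auto simp: U_def)
    also have "{x \<in> carrier F. N #>\<^bsub>F\<^esub> x \<in> U} = P H"
      by (auto simp: U_def P_def q_def carrier_FactGroup)
    finally show ?thesis .
  qed
  have Psub: "subgroup (P H) F" if "subgroup H G" for H
    by (rule F.subgroupI)
      (use that in \<open>auto simp: P_def subgroup.m_closed subgroup.m_inv_closed subgroup.one_closed intro!: exI[of _ "\<one>\<^bsub>F\<^esub>"]\<close>)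
  have idx: "card (rcosets\<^bsub>F\<^esub> (P H)) = card (rcosets\<^bsub>G\<^esub> H)" if "subgroup H G" for H
  proof -
    have "card ((\<lambda>f. P H #>\<^bsub>F\<^esub> f) ` carrier F) = card ((\<lambda>f. H #>\<^bsub>G\<^esub> q f) ` carrier F)"
    proof (rule card_image_eq_of_kernel)
      fix x y assume xy: "x \<in> carrier F" "y \<in> carrier F"
      show "(H #>\<^bsub>G\<^esub> q x = H #>\<^bsub>G\<^esub> q y) = (P H #>\<^bsub>F\<^esub> x = P H #>\<^bsub>F\<^esub> y)"
        unfolding F.rcos_eq_iff[OF Psub[OF that] xy] G.rcos_eq_iff[OF that qc[OF xy(1)] qc[OF xy(2)]]
        using xy by (simp add: P_def)
    qed
    then show ?thesis unfolding rcosets_eq_image qs[symmetric] image_image .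
  qed
  let ?G = "{H. subgroup H G \<and> openin T\<^sub>G H \<and> card (rcosets\<^bsub>G\<^esub> H) = m}"
  have "P ` ?G \<subseteq> {H. subgroup H F \<and> openin T H \<and> card (rcosets\<^bsub>F\<^esub> H) = m}"
  proof (rule image_subsetI)
    fix H assume "H \<in> ?G"
    then have H: "subgroup H G" "openin T\<^sub>G H" "card (rcosets\<^bsub>G\<^esub> H) = m" by auto
    have "openin T (P H)" using op[OF subgroup.subset[OF H(1)]] H(2) by blast
    then show "P H \<in> {H. subgroup H F \<and> openin T H \<and> card (rcosets\<^bsub>F\<^esub> H) = m}"
      using Psub[OF H(1)] idx[OF H(1)] H(3) by simp
  qed
  then have "finite (P ` ?G)" using fin by (rule finite_subset)
  moreover have "inj_on P ?G"
  proof (rule inj_onI)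
    fix H H' assume a: "H \<in> ?G" "H' \<in> ?G" "P H = P H'"
    have "q ` P L = L" if "L \<in> ?G" for L
    proof -
      have "L \<subseteq> carrier G" using that subgroup.subset by blast
      then show ?thesis unfolding P_def qs[symmetric] by blast
    qed
    from this[OF a(1)] this[OF a(2)] show "H = H'" unfolding a(3) by simp
  qed
  ultimately have finG: "finite ?G" by (rule finite_imageD)
  have Pq: "P (q ` H) = H" if "H \<in> \<K>" for H
  proof
    have H: "subgroup H F" "N \<subseteq> H" using K[OF that] N_def by auto
    show "H \<subseteq> P (q ` H)" using subgroup.subset[OF H(1)] by (auto simp: P_def)
    show "P (q ` H) \<subseteq> H"
    proof
      fix f assume "f \<in> P (q ` H)"
      then obtain h where h: "f \<in> carrier F" "h \<in> H" "q f = q h" by (auto simp: P_def)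
      have hc: "h \<in> carrier F" using subgroup.mem_carrier[OF H(1) h(2)] .
      have "f \<otimes>\<^bsub>F\<^esub> inv\<^bsub>F\<^esub> h \<in> H" using qk[OF h(1) hc h(3)] H(2) by auto
      then have "f \<otimes>\<^bsub>F\<^esub> inv\<^bsub>F\<^esub> h \<otimes>\<^bsub>F\<^esub> h \<in> H" using subgroup.m_closed[OF H(1) _ h(2)] by blast
      then show "f \<in> H" using h(1) hc by (simp add: F.m_assoc)
    qed
  qed
  have "(\<lambda>H. q ` H) ` \<K> \<subseteq> ?G"
  proof (rule image_subsetI)
    fix H assume H: "H \<in> \<K>"
    then have s: "subgroup (q ` H) G" using q.subgroup_img_is_subgroup K by blast
    then have "openin T\<^sub>G (q ` H)" using op[OF subgroup.subset[OF s]] Pq[OF H] K[OF H] by simp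
    moreover have "card (rcosets\<^bsub>G\<^esub> (q ` H)) = m" using idx[OF s] Pq[OF H] K[OF H] by simp
    ultimately show "q ` H \<in> ?G" using s by blast
  qed
  moreover have "inj_on (\<lambda>H. q ` H) \<K>"
  proof (rule inj_onI)
    fix H H' assume a: "H \<in> \<K>" "H' \<in> \<K>" "q ` H = q ` H'"
    show "H = H'" using Pq[OF a(1)] Pq[OF a(2)] unfolding a(3) by simp
  qed
  ultimately show ?thesis
    unfolding num_open_subgroups_def using finG by (intro card_inj_on_le)
qed

lemma (in magnus_coefficients) Stab_saturated:
  assumes "\<phi> \<in> Pol m" "k \<in> Stab \<phi>" "k' \<in> carrier F"
    "\<And>w. w \<in> words m \<Longrightarrow> [\<nu> w k = \<nu> w k'] (mod (int p))"
  shows "k' \<in> Stab \<phi>"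
proof -
  have k: "k \<in> carrier F" using assms(2) by (simp add: Stab_def)
  have "[\<phi> (f \<otimes> k' \<otimes> g) = \<phi> (f \<otimes> g)] (mod (int p))" if fg: "f \<in> carrier F" "g \<in> carrier F" for f g
  proof -
    have "(\<lambda>h. \<phi> (f \<otimes> h \<otimes> g)) \<in> Pol m"
      by (rule Pol_translate_left[OF Pol_translate_right[OF assms(1) fg(2)] fg(1)])
    from Pol_separated[OF this k assms(3,4)]
    have "[\<phi> (f \<otimes> k \<otimes> g) = \<phi> (f \<otimes> k' \<otimes> g)] (mod (int p))" by blast
    from cong_trans[OF cong_sym[OF this] StabD[OF assms(2) fg]] show ?thesis .
  qed
  then show ?thesis using assms(3) unfolding Stab_def Inv_def by blast
qed

text \<open>Membership in \<open>lvl n\<close> and the value of \<phi> both depend on finitely many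
  coefficients. In the topology of F this gives openness.\<close>

lemma (in golod_shafarevich_coefficients) kers_saturated:
  assumes "H \<in> kers n"
  obtains j where "\<And>f g. f \<in> H \<Longrightarrow> g \<in> carrier F \<Longrightarrow>
    (\<And>w. w \<in> words j \<Longrightarrow> [\<nu> w f = \<nu> w g] (mod (int p))) \<Longrightarrow> g \<in> H"
proof -
  obtain \<phi> i where \<phi>: "\<phi> \<in> Pol i" "H = {k \<in> lvl n. [\<phi> k = \<phi> \<one>] (mod (int p))}"
    using kers_props(4)[OF assms] by blast
  show ?thesis
  proof (rule that[of "max n i"])
    fix f g assume f: "f \<in> H" and g: "g \<in> carrier F"
      and eq: "\<And>w. w \<in> words (max n i) \<Longrightarrow> [\<nu> w f = \<nu> w g] (mod (int p))"
    have eqn: "[\<nu> w f = \<nu> w g] (mod (int p))" if "w \<in> words n" for w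
      using eq[of w] words_mono[of n "max n i"] that by auto
    have eqi: "[\<nu> w f = \<nu> w g] (mod (int p))" if "w \<in> words i" for w
      using eq[of w] words_mono[of i "max n i"] that by auto
    have fl: "f \<in> lvl n" "[\<phi> f = \<phi> \<one>] (mod (int p))" using f \<phi>(2) by auto
    then have fc: "f \<in> carrier F" using lvl_subset by auto
    have "g \<in> Stab \<psi>" if \<psi>: "\<psi> \<in> Pol n \<inter> Inv R" for \<psi>
      using Stab_saturated[of \<psi> n f g] \<psi> fl(1) g eqn unfolding lvl_def by blast
    then have "g \<in> lvl n" unfolding lvl_def using g by blast
    moreover have "[\<phi> g = \<phi> \<one>] (mod (int p))"
      by (rule cong_trans[OF cong_sym[OF Pol_separated[OF \<phi>(1) fc g eqi]] fl(2)])
    ultimately show "g \<in> H" unfolding \<phi>(2) by blast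
  qed
qed

lemma (in golod_shafarevich_coefficients) kers_index:
  assumes "H \<in> kers n" "n > 0"
  shows "card (rcosets H) = p ^ Suc (\<Sum>i\<in>{1..<n}. cdim i)"
proof -
  have "card ((\<lambda>a. H #> a) ` carrier F)
      = card ((\<lambda>a. lvl n #> a) ` carrier F) * card ((\<lambda>a. H #> a) ` lvl n)"
    by (rule card_cosets_tower[OF kers_props(1)[OF assms(1)] lvl_subgroup subgroup_self
          kers_props(2)[OF assms(1)] lvl_subset])
  moreover have "card ((\<lambda>a. lvl n #> a) ` carrier F) = p ^ (\<Sum>i\<in>{1..<n}. cdim i)"
    using index_lvl[of 1 n] assms(2) by (simp add: lvl_1)
  ultimately show ?thesis
    using kers_props(3)[OF assms(1)] by (simp add: rcosets_eq_image)
qed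

theorem theoremB1:
  fixes p :: nat and G :: "'g monoid" and T :: "'g topology"
  assumes "prime p"
    and "GGS_group p G T"
  shows "\<exists>\<beta>::real. \<beta> > 0 \<and>
    infinite {m::nat. log 2 (log 2 (real (num_open_subgroups G T m))) \<ge> (log 2 (real m)) powr \<beta>}"
proof -
  from assms(2) obtain F :: "continuum monoid" and TF X R where
    G: "pro_p_group p G T" and P: "pro_p_presentation p F TF X R"
    and pres: "presented_by G T F TF R" and GGS: "GGS_condition p F TF X R"
    unfolding GGS_group_def by blast
  interpret G: pro_p_group p G T by (rule G)
  interpret P: pro_p_presentation p F TF X R by (rule P)
  obtain \<Delta> t\<^sub>0 where \<Delta>: "degree_function p F TF X \<Delta>" and t\<^sub>0: "0 < t\<^sub>0" "t\<^sub>0 < 1"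
    and sum: "(\<lambda>r. enat_power t\<^sub>0 (\<Delta> r)) summable_on R"
    and neg: "1 - (\<Sum>x\<in>X. enat_power t\<^sub>0 (\<Delta> x)) + (\<Sum>\<^sub>\<infinity>r\<in>R. enat_power t\<^sub>0 (\<Delta> r)) < 0"
    using GGS unfolding GGS_condition_def by blast
  obtain \<mu> d where \<mu>: "magnus_embedding p F TF X \<mu>" and d: "series_degree_function p X d"
    and \<Delta>d: "\<And>f. f \<in> carrier F \<Longrightarrow> \<Delta> f = d (\<mu> f \<ominus>\<^bsub>Fp_series p X\<^esub> \<one>\<^bsub>Fp_series p X\<^esub>)"
    using \<Delta> unfolding degree_function_def by blast
  interpret M: magnus_embedded_group p F TF X \<mu>
    by (intro magnus_embedded_group.intro continuum_free_pro_p_group.intro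
        P.free_pro_p_group_axioms magnus_embedded_group_axioms.intro assms(1) \<mu>)
  define D where "D x = the_enat (d (M.monom [x]))" for x
  have D: "d (M.monom [x]) = enat (D x)" "D x > 0" if "x \<in> X" for x
    using M.degree_gen[OF d that] by (auto simp: D_def zero_enat_def)
  have \<Delta>X: "\<Delta> x = enat (D x)" if "x \<in> X" for x
    using \<Delta>d[of x] M.degree_generator[OF d that] D(1)[OF that] that P.basis_subset by auto
  interpret C: magnus_coefficients F p X D "\<lambda>w f. \<mu> f w"
    by (rule M.magnus_coefficients) (rule D(2))
  \<comment> \<open>A relator of infinite degree is trivial; without such relators the degrees are
    natural numbers.\<close>
  define R' where "R' = {r \<in> R. \<Delta> r \<noteq> \<infinity>}"
  define e where "e r = the_enat (\<Delta> r)" for r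
  define H where "H = (\<Sum>\<^sub>\<infinity>r\<in>R. enat_power t\<^sub>0 (\<Delta> r))"
  have e: "\<Delta> r = enat (e r)" if "r \<in> R'" for r using that by (auto simp: R'_def e_def)
  have R'R: "R' \<subseteq> R" "R' \<subseteq> carrier F" using P.relators_subset by (auto simp: R'_def)
  have H: "(\<Sum>r\<in>A. t\<^sub>0 ^ e r) \<le> H" if A: "finite A" "A \<subseteq> R'" for A
  proof -
    have "(\<Sum>r\<in>A. t\<^sub>0 ^ e r) = (\<Sum>r\<in>A. enat_power t\<^sub>0 (\<Delta> r))"
      using A e by (intro sum.cong) (auto simp: enat_power_def)
    also have "\<dots> \<le> H" unfolding H_def
      using A R'R t\<^sub>0 by (intro finite_sum_le_infsum sum) (auto simp: enat_power_def split: enat.split)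
    finally show ?thesis .
  qed
  \<comment> \<open>Each of these relators contributes at least \<open>t\<^sub>0 ^ i\<close> to sums
    bounded by H.\<close>
  have fin_R: "finite {r \<in> R'. e r < i}" for i
  proof -
    have "card A \<le> nat \<lceil>H / t\<^sub>0 ^ i\<rceil>" if A: "A \<subseteq> {r \<in> R'. e r < i}" "finite A" for A
    proof -
      have "card A * t\<^sub>0 ^ i = (\<Sum>r\<in>A. t\<^sub>0 ^ i)" by simp
      also have "\<dots> \<le> (\<Sum>r\<in>A. t\<^sub>0 ^ e r)"
        using A t\<^sub>0 by (intro sum_mono power_decreasing) auto
      also have "\<dots> \<le> H" using A by (intro H) auto
      finally have "card A \<le> H / t\<^sub>0 ^ i" using t\<^sub>0 by (simp add: pos_le_divide_eq)
      then show ?thesis by linarith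
    qed
    then show ?thesis using finite_if_finite_subsets_card_bdd by blast
  qed
  interpret C: golod_shafarevich_coefficients F p X D "\<lambda>w f. \<mu> f w" R' e
  proof
    fix r w assume a: "r \<in> R'" "w \<in> lists X" "w \<noteq> []" "C.weight w < e r"
    have r: "r \<in> carrier F" using a R'R by auto
    have "enat (sum_list (map (\<lambda>x. the_enat (d (M.monom [x]))) w))
        < d (\<mu> r \<ominus>\<^bsub>Fp_series p X\<^esub> \<one>\<^bsub>Fp_series p X\<^esub>)"
      using a(4) unfolding e[OF a(1), unfolded \<Delta>d[OF r]] C.weight_def D_def by (simp only: enat_ord_simps)
    then have "\<mu> r w = 0" by (rule M.degree_relator[OF d r a(2,3)])
    then show "[\<mu> r w = 0] (mod (int p))" by simp
  qed (use R'R fin_R in auto)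
  \<comment> \<open>The stabiliser is normal, closed because it depends on finitely many
    coefficients, and contains all of R, the dropped relators being trivial.\<close>
  have Stab: "closed_normal_closure F TF R \<subseteq> C.Stab \<phi>" if \<phi>: "\<phi> \<in> C.Pol n" "\<phi> \<in> C.Inv R'" for \<phi> n
  proof -
    have "closedin TF (C.Stab \<phi>)"
    proof (rule M.closed_saturated[of "C.words n"])
      show "C.words n \<subseteq> lists X" using C.words_lists by blast
      show "g \<in> C.Stab \<phi>" if "f \<in> C.Stab \<phi>" "g \<in> carrier F" "M.agree (C.words n) f g" for f g
        using C.Stab_saturated[OF \<phi>(1) that(1,2)] that(3) unfolding M.agree_def by blast
    qed (auto simp: C.Stab_def)
    moreover have "R \<subseteq> C.Stab \<phi>"
    proof
      fix r assume r: "r \<in> R"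
      then have rc: "r \<in> carrier F" using P.relators_subset by auto
      show "r \<in> C.Stab \<phi>"
      proof (cases "\<Delta> r = \<infinity>")
        case True
        then have "r = \<one>\<^bsub>F\<^esub>" using M.degree_infinite[OF d rc] \<Delta>d[OF rc] by simp
        then show ?thesis using subgroup.one_closed[OF normal_imp_subgroup[OF C.Stab_normal]] by simp
      next
        case False
        then show ?thesis using C.Stab_iff[OF R'R(2)] \<phi>(2) r by (auto simp: R'_def)
      qed
    qed
    ultimately show ?thesis unfolding closed_normal_closure_def using C.Stab_normal by blast
  qed
  have kers: "subgroup K F \<and> openin TF K \<and> card (rcosets\<^bsub>F\<^esub> K) = p ^ Suc (\<Sum>i\<in>{1..<n}. C.cdim i)
      \<and> closed_normal_closure F TF R \<subseteq> K" if K: "K \<in> C.kers n" and n: "n > 0" for K n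
  proof (intro conjI)
    show sub: "subgroup K F" by (rule C.kers_props(1)[OF K])
    show "card (rcosets\<^bsub>F\<^esub> K) = p ^ Suc (\<Sum>i\<in>{1..<n}. C.cdim i)" by (rule C.kers_index[OF K n])
    obtain j where j: "\<And>f g. f \<in> K \<Longrightarrow> g \<in> carrier F \<Longrightarrow>
        (\<And>w. w \<in> C.words j \<Longrightarrow> [\<mu> f w = \<mu> g w] (mod (int p))) \<Longrightarrow> g \<in> K"
      using C.kers_saturated[OF K] by blast
    show "openin TF K"
    proof (rule M.open_saturated[of "C.words j"])
      show "C.words j \<subseteq> lists X" using C.words_lists by blast
      show "g \<in> K" if "f \<in> K" "g \<in> carrier F" "M.agree (C.words j) f g" for f g
        using j[OF that(1,2)] that(3) unfolding M.agree_def by blast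
    qed (use subgroup.subset[OF sub] in auto)
    obtain \<phi> i where \<phi>: "\<phi> \<in> C.Pol i" "\<phi> \<in> C.Inv R'"
      "K = {k \<in> C.lvl n. [\<phi> k = \<phi> \<one>\<^bsub>F\<^esub>] (mod (int p))}"
      using C.kers_props(4)[OF K] by blast
    show "closed_normal_closure F TF R \<subseteq> K"
    proof
      fix k assume k: "k \<in> closed_normal_closure F TF R"
      have ks: "k \<in> C.Stab \<psi>" if "\<psi> \<in> C.Pol m" "\<psi> \<in> C.Inv R'" for \<psi> m using Stab[OF that] k by blast
      have k\<phi>: "k \<in> C.Stab \<phi>" by (rule ks[OF \<phi>(1,2)])
      then have kc: "k \<in> carrier F" by (simp add: C.Stab_def)
      then have "k \<in> C.lvl n" unfolding C.lvl_def using ks by blast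
      moreover have "[\<phi> k = \<phi> \<one>\<^bsub>F\<^esub>] (mod (int p))"
        using C.StabD[OF k\<phi> P.one_closed P.one_closed] kc by simp
      ultimately show "k \<in> K" unfolding \<phi>(3) by blast
    qed
  qed
  show ?thesis
  proof (rule C.double_exponential_growth[OF t\<^sub>0 H])
    have "(\<Sum>x\<in>X. enat_power t\<^sub>0 (\<Delta> x)) = (\<Sum>x\<in>X. t\<^sub>0 ^ D x)"
      using \<Delta>X by (intro sum.cong) (auto simp: enat_power_def)
    then show "1 + H < (\<Sum>x\<in>X. t\<^sub>0 ^ D x)" using neg by (simp add: H_def)
    show "finite (C.kers n)" if n: "n > 0" for n
      by (rule finite_subset[OF _ M.finite_open_subgroups]) (use kers[OF _ n] in blast)
    show "card (C.kers n) \<le> num_open_subgroups G T (p ^ Suc (\<Sum>i\<in>{1..<n}. C.cdim i))" if n: "n > 0" for n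
      by (rule presented_num_open_subgroups[OF P.topological_group_axioms G.group_axioms
            P.relators_subset pres M.finite_open_subgroups kers[OF _ n]])
  qed
qed

end
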